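(* Let $\mathcal{M}$ be a complete Riemannian manifold, let $f\colon\mathcal{M}\to\mathbb{R}$ be twice continuously differentiable, let $x_0\in\mathcal{M}$ be arbitrary, and let $x_0,x_1,x_2,\ldots$ be the iterates (with trial steps $s_0,s_1,\ldots$) produced by the ARC algorithm (described in the context) with the exponential retraction $\mathrm{R}=\mathrm{Exp}$. Assume: (A1) there is a finite $f_{\mathrm{low}}$ with $f(x)\ge f_{\mathrm{low}}$ for all $x\in\mathcal{M}$; (A2) there is a constant $L$ such that at each iteration $k$, with $\hat f_k=f\circ\mathrm{Exp}_{x_k}$, $\hat f_k(s_k)-\big[\hat f_k(0)+\langle s_k,\nabla\hat f_k(0)\rangle+\frac12\langle s_k,\nabla^2\hat f_k(0)[s_k]\rangle\big]\le\frac L6\|s_k\|^3$; (A3) there is a constant $L'$ such that at each successful iteration $k$, $\|P_{s_k}^{-1}\mathrm{grad} f(\mathrm{Exp}_{x_k}(s_k))-\mathrm{grad} f(x_k)-\mathrm{Hess} f(x_k)[s_k]\|\le\frac{L'}2\|s_k\|^2$. Let $\varsigma_{\max}=\max\!\left(\varsigma_0,\frac{L\gamma_3}{2(1-\eta_2)}\right)$. Then for any $\varepsilon>0$, the total number of successful iterations $k$ such that $\|\mathrm{grad} f(x_{k+1})\|>\varepsilon$ is bounded above by $$K_1(\varepsilon)=\frac{3(f(x_0)-f_{\mathrm{low}})}{\eta_1\varsigma_{\min}}\left(\frac{L'}2+\theta+\varsigma_{\max}\right)^{1.5}\frac1{\varepsilon^{1.5}}.$$ Furthermore, $\lim_{k\to\infty}\|\mathrm{grad}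 f(x_k)\|=0$ (when the algorithm does not terminate, so that the sequence of iterates is infinite).
   Context: Notation. $\mathrm{T}_x\mathcal{M}$ is the tangent space at $x$ with Riemannian inner product $\langle\cdot,\cdot\rangle$ and norm $\|\cdot\|$; $\mathrm{grad} f$ and $\mathrm{Hess} f$ are the Riemannian gradient and Hessian; $\nabla,\nabla^2$ are the usual gradient and Hessian of functions on the Euclidean space $\mathrm{T}_x\mathcal{M}$; $\lambda_{\min}$ is the smallest eigenvalue. $\mathrm{Exp}$ is the Riemannian exponential map. For $s\in \mathrm{T}_x\mathcal{M}$, $P_s\colon\mathrm{T}_x\mathcal{M}\to\mathrm{T}_{\mathrm{Exp}_x(s)}\mathcal{M}$ is parallel transport along $t\mapsto\mathrm{Exp}_x(ts)$ from $t=0$ to $t=1$. ARC algorithm with retraction $\mathrm{R}$. Parameters: $\theta>0$, $\varsigma_{\min}>0$, $0<\eta_1\le\eta_2<1$, $0<\gamma_1<1<\gamma_2<\gamma_3$. Input: $x_0\in\mathcal{M}$, $\varsigma_0\ge\varsigma_{\min}$. For $k=0,1,2,\ldots$: let $\hat f_k=f\circ\mathrm{R}_{x_k}\colon\mathrm{T}_{x_k}\mathcal{M}\to\mathbb{R}$ and define $m_k(s)=\hat f_k(0)+\langle s,\nabla\hat f_k(0)\rangle+\frac12\langle s,\nabla^2\hat f_k(0)[s]\rangle+\frac{\varsigma_k}{3}\|s\|^3$. A subproblem solver returns any $s_k\in\mathrm{T}_{x_k}\mathcal{M}$ satisfying $m_k(s_k)\le m_k(0)$ and $\|\nabla m_k(s_k)\|\le\theta\|s_k\|^2$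 (optionally also $\lambda_{\min}(\nabla^2m_k(s_k))\ge-\theta\|s_k\|$). If $s_k=0$, terminate. Otherwise compute $\rho_k=\dfrac{f(x_k)-f(\mathrm{R}_{x_k}(s_k))}{m_k(0)-m_k(s_k)+\frac{\varsigma_k}{3}\|s_k\|^3}$. If $\rho_k\ge\eta_1$ (iteration $k$ is successful), set $x_{k+1}=\mathrm{R}_{x_k}(s_k)$; otherwise (unsuccessful) set $x_{k+1}=x_k$. Choose $\varsigma_{k+1}\in[\max(\varsigma_{\min},\gamma_1\varsigma_k),\varsigma_k]$ if $\rho_k\ge\eta_2$; $\varsigma_{k+1}\in[\varsigma_k,\gamma_2\varsigma_k]$ if $\rho_k\in[\eta_1,\eta_2)$; $\varsigma_{k+1}\in[\gamma_2\varsigma_k,\gamma_3\varsigma_k]$ if $\rho_k<\eta_1$. *)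

theory Defs
  imports "HOL-Analysis.Analysis"
begin

section \<open>Smooth manifolds\<close>

text \<open>\<open>Ck_on k f S\<close> is meant for open \<open>S\<close> only.\<close>

fun Ck_on :: "nat \<Rightarrow> ('e::real_normed_vector \<Rightarrow> 'b::real_normed_vector) \<Rightarrow> 'e set \<Rightarrow> bool" where
  "Ck_on 0 f S \<longleftrightarrow> continuous_on S f"
| "Ck_on (Suc k) f S \<longleftrightarrow>
     (\<forall>x\<in>S. f differentiable (at x)) \<and> (\<forall>v. Ck_on k (\<lambda>x. frechet_derivative f (at x) v) S)"

definition smooth_on :: "('e::real_normed_vector \<Rightarrow> 'b::real_normed_vector) \<Rightarrow> 'e set \<Rightarrow> bool" where
  "smooth_on f S \<longleftrightarrow> (\<forall>k. Ck_on k f S)"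

text \<open>A chart \<open>(U, \<phi>)\<close> consists of its domain and its coordinate map; the values of \<open>\<phi>\<close> outside
  \<open>U\<close> are irrelevant.\<close>

type_synonym ('a, 'e) chart = "'a set \<times> ('a \<Rightarrow> 'e)"

abbreviation chart_dom :: "('a, 'e) chart \<Rightarrow> 'a set" where "chart_dom c \<equiv> fst c"
abbreviation chart_map :: "('a, 'e) chart \<Rightarrow> 'a \<Rightarrow> 'e" where "chart_map c \<equiv> snd c"

definition chart_inv :: "('a, 'e) chart \<Rightarrow> 'e \<Rightarrow> 'a" where
  "chart_inv c = inv_into (chart_dom c) (chart_map c)"

definition is_chart :: "('a::topological_space, 'e::euclidean_space) chart \<Rightarrow> bool" where
  "is_chart c \<longleftrightarrow> open (chart_dom c) \<and> open (chart_map c ` chart_dom c) \<and>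
     homeomorphism (chart_dom c) (chart_map c ` chart_dom c) (chart_map c) (chart_inv c)"

definition smooth_atlas :: "('a::topological_space, 'e::euclidean_space) chart set \<Rightarrow> bool" where
  "smooth_atlas A \<longleftrightarrow> (\<forall>c\<in>A. is_chart c) \<and> (\<Union>c\<in>A. chart_dom c) = UNIV \<and>
     (\<forall>c\<in>A. \<forall>d\<in>A. smooth_on (chart_map d \<circ> chart_inv c) (chart_map c ` (chart_dom c \<inter> chart_dom d)))"

section \<open>Tangent spaces and Riemannian metrics\<close>

text \<open>The points of the manifold are the elements of the type \<open>'a\<close>. For every point \<open>x\<close> one chart
  \<open>chart_at M x\<close> around \<open>x\<close> is singled out, and a tangent vector at \<open>x\<close> is represented by its
  coordinates in that chart. So every tangent space has \<open>'e\<close> as its underlying vector space, and its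
  inner product is \<open>metric M x\<close>. The inner product and the norm of the type \<open>'e\<close> play no role besides
  providing the topology of \<open>'e\<close>.\<close>

record ('a, 'e) riem =
  charts :: "('a, 'e) chart set"
  metric :: "'a \<Rightarrow> 'e \<Rightarrow> 'e \<Rightarrow> real"

definition chart_at :: "('a, 'e) riem \<Rightarrow> 'a \<Rightarrow> ('a, 'e) chart" where
  "chart_at M x = (SOME c. c \<in> charts M \<and> x \<in> chart_dom c)"

text \<open>\<open>to_chart M c x v\<close> are the coordinates in the chart \<open>c\<close> of the tangent vector \<open>v\<close> at \<open>x\<close>;
  \<open>from_chart M c x\<close> is the inverse map.\<close>

definition to_chart :: "('a, 'e::euclidean_space) riem \<Rightarrow> ('a, 'e) chart \<Rightarrow> 'a \<Rightarrow> 'e \<Rightarrow> 'e" where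
  "to_chart M c x v =
     frechet_derivative (chart_map c \<circ> chart_inv (chart_at M x)) (at (chart_map (chart_at M x) x)) v"

definition from_chart :: "('a, 'e::euclidean_space) riem \<Rightarrow> ('a, 'e) chart \<Rightarrow> 'a \<Rightarrow> 'e \<Rightarrow> 'e" where
  "from_chart M c x u =
     frechet_derivative (chart_map (chart_at M x) \<circ> chart_inv c) (at (chart_map c x)) u"

definition metric_coord ::
  "('a, 'e::euclidean_space) riem \<Rightarrow> ('a, 'e) chart \<Rightarrow> 'e \<Rightarrow> 'e \<Rightarrow> 'e \<Rightarrow> real" where
  "metric_coord M c y v w =
     (let x = chart_inv c y in metric M x (from_chart M c x v) (from_chart M c x w))"

definition riemannian_manifold ::
  "('a::{t2_space, second_countable_topology}, 'e::euclidean_space) riem \<Rightarrow> bool" where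
  "riemannian_manifold M \<longleftrightarrow>
     smooth_atlas (charts M) \<and>
     (\<forall>x. bilinear (metric M x)) \<and>
     (\<forall>x v w. metric M x v w = metric M x w v) \<and>
     (\<forall>x v. v \<noteq> 0 \<longrightarrow> metric M x v v > 0) \<and>
     (\<forall>c\<in>charts M. \<forall>v w. smooth_on (\<lambda>y. metric_coord M c y v w) (chart_map c ` chart_dom c))"

definition tnorm :: "('a, 'e) riem \<Rightarrow> 'a \<Rightarrow> 'e \<Rightarrow> real" where
  "tnorm M x v = sqrt (metric M x v v)"

section \<open>Levi-Civita connection, geodesics, parallel transport\<close>

text \<open>The vector \<open>\<Gamma>\<^bsub>y\<^esub>(v, w)\<close> in the chart \<open>c\<close>, determined by the Koszul formula for constant
  coordinate vector fields.\<close>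

definition christoffel :: "('a, 'e::euclidean_space) riem \<Rightarrow> ('a, 'e) chart \<Rightarrow> 'e \<Rightarrow> 'e \<Rightarrow> 'e \<Rightarrow> 'e" where
  "christoffel M c y v w = (THE u. \<forall>z.
     2 * metric_coord M c y u z =
       frechet_derivative (\<lambda>y. metric_coord M c y w z) (at y) v
     + frechet_derivative (\<lambda>y. metric_coord M c y v z) (at y) w
     - frechet_derivative (\<lambda>y. metric_coord M c y v w) (at y) z)"

text \<open>\<open>cov_deriv M X x v\<close> is \<open>\<nabla>\<^sub>v X\<close> at \<open>x\<close>, computed in the chart \<open>chart_at M x\<close>, which is also the chart
  in which \<open>v\<close>, \<open>X x\<close> and the result are represented.\<close>

definition cov_deriv :: "('a, 'e::euclidean_space) riem \<Rightarrow> ('a \<Rightarrow> 'e) \<Rightarrow> 'a \<Rightarrow> 'e \<Rightarrow> 'e" where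
  "cov_deriv M X x v = (let c = chart_at M x in
     frechet_derivative (\<lambda>y. to_chart M c (chart_inv c y) (X (chart_inv c y))) (at (chart_map c x)) v
     + christoffel M c (chart_map c x) v (X x))"

text \<open>\<open>parallel_on M I \<gamma> V\<close>: the covariant derivative of the vector field \<open>V\<close> along the curve \<open>\<gamma>\<close>
  vanishes on \<open>I\<close>, that is, \<open>V' + \<Gamma>(\<gamma>', V) = 0\<close> in every chart.\<close>

definition parallel_on ::
  "('a, 'e::euclidean_space) riem \<Rightarrow> real set \<Rightarrow> (real \<Rightarrow> 'a) \<Rightarrow> (real \<Rightarrow> 'e) \<Rightarrow> bool" where
  "parallel_on M I \<gamma> V \<longleftrightarrow> (\<forall>t\<in>I. \<forall>c\<in>charts M. \<gamma> t \<in> chart_dom c \<longrightarrow>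
     ((\<lambda>\<tau>. to_chart M c (\<gamma> \<tau>) (V \<tau>)) has_vector_derivative
       - christoffel M c (chart_map c (\<gamma> t))
           (vector_derivative (chart_map c \<circ> \<gamma>) (at t within I)) (to_chart M c (\<gamma> t) (V t)))
     (at t within I))"

definition velocity :: "('a, 'e::euclidean_space) riem \<Rightarrow> (real \<Rightarrow> 'a) \<Rightarrow> real \<Rightarrow> 'e" where
  "velocity M \<gamma> t = vector_derivative (chart_map (chart_at M (\<gamma> t)) \<circ> \<gamma>) (at t)"

definition geodesic :: "('a::topological_space, 'e::euclidean_space) riem \<Rightarrow> (real \<Rightarrow> 'a) \<Rightarrow> bool" where
  "geodesic M \<gamma> \<longleftrightarrow> continuous_on UNIV \<gamma> \<and>
     (\<forall>t. \<forall>c\<in>charts M. \<gamma> t \<in> chart_dom c \<longrightarrow> (chart_map c \<circ> \<gamma>) differentiable (at t)) \<and>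
     parallel_on M UNIV \<gamma> (velocity M \<gamma>)"

text \<open>Completeness is geodesic completeness: every geodesic extends to all of the real line.\<close>

definition complete_manifold :: "('a::topological_space, 'e::euclidean_space) riem \<Rightarrow> bool" where
  "complete_manifold M \<longleftrightarrow> (\<forall>x v. \<exists>\<gamma>. geodesic M \<gamma> \<and> \<gamma> 0 = x \<and> velocity M \<gamma> 0 = v)"

definition Exp :: "('a::topological_space, 'e::euclidean_space) riem \<Rightarrow> 'a \<Rightarrow> 'e \<Rightarrow> 'a" where
  "Exp M x v = (THE \<gamma>. geodesic M \<gamma> \<and> \<gamma> 0 = x \<and> velocity M \<gamma> 0 = v) 1"

definition transport ::
  "('a::topological_space, 'e::euclidean_space) riem \<Rightarrow> 'a \<Rightarrow> 'e \<Rightarrow> 'e \<Rightarrow> 'e" where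
  "transport M x s u =
     (THE w. \<exists>V. parallel_on M {0..1} (\<lambda>t. Exp M x (t *\<^sub>R s)) V \<and> V 0 = u \<and> V 1 = w)"

section \<open>Gradients and Hessians\<close>

definition C2_function :: "('a, 'e::euclidean_space) riem \<Rightarrow> ('a \<Rightarrow> real) \<Rightarrow> bool" where
  "C2_function M f \<longleftrightarrow> (\<forall>c\<in>charts M. Ck_on 2 (f \<circ> chart_inv c) (chart_map c ` chart_dom c))"

definition grad :: "('a, 'e::euclidean_space) riem \<Rightarrow> ('a \<Rightarrow> real) \<Rightarrow> 'a \<Rightarrow> 'e" where
  "grad M f x = (let c = chart_at M x in
     THE v. \<forall>w. metric M x v w = frechet_derivative (f \<circ> chart_inv c) (at (chart_map c x)) w)"

definition Hess :: "('a, 'e::euclidean_space) riem \<Rightarrow> ('a \<Rightarrow> real) \<Rightarrow> 'a \<Rightarrow> 'e \<Rightarrow> 'e" where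
  "Hess M f x s = cov_deriv M (grad M f) x s"

text \<open>\<open>egrad M x h\<close> and \<open>ehess M x h\<close> are the usual gradient and Hessian of a function \<open>h\<close> on the
  Euclidean space \<open>T\<^sub>xM\<close> with inner product \<open>metric M x\<close>.\<close>

definition egrad :: "('a, 'e::euclidean_space) riem \<Rightarrow> 'a \<Rightarrow> ('e \<Rightarrow> real) \<Rightarrow> 'e \<Rightarrow> 'e" where
  "egrad M x h u = (THE v. \<forall>w. metric M x v w = frechet_derivative h (at u) w)"

definition ehess :: "('a, 'e::euclidean_space) riem \<Rightarrow> 'a \<Rightarrow> ('e \<Rightarrow> real) \<Rightarrow> 'e \<Rightarrow> 'e \<Rightarrow> 'e" where
  "ehess M x h u s = frechet_derivative (egrad M x h) (at u) s"

section \<open>Adaptive regularization with cubics\<close>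

definition taylor2 :: "('a, 'e::euclidean_space) riem \<Rightarrow> 'a \<Rightarrow> ('e \<Rightarrow> real) \<Rightarrow> 'e \<Rightarrow> real" where
  "taylor2 M x h s = h 0 + metric M x s (egrad M x h 0) + 1 / 2 * metric M x s (ehess M x h 0 s)"

definition arc_model ::
  "('a, 'e::euclidean_space) riem \<Rightarrow> ('a \<Rightarrow> 'e \<Rightarrow> 'a) \<Rightarrow> ('a \<Rightarrow> real) \<Rightarrow> 'a \<Rightarrow> real \<Rightarrow> 'e \<Rightarrow> real" where
  "arc_model M R f x \<sigma> s = taylor2 M x (f \<circ> R x) s + \<sigma> / 3 * tnorm M x s ^ 3"

definition arc_ratio ::
  "('a, 'e::euclidean_space) riem \<Rightarrow> ('a \<Rightarrow> 'e \<Rightarrow> 'a) \<Rightarrow> ('a \<Rightarrow> real) \<Rightarrow> 'a \<Rightarrow> real \<Rightarrow> 'e \<Rightarrow> real" where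
  "arc_ratio M R f x \<sigma> s = (f x - f (R x s)) /
     (arc_model M R f x \<sigma> 0 - arc_model M R f x \<sigma> s + \<sigma> / 3 * tnorm M x s ^ 3)"

text \<open>Runs are infinite sequences of iterates \<open>x\<close>, steps \<open>s\<close> and regularization weights \<open>\<sigma>\<close>. The
  algorithm terminates at the first \<open>k\<close> with \<open>s k = 0\<close>; the entries after that (\<open>x j\<close>, \<open>s j\<close>, \<open>\<sigma> j\<close>
  for \<open>j > k\<close>) are unconstrained and must not be referred to. \<open>reached s k\<close> states that iteration
  \<open>k\<close> is actually entered.\<close>

definition reached :: "(nat \<Rightarrow> 'e::zero) \<Rightarrow> nat \<Rightarrow> bool" where
  "reached s k \<longleftrightarrow> (\<forall>j<k. s j \<noteq> 0)"

definition arc_run ::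
  "('a, 'e::euclidean_space) riem \<Rightarrow> ('a \<Rightarrow> 'e \<Rightarrow> 'a) \<Rightarrow> ('a \<Rightarrow> real) \<Rightarrow>
   real \<Rightarrow> real \<Rightarrow> real \<Rightarrow> real \<Rightarrow> real \<Rightarrow> real \<Rightarrow> real \<Rightarrow>
   (nat \<Rightarrow> 'a) \<Rightarrow> (nat \<Rightarrow> 'e) \<Rightarrow> (nat \<Rightarrow> real) \<Rightarrow> bool" where
  "arc_run M R f \<theta> \<sigma>min \<eta>1 \<eta>2 \<gamma>1 \<gamma>2 \<gamma>3 x s \<sigma> \<longleftrightarrow>
     \<sigma> 0 \<ge> \<sigma>min \<and>
     (\<forall>k. reached s k \<longrightarrow>
       (let m = arc_model M R f (x k) (\<sigma> k); \<rho> = arc_ratio M R f (x k) (\<sigma> k) (s k) in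
         m (s k) \<le> m 0 \<and>
         tnorm M (x k) (egrad M (x k) m (s k)) \<le> \<theta> * (tnorm M (x k) (s k))\<^sup>2 \<and>
         (s k \<noteq> 0 \<longrightarrow>
           x (Suc k) = (if \<rho> \<ge> \<eta>1 then R (x k) (s k) else x k) \<and>
           (\<rho> \<ge> \<eta>2 \<longrightarrow> \<sigma> (Suc k) \<in> {max \<sigma>min (\<gamma>1 * \<sigma> k) .. \<sigma> k}) \<and>
           (\<rho> \<in> {\<eta>1..<\<eta>2} \<longrightarrow> \<sigma> (Suc k) \<in> {\<sigma> k .. \<gamma>2 * \<sigma> k}) \<and>
           (\<rho> < \<eta>1 \<longrightarrow> \<sigma> (Suc k) \<in> {\<gamma>2 * \<sigma> k .. \<gamma>3 * \<sigma> k}))))"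

definition arc_successful ::
  "('a, 'e::euclidean_space) riem \<Rightarrow> ('a \<Rightarrow> 'e \<Rightarrow> 'a) \<Rightarrow> ('a \<Rightarrow> real) \<Rightarrow> real \<Rightarrow>
   (nat \<Rightarrow> 'a) \<Rightarrow> (nat \<Rightarrow> 'e) \<Rightarrow> (nat \<Rightarrow> real) \<Rightarrow> nat \<Rightarrow> bool" where
  "arc_successful M R f \<eta>1 x s \<sigma> k \<longleftrightarrow>
     reached s k \<and> s k \<noteq> 0 \<and> arc_ratio M R f (x k) (\<sigma> k) (s k) \<ge> \<eta>1"

end

theory Submission
  imports Defs
begin

text \<open>Write \<open>n\<close> for the length of the step of iteration \<open>k\<close>. The update rule for the weights keeps
  them between \<open>\<sigma>min\<close> and \<open>\<sigma>max\<close>, since by (A2) the ratio exceeds \<open>\<eta>2\<close> as soon as the weight exceeds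
  \<open>L / (2 (1 - \<eta>2))\<close>. A successful iteration decreases \<open>f\<close> by at least \<open>\<eta>1 \<sigma>min n\<^sup>3 / 3\<close>. By (A3), the
  first-order condition on the step and the isometry of parallel transport, the new gradient has norm
  at most \<open>(L' / 2 + \<theta> + \<sigma>max) n\<^sup>2\<close>. Telescoping gives the count. The limit follows because infinitely
  many iterations succeed: otherwise the weights would grow geometrically.

  The geometric input is that \<open>f \<circ> Exp\<^sub>x\<close> has gradient \<open>grad f x\<close> and Hessian \<open>Hess f x\<close> at the origin.
  This requires differentiating \<open>Exp\<^sub>x\<close> near the origin and its derivative at the origin. In a chart
  the geodesics are the solutions of a smooth first-order equation near an equilibrium, and comparing
  two solutions with a solution of the linearized equation leaves a quadratic error.\<close>

section \<open>Functions of class \<open>C\<^sup>k\<close>\<close>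

text \<open>\<open>Exp\<close> is a definite description of global geodesics, so its smoothness is
  not given, and a geodesic may leave the chart in which it starts. Small initial velocities are
  therefore shown to keep it in one chart up to time 1. As \<open>f\<close> is only C^2, three facts
  on the coordinate form F of \<open>Exp M x\<close> are used: F has a derivative F'(u) at each
  small u, F'(0) is the identity, and u \<mapsto> F'(u) w has derivative - \<Gamma>(u, w) at 0. The
  last one yields precisely the correction that distinguishes \<open>Hess\<close> from the second
  derivative in coordinates. The equilibrium is the state of velocity 0, where the linearized
  equation has constant coefficients and both variations are polynomials in t. Christoffel symbols
  and both kinds of gradient are vectors determined by their metric products, so one treatment of
  linear systems with a parameter covers their existence and regularity. Parallel fields cross
  charts, which is why the transformation law of the Christoffel symbols is proved. The exponent 1.5
  arises because the gradient is bounded by a multiple of n^2 and the decrease of \<open>f\<close>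
  from below by one of n^3.\<close>

abbreviation fder :: "('e::real_normed_vector \<Rightarrow> 'b::real_normed_vector) \<Rightarrow> 'e \<Rightarrow> 'e \<Rightarrow> 'b" where
  "fder f x \<equiv> frechet_derivative f (at x)"

lemma fder_eqI: "(f has_derivative f') (at x) \<Longrightarrow> fder f x = f'"
  using frechet_derivative_at by metis

lemma fder_works: "f differentiable (at x) \<Longrightarrow> (f has_derivative fder f x) (at x)"
  using frechet_derivative_works by blast

lemma has_derivative_eqI:
  "(f has_derivative f') F \<Longrightarrow> (\<And>h. f' h = g' h) \<Longrightarrow> (f has_derivative g') F"
  by (metis ext)

text \<open>Openness of \<open>S\<close> makes each derivative depend on values in \<open>S\<close>
  only, so equality on \<open>S\<close> passes to the directional derivatives and the induction
  applies to them.\<close>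

lemma Ck_on_cong:
  assumes "open S" "\<forall>x\<in>S. f x = g x" "Ck_on k f S"
  shows "Ck_on k g S"
  using assms(2,3)
proof (induction k arbitrary: f g)
  case 0
  then show ?case by (metis Ck_on.simps(1) continuous_on_cong)
next
  case (Suc k)
  have D: "(g has_derivative fder f x) (at x)" if "x \<in> S" for x
    using has_derivative_transform_within_open[OF _ assms(1) that, of f "fder f x" UNIV g] Suc.prems that
    by (auto simp: fder_works)
  have "Ck_on k (\<lambda>x. fder g x v) S" for v
    by (rule Suc.IH[of "\<lambda>x. fder f x v"]) (use Suc.prems fder_eqI[OF D] in auto)
  then show ?case using D by (auto simp: differentiable_def)
qed

text \<open>The derivative \<open>f'\<close> is known on \<open>S\<close> only, whereas
  \<open>frechet_derivative\<close> is a total function; \<open>Ck_on_cong\<close> exchanges the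
  two.\<close>

lemma Ck_on_Suc_has_derivativeI:
  assumes "open S" "\<And>x. x \<in> S \<Longrightarrow> (f has_derivative f' x) (at x)"
    and "\<And>v. Ck_on k (\<lambda>x. f' x v) S"
  shows "Ck_on (Suc k) f S"
proof -
  have "Ck_on k (\<lambda>x. fder f x v) S" for v
    by (rule Ck_on_cong[OF assms(1) _ assms(3)[of v]]) (simp add: fder_eqI[OF assms(2)])
  then show ?thesis using assms(2) by (auto simp: differentiable_def)
qed

lemma Ck_on_has_derivative: "Ck_on (Suc k) f S \<Longrightarrow> x \<in> S \<Longrightarrow> (f has_derivative fder f x) (at x)"
  by (auto simp: fder_works)

lemma Ck_on_fder: "Ck_on (Suc k) f S \<Longrightarrow> Ck_on k (\<lambda>x. fder f x v) S"
  by auto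

lemma Ck_on_linear_fder: "Ck_on (Suc k) f S \<Longrightarrow> x \<in> S \<Longrightarrow> linear (fder f x)"
  using Ck_on_has_derivative has_derivative_linear by blast

lemma Ck_on_Suc_imp: "Ck_on (Suc k) f S \<Longrightarrow> Ck_on k f S"
proof (induction k arbitrary: f)
  case 0
  then show ?case
    by (auto intro!: continuous_at_imp_continuous_on differentiable_imp_continuous_within)
next
  case (Suc k)
  then have "Ck_on k (\<lambda>x. fder f x v) S" for v
    using Ck_on_fder by blast
  then show ?case using Suc.prems by simp
qed

lemma Ck_on_le: "Ck_on n f S \<Longrightarrow> k \<le> n \<Longrightarrow> Ck_on k f S"
  by (induction n) (auto simp del: Ck_on.simps(2) simp: le_Suc_eq dest: Ck_on_Suc_imp)

lemma Ck_on_continuous: "Ck_on k f S \<Longrightarrow> continuous_on S f"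
  using Ck_on_le[of k f S 0] by simp

lemma Ck_on_const: "open S \<Longrightarrow> Ck_on k (\<lambda>x. c) S"
  by (induction k arbitrary: c) (auto intro!: Ck_on_Suc_has_derivativeI derivative_intros simp del: Ck_on.simps(2))

lemma Ck_on_bounded_linear: "bounded_linear L \<Longrightarrow> open S \<Longrightarrow> Ck_on k L S"
  by (cases k) (auto intro!: Ck_on_Suc_has_derivativeI bounded_linear_imp_has_derivative Ck_on_const
      linear_continuous_on simp del: Ck_on.simps(2))

lemma Ck_on_add:
  assumes "open S" "Ck_on k f S" "Ck_on k g S"
  shows "Ck_on k (\<lambda>x. f x + g x) S"
  using assms(2,3)
proof (induction k arbitrary: f g)
  case (Suc k)
  show ?case
    using Suc.prems
    by (intro Ck_on_Suc_has_derivativeI[OF assms(1) has_derivative_add] Suc.IH)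
      (auto intro: Ck_on_has_derivative Ck_on_fder simp del: Ck_on.simps(2))
qed (auto intro: continuous_intros)

lemma Ck_on_sum:
  assumes "open S" "\<And>i. i \<in> I \<Longrightarrow> Ck_on k (f i) S"
  shows "Ck_on k (\<lambda>x. \<Sum>i\<in>I. f i x) S"
  using assms(2)
  by (induction I rule: infinite_finite_induct) (auto intro!: Ck_on_const Ck_on_add assms(1))

text \<open>The product rule gives two products by the same \<open>pr\<close>, each with one factor
  differentiated. All factors are then of class C^k, so the induction closes with \<open>f\<close>
  and \<open>g\<close> arbitrary.\<close>

lemma Ck_on_bilinear:
  assumes B: "bounded_bilinear pr" and "open S" "Ck_on k f S" "Ck_on k g S"
  shows "Ck_on k (\<lambda>x. pr (f x) (g x)) S"
  using assms(3,4)
proof (induction k arbitrary: f g)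
  case 0
  then show ?case using bounded_bilinear.continuous_on[OF B] by simp
next
  case (Suc k)
  show ?case
    using Suc.prems
    by (intro Ck_on_Suc_has_derivativeI[OF assms(2) bounded_bilinear.FDERIV[OF B]] Ck_on_add[OF assms(2)] Suc.IH)
      (auto intro: Ck_on_has_derivative Ck_on_fder Ck_on_Suc_imp simp del: Ck_on.simps(2))
qed

lemmas Ck_on_scaleR = Ck_on_bilinear[OF bounded_bilinear_scaleR]
lemmas Ck_on_mult = Ck_on_bilinear[OF bounded_bilinear_mult]

lemma Ck_on_linear_comp:
  assumes "bounded_linear L" "open S" "Ck_on k f S"
  shows "Ck_on k (\<lambda>x. L (f x)) S"
  using assms(3)
proof (induction k arbitrary: f)
  case 0
  then show ?case using bounded_linear.continuous_on[OF assms(1)] by simp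
next
  case (Suc k)
  show ?case
    using Suc.prems
    by (intro Ck_on_Suc_has_derivativeI[OF assms(2) bounded_linear.has_derivative[OF assms(1)]] Suc.IH)
      (auto intro: Ck_on_has_derivative Ck_on_fder simp del: Ck_on.simps(2))
qed

lemma Ck_on_diff:
  assumes "open S" "Ck_on k f S" "Ck_on k g S"
  shows "Ck_on k (\<lambda>x. f x - g x) S"
  using Ck_on_add[OF assms(1,2) Ck_on_linear_comp[OF _ assms(1,3), of uminus]]
  by (simp add: bounded_linear_minus)

text \<open>For a linear inner map the direction \<open>L h\<close> of the outer derivative does not
  move with the point, so the induction closes without a chain rule for higher derivatives.\<close>

lemma Ck_on_comp_linear:
  assumes L: "bounded_linear L" and "open S" "Ck_on k f S"
  shows "Ck_on k (\<lambda>x. f (L x)) (L -` S)"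
  using assms(3)
proof (induction k arbitrary: f)
  case 0
  then show ?case
    using continuous_on_compose2[OF _ linear_continuous_on[OF L], of S f "L -` S"] by auto
next
  case (Suc k)
  have o: "open (L -` S)"
    using continuous_open_vimage[OF assms(2)] linear_continuous_at[OF L] by blast
  have "((\<lambda>x. f (L x)) has_derivative (\<lambda>h. fder f (L x) (L h))) (at x)" if "x \<in> L -` S" for x
    by (rule has_derivative_compose[OF bounded_linear_imp_has_derivative[OF L]])
      (use Ck_on_has_derivative[OF Suc.prems, of "L x"] that in simp)
  then show ?case
    by (rule Ck_on_Suc_has_derivativeI[OF o]) (use Suc.IH[OF Ck_on_fder[OF Suc.prems]] in auto)
qed

lemma Ck_on_Pair:
  assumes "open S" "Ck_on k f S" "Ck_on k g S"
  shows "Ck_on k (\<lambda>x. (f x, g x)) S"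
proof -
  have "bounded_linear (\<lambda>a. (a, 0))" "bounded_linear (\<lambda>b. (0, b))"
    by (auto intro: bounded_linear_Pair bounded_linear_ident bounded_linear_zero)
  from Ck_on_add[OF assms(1) Ck_on_linear_comp[OF this(1) assms(1,2)] Ck_on_linear_comp[OF this(2) assms(1,3)]]
  show ?thesis by simp
qed

section \<open>Linear maps through a basis; Lipschitz and Taylor estimates\<close>

lemma linear_basis_sum:
  fixes f :: "'e::euclidean_space \<Rightarrow> 'b::real_vector"
  assumes "linear f"
  shows "f h = (\<Sum>b\<in>Basis. (h \<bullet> b) *\<^sub>R f b)"
  by (metis (no_types, lifting) assms euclidean_representation linear_scale linear_sum sum.cong)

lemma linear_norm_le_basis:
  fixes f :: "'e::euclidean_space \<Rightarrow> 'b::real_normed_vector"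
  assumes "linear f"
  shows "norm (f h) \<le> (\<Sum>b\<in>Basis. norm (f b)) * norm h"
proof -
  have "norm (f h) \<le> (\<Sum>b\<in>Basis. norm ((h \<bullet> b) *\<^sub>R f b))"
    by (subst linear_basis_sum[OF assms]) (rule norm_sum)
  also have "\<dots> \<le> (\<Sum>b\<in>Basis. norm (f b) * norm h)"
    by (rule sum_mono) (metis Basis_le_norm mult.commute mult_left_mono norm_ge_zero norm_scaleR)
  finally show ?thesis by (simp add: sum_distrib_right)
qed

text \<open>Continuity of each \<open>A t v\<close> bounds it on the compact \<open>K\<close>;
  finitely many basis vectors then give one constant for all \<open>v\<close>.\<close>

lemma linear_family_bounded:
  fixes A :: "'t::topological_space \<Rightarrow> 'e::euclidean_space \<Rightarrow> 'b::real_normed_vector"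
  assumes K: "compact K" and lin: "\<And>t. t \<in> K \<Longrightarrow> linear (A t)" and cont: "\<And>v. continuous_on K (\<lambda>t. A t v)"
  obtains C where "C > 0" "\<And>t v. t \<in> K \<Longrightarrow> norm (A t v) \<le> C * norm v"
proof -
  have "\<exists>C\<ge>0. \<forall>t\<in>K. norm (A t v) \<le> C" for v
  proof -
    have "bounded ((\<lambda>t. A t v) ` K)"
      using K cont compact_continuous_image compact_imp_bounded by blast
    then obtain C where "\<forall>x\<in>(\<lambda>t. A t v) ` K. norm x \<le> C" unfolding bounded_iff by blast
    then show ?thesis by (intro exI[of _ "max 0 C"]) (auto simp: le_max_iff_disj)
  qed
  then obtain C where C: "\<And>b. C b \<ge> 0" "\<And>b t. t \<in> K \<Longrightarrow> norm (A t b) \<le> C b" by metis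
  show ?thesis
  proof (rule that[of "1 + (\<Sum>b\<in>Basis. C b)"])
    show "0 < 1 + (\<Sum>b\<in>Basis. C b)" by (simp add: C add_pos_nonneg sum_nonneg)
    fix t and v :: 'e assume t: "t \<in> K"
    have "(\<Sum>b\<in>Basis. norm (A t b)) \<le> (\<Sum>b\<in>Basis. C b)" using C(2)[OF t] by (intro sum_mono)
    then have "(\<Sum>b\<in>Basis. norm (A t b)) * norm v \<le> (1 + (\<Sum>b\<in>Basis. C b)) * norm v" by (intro mult_right_mono) auto
    then show "norm (A t v) \<le> (1 + (\<Sum>b\<in>Basis. C b)) * norm v"
      using linear_norm_le_basis[OF lin[OF t], of v] by simp
  qed
qed

lemma Ck_on_fder_bounded:
  fixes f :: "'e::euclidean_space \<Rightarrow> 'b::real_normed_vector"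
  assumes f: "Ck_on (Suc k) f S" and K: "compact K" "K \<subseteq> S"
  obtains C where "C > 0" "\<And>x h. x \<in> K \<Longrightarrow> norm (fder f x h) \<le> C * norm h"
  by (rule linear_family_bounded[OF K(1), of "fder f"])
    (use K(2) Ck_on_linear_fder[OF f] continuous_on_subset[OF Ck_on_continuous[OF Ck_on_fder[OF f]] K(2)] that in auto)

lemma Ck_on_lipschitz:
  fixes f :: "'e::euclidean_space \<Rightarrow> 'b::real_normed_vector"
  assumes "Ck_on (Suc k) f S" "compact K" "convex K" "K \<subseteq> S"
  obtains C where "C \<ge> 0" "\<And>x y. x \<in> K \<Longrightarrow> y \<in> K \<Longrightarrow> norm (f x - f y) \<le> C * norm (x - y)"
proof -
  obtain C where C: "C > 0" "\<And>x h. x \<in> K \<Longrightarrow> norm (fder f x h) \<le> C * norm h"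
    using Ck_on_fder_bounded[OF assms(1,2,4)] by metis
  have "norm (f x - f y) \<le> C * norm (x - y)" if "x \<in> K" "y \<in> K" for x y
    by (rule differentiable_bound[OF assms(3), of f "fder f"])
      (use that C assms in \<open>auto intro!: onorm_le has_derivative_at_withinI[OF Ck_on_has_derivative] simp del: Ck_on.simps(2)\<close>)
  with C(1) show thesis using that less_imp_le by blast
qed

text \<open>Each derivative along a basis vector is Lipschitz on \<open>K\<close>. Adding these
  constants bounds differences of derivatives as operators, and convexity permits the mean value
  estimate along the segment from \<open>x\<close> to \<open>y\<close>.\<close>

lemma Ck_on_2_taylor:
  fixes f :: "'e::euclidean_space \<Rightarrow> 'b::real_normed_vector"
  assumes f: "Ck_on (Suc (Suc k)) f S" and K: "compact K" "convex K" "K \<subseteq> S"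
  obtains C where "C \<ge> 0"
    "\<And>x y h. x \<in> K \<Longrightarrow> y \<in> K \<Longrightarrow> norm (fder f x h - fder f y h) \<le> C * norm (x - y) * norm h"
    "\<And>x y. x \<in> K \<Longrightarrow> y \<in> K \<Longrightarrow> norm (f y - f x - fder f x (y - x)) \<le> C * (norm (y - x))\<^sup>2"
proof -
  have "\<exists>C\<ge>0. \<forall>x\<in>K. \<forall>y\<in>K. norm (fder f x b - fder f y b) \<le> C * norm (x - y)" for b
    using Ck_on_lipschitz[OF Ck_on_fder[OF f, of b] K] by metis
  then obtain C where C: "\<And>b. C b \<ge> 0"
    "\<And>b x y. x \<in> K \<Longrightarrow> y \<in> K \<Longrightarrow> norm (fder f x b - fder f y b) \<le> C b * norm (x - y)" by metis
  define D where "D = (\<Sum>b\<in>Basis. C b)"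
  have D0: "D \<ge> 0" by (simp add: D_def C sum_nonneg)
  have D1: "norm (fder f x h - fder f y h) \<le> D * norm (x - y) * norm h" if xy: "x \<in> K" "y \<in> K" for x y h
  proof -
    have "linear (\<lambda>h. fder f x h - fder f y h)"
      using xy K(3) by (intro linear_compose_sub Ck_on_linear_fder[OF f]) auto
    then have "norm (fder f x h - fder f y h) \<le> (\<Sum>b\<in>Basis. norm (fder f x b - fder f y b)) * norm h"
      by (rule linear_norm_le_basis)
    also have "\<dots> \<le> (\<Sum>b\<in>Basis. C b * norm (x - y)) * norm h"
      using C xy by (intro mult_right_mono sum_mono) auto
    finally show ?thesis by (simp add: D_def sum_distrib_right)
  qed
  have D2: "norm (f y - f x - fder f x (y - x)) \<le> D * (norm (y - x))\<^sup>2" if xy: "x \<in> K" "y \<in> K" for x y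
  proof -
    have seg: "closed_segment x y \<subseteq> K" using xy K(2) closed_segment_subset by blast
    have "norm (f y - f x - fder f x (y - x)) \<le> norm (y - x) * (D * norm (y - x))"
    proof (rule differentiable_bound_linearization[where S="closed_segment x y" and f'="fder f"])
      show "x + t *\<^sub>R (y - x) \<in> closed_segment x y" if "t \<in> {0..1}" for t
        using that by (auto simp: closed_segment_def algebra_simps intro!: exI[of _ t])
      show "(f has_derivative fder f z) (at z within closed_segment x y)" if "z \<in> closed_segment x y" for z
        using that seg K f by (auto intro!: has_derivative_at_withinI[OF Ck_on_has_derivative] simp del: Ck_on.simps(2))
      show "onorm (fder f z - fder f x) \<le> D * norm (y - x)" if z: "z \<in> closed_segment x y" for z
      proof (rule onorm_le)
        fix h
        have "norm ((fder f z - fder f x) h) \<le> D * norm (z - x) * norm h"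
          using D1 z xy seg by auto
        also have "\<dots> \<le> D * norm (y - x) * norm h"
          using segment_bound1[OF z] D0 by (intro mult_right_mono mult_left_mono) auto
        finally show "norm ((fder f z - fder f x) h) \<le> D * norm (y - x) * norm h" .
      qed
    qed auto
    then show ?thesis by (simp add: power2_eq_square ac_simps)
  qed
  show thesis using that[OF D0 D1 D2] by blast
qed

text \<open>The second difference is symmetric in \<open>v\<close> and \<open>w\<close>, so
  uniqueness of limits will give the symmetry of second derivatives. The mean value theorem is
  applied twice, first along \<open>v\<close> to a difference between two parallel lines, then along
  \<open>w\<close>. This yields the mixed derivative at an intermediate point, and continuity does
  the rest.\<close>

lemma second_difference_tendsto:
  fixes f :: "'e::real_normed_vector \<Rightarrow> real"
  assumes f: "Ck_on (Suc (Suc 0)) f S" and S: "open S" "y \<in> S"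
  shows "((\<lambda>t. (f (y + t *\<^sub>R v + t *\<^sub>R w) - f (y + t *\<^sub>R v) - f (y + t *\<^sub>R w) + f y) / t\<^sup>2)
    \<longlongrightarrow> fder (\<lambda>x. fder f x v) y w) (at_right 0)"
proof (rule tendstoI)
  fix e :: real assume e: "e > 0"
  define g where "g x = fder (\<lambda>x. fder f x v) x w" for x
  have "continuous_on S g"
    unfolding g_def using Ck_on_fder[OF Ck_on_fder[OF f, of v], of w] by simp
  then have "open (g -` ball (g y) e \<inter> S)" using S continuous_on_open_vimage by blast
  then obtain r where r: "r > 0" "ball y r \<subseteq> g -` ball (g y) e \<inter> S"
    using S e by (metis IntI centre_in_ball open_contains_ball vimageI)
  \<comment> \<open>Chosen so that the parallelogram with coefficients below \<open>d\<close> lies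
    in the ball; the summand 1 keeps the denominator positive when \<open>v\<close> and
    \<open>w\<close> vanish.\<close>
  define d where "d = r / (1 + norm v + norm w)"
  have n: "1 + norm v + norm w > 0" by (smt (verit) norm_ge_zero)
  have d: "d > 0" using r n by (simp add: d_def)
  have near: "y + a *\<^sub>R v + b *\<^sub>R w \<in> ball y r" if "0 \<le> a" "a < d" "0 \<le> b" "b < d" for a b
  proof -
    have "norm (a *\<^sub>R v + b *\<^sub>R w) \<le> a * norm v + b * norm w"
      using that norm_triangle_ineq[of "a *\<^sub>R v" "b *\<^sub>R w"] by simp
    also have "\<dots> \<le> d * norm v + d * norm w" using that by (intro add_mono mult_right_mono) auto
    also have "\<dots> < d * (1 + norm v + norm w)" using d by (simp add: algebra_simps)
    also have "\<dots> = r" using n by (simp add: d_def)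
    finally have "dist (y + a *\<^sub>R v + b *\<^sub>R w) y < r" by (simp add: dist_norm add.assoc)
    then show ?thesis by (simp add: dist_commute)
  qed
  have "dist ((f (y + t *\<^sub>R v + t *\<^sub>R w) - f (y + t *\<^sub>R v) - f (y + t *\<^sub>R w) + f y) / t\<^sup>2) (g y) < e"
    if t: "0 < t" "t < d" for t
  proof -
    define \<phi> where "\<phi> s = f (y + s *\<^sub>R v + t *\<^sub>R w) - f (y + s *\<^sub>R v + 0 *\<^sub>R w)" for s
    define \<phi>' where "\<phi>' s = fder f (y + s *\<^sub>R v + t *\<^sub>R w) v - fder f (y + s *\<^sub>R v + 0 *\<^sub>R w) v" for s
    have fd: "((\<lambda>s. f (y + s *\<^sub>R v + b *\<^sub>R w)) has_real_derivative fder f (y + s *\<^sub>R v + b *\<^sub>R w) v) (at s)"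
      if "0 \<le> s" "s < d" "0 \<le> b" "b < d" for s b
    proof -
      have "y + s *\<^sub>R v + b *\<^sub>R w \<in> S" using near[OF that] r by auto
      then have *: "(f has_derivative fder f (y + s *\<^sub>R v + b *\<^sub>R w)) (at (y + s *\<^sub>R v + b *\<^sub>R w))"
        using Ck_on_has_derivative[OF f] by blast
      have "((\<lambda>s. f (y + s *\<^sub>R v + b *\<^sub>R w)) has_derivative (\<lambda>h. fder f (y + s *\<^sub>R v + b *\<^sub>R w) (h *\<^sub>R v))) (at s)"
        by (rule has_derivative_compose[where f="\<lambda>s. y + s *\<^sub>R v + b *\<^sub>R w", OF _ *]) (auto intro!: derivative_eq_intros)
      then show ?thesis unfolding has_field_derivative_def
        by (rule has_derivative_eqI)
          (use has_derivative_linear[OF *] in \<open>simp add: linear_scale\<close>)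
    qed
    have \<phi>d: "(\<phi> has_real_derivative \<phi>' s) (at s)" if "0 \<le> s" "s \<le> t" for s
      unfolding \<phi>_def \<phi>'_def using that t by (intro DERIV_diff fd) auto
    obtain \<xi> where \<xi>: "0 < \<xi>" "\<xi> < t" "\<phi> t - \<phi> 0 = (t - 0) * \<phi>' \<xi>"
      using MVT2[of 0 t \<phi> \<phi>'] t \<phi>d by blast
    define \<psi> where "\<psi> b = fder f (y + \<xi> *\<^sub>R v + b *\<^sub>R w) v" for b
    have gd: "(\<psi> has_real_derivative g (y + \<xi> *\<^sub>R v + b *\<^sub>R w)) (at b)" if "0 \<le> b" "b \<le> t" for b
    proof -
      have "y + \<xi> *\<^sub>R v + b *\<^sub>R w \<in> S" using near[of \<xi> b] that t \<xi> r by auto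
      then have *: "((\<lambda>x. fder f x v) has_derivative fder (\<lambda>x. fder f x v) (y + \<xi> *\<^sub>R v + b *\<^sub>R w)) (at (y + \<xi> *\<^sub>R v + b *\<^sub>R w))"
        using Ck_on_has_derivative[OF Ck_on_fder[OF f]] by blast
      have "(\<psi> has_derivative (\<lambda>h. fder (\<lambda>x. fder f x v) (y + \<xi> *\<^sub>R v + b *\<^sub>R w) (h *\<^sub>R w))) (at b)"
        unfolding \<psi>_def by (rule has_derivative_compose[where f="\<lambda>b. y + \<xi> *\<^sub>R v + b *\<^sub>R w", OF _ *]) (auto intro!: derivative_eq_intros)
      then show ?thesis unfolding has_field_derivative_def g_def
        by (rule has_derivative_eqI)
          (use has_derivative_linear[OF *] in \<open>simp add: linear_scale\<close>)
    qed
    obtain \<eta> where \<eta>: "0 < \<eta>" "\<eta> < t" "\<psi> t - \<psi> 0 = (t - 0) * g (y + \<xi> *\<^sub>R v + \<eta> *\<^sub>R w)"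
      using MVT2[of 0 t \<psi> "\<lambda>b. g (y + \<xi> *\<^sub>R v + b *\<^sub>R w)"] t gd by blast
    have "\<phi> t - \<phi> 0 = t * (t * g (y + \<xi> *\<^sub>R v + \<eta> *\<^sub>R w))"
      using \<xi>(3) \<eta>(3) unfolding \<psi>_def \<phi>'_def by simp
    then have "(f (y + t *\<^sub>R v + t *\<^sub>R w) - f (y + t *\<^sub>R v) - f (y + t *\<^sub>R w) + f y) / t\<^sup>2 = g (y + \<xi> *\<^sub>R v + \<eta> *\<^sub>R w)"
      unfolding \<phi>_def using t by (simp add: power2_eq_square field_simps)
    moreover have "y + \<xi> *\<^sub>R v + \<eta> *\<^sub>R w \<in> ball y r" using near \<xi> \<eta> t by auto
    ultimately show ?thesis using r by (auto simp: dist_commute)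
  qed
  then show "\<forall>\<^sub>F t in at_right 0. dist ((f (y + t *\<^sub>R v + t *\<^sub>R w) - f (y + t *\<^sub>R v) - f (y + t *\<^sub>R w) + f y) / t\<^sup>2) (fder (\<lambda>x. fder f x v) y w) < e"
    using d unfolding g_def eventually_at_right_field by blast
qed

lemma fder_fder_sym_real:
  fixes f :: "'e::real_normed_vector \<Rightarrow> real"
  assumes "Ck_on (Suc (Suc 0)) f S" "open S" "y \<in> S"
  shows "fder (\<lambda>x. fder f x v) y w = fder (\<lambda>x. fder f x w) y v"
  using second_difference_tendsto[OF assms, of v w] second_difference_tendsto[OF assms, of w v]
  by (intro tendsto_unique[OF _ second_difference_tendsto[OF assms, of v w]])
    (auto simp: algebra_simps)

text \<open>The inner product with a basis vector commutes with differentiation, which reduces the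
  claim to real-valued components.\<close>

lemma fder_fder_sym:
  fixes f :: "'e::real_normed_vector \<Rightarrow> 'b::euclidean_space"
  assumes f: "Ck_on (Suc (Suc 0)) f S" and S: "open S" "y \<in> S"
  shows "fder (\<lambda>x. fder f x v) y w = fder (\<lambda>x. fder f x w) y v"
proof (rule euclidean_eqI)
  fix b :: 'b assume "b \<in> Basis"
  have 1: "fder (\<lambda>x. f x \<bullet> b) x u = fder f x u \<bullet> b" if "x \<in> S" for x u
    using fder_eqI[OF has_derivative_inner_left[OF Ck_on_has_derivative[OF f that]]] by simp
  have 2: "fder (\<lambda>x. fder (\<lambda>x. f x \<bullet> b) x v) y w = fder (\<lambda>x. fder f x v) y w \<bullet> b" for v w
  proof -
    have "((\<lambda>x. fder f x v \<bullet> b) has_derivative (\<lambda>w. fder (\<lambda>x. fder f x v) y w \<bullet> b)) (at y)"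
      using has_derivative_inner_left[OF Ck_on_has_derivative[OF Ck_on_fder[OF f] S(2)]] .
    then have "((\<lambda>x. fder (\<lambda>x. f x \<bullet> b) x v) has_derivative (\<lambda>w. fder (\<lambda>x. fder f x v) y w \<bullet> b)) (at y)"
      using has_derivative_transform_within_open[OF _ S] 1 by (smt (verit))
    from fder_eqI[OF this] show ?thesis by simp
  qed
  have "Ck_on (Suc (Suc 0)) (\<lambda>x. f x \<bullet> b) S"
    using Ck_on_linear_comp[OF bounded_linear_inner_left S(1) f] .
  from fder_fder_sym_real[OF this S, of v w] show "fder (\<lambda>x. fder f x v) y w \<bullet> b = fder (\<lambda>x. fder f x w) y v \<bullet> b"
    by (simp add: 2)
qed

section \<open>Linear systems depending on a parameter\<close>

text \<open>Tangent metrics and their coordinate forms are both instances. The inner product of the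
  type \<open>'e\<close> is a different form and serves only as a reference for estimates.\<close>

definition inner_form :: "('e::real_vector \<Rightarrow> 'e \<Rightarrow> real) \<Rightarrow> bool" where
  "inner_form g \<longleftrightarrow> bilinear g \<and> (\<forall>v w. g v w = g w v) \<and> (\<forall>v. v \<noteq> 0 \<longrightarrow> g v v > 0)"

lemma inner_formD:
  assumes "inner_form g"
  shows "linear (g v)" "linear (\<lambda>v. g v w)" "bilinear g" "g v w = g w v" "v \<noteq> 0 \<Longrightarrow> g v v > 0" "0 \<le> g v v"
proof -
  show *: "linear (g v)" "linear (\<lambda>v. g v w)" "bilinear g" "g v w = g w v" "v \<noteq> 0 \<Longrightarrow> g v v > 0"
    using assms by (auto simp: inner_form_def bilinear_def)
  show "0 \<le> g v v"
    by (cases "v = 0") (use assms in \<open>auto simp: inner_form_def bilinear_rzero less_imp_le\<close>)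
qed

lemma inner_form_eqI:
  assumes "inner_form g" "\<And>w. g u w = g v w"
  shows "u = v"
proof (rule ccontr)
  assume "u \<noteq> v"
  then have "g (u - v) (u - v) > 0" using inner_formD(5)[OF assms(1)] by simp
  moreover have "g (u - v) (u - v) = 0"
    using assms(2) by (simp add: bilinear_lsub[OF inner_formD(3)[OF assms(1)]])
  ultimately show False by simp
qed

text \<open>Taking the products of \<open>u\<close> with the basis vectors is an injective linear
  map, hence surjective in finite dimension.\<close>

lemma inner_form_riesz:
  fixes g :: "'e::euclidean_space \<Rightarrow> 'e \<Rightarrow> real"
  assumes g: "inner_form g" and l: "linear l"
  shows "\<exists>!u. \<forall>w. g u w = l w"
proof -
  define T where "T u = (\<Sum>b\<in>Basis. g u b *\<^sub>R b)" for u
  have Tb: "T u \<bullet> b = g u b" if "b \<in> Basis" for u b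
    using that by (simp add: T_def inner_sum_left inner_Basis if_distrib sum.delta cong: if_cong)
  have ext: "(\<forall>w. g u w = l' w)" if "\<And>b. b \<in> Basis \<Longrightarrow> g u b = l' b" "linear l'" for u l'
    by (metis (no_types, lifting) inner_formD(1)[OF g] linear_eq_stdbasis that)
  have lin: "linear T"
    unfolding T_def using bilinear_ladd[OF inner_formD(3)[OF g]] bilinear_lmul[OF inner_formD(3)[OF g]]
    by (intro linearI) (auto simp: scaleR_add_left sum.distrib scaleR_right.sum)
  have "inj T"
  proof (rule injI)
    fix u v assume "T u = T v"
    then have "\<forall>w. g u w = g v w" using Tb ext[of u "g v"] inner_formD(1)[OF g] by metis
    then show "u = v" using inner_form_eqI[OF g] by blast
  qed
  then have "surj T" using lin linear_injective_imp_surjective by blast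
  then obtain u where "T u = (\<Sum>b\<in>Basis. l b *\<^sub>R b)" by (metis surjD)
  then have "g u b = l b" if "b \<in> Basis" for b
    using that Tb[of b u] by (simp add: inner_sum_left inner_Basis if_distrib sum.delta cong: if_cong)
  then show ?thesis using ext l inner_form_eqI[OF g] by metis
qed

text \<open>The same definite description occurs in \<open>grad\<close>, in \<open>egrad\<close>
  and, after halving, in \<open>christoffel\<close>, so facts about it serve all three.\<close>

definition riesz :: "('e \<Rightarrow> 'e \<Rightarrow> real) \<Rightarrow> ('e \<Rightarrow> real) \<Rightarrow> 'e" where
  "riesz g l = (THE u. \<forall>w. g u w = l w)"

lemma riesz:
  fixes g :: "'e::euclidean_space \<Rightarrow> 'e \<Rightarrow> real"
  assumes "inner_form g" "linear l"
  shows "g (riesz g l) w = l w"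
  using theI'[OF inner_form_riesz[OF assms]] unfolding riesz_def by blast

lemma riesz_unique:
  fixes g :: "'e::euclidean_space \<Rightarrow> 'e \<Rightarrow> real"
  assumes "inner_form g" "\<And>w. g u w = l w"
  shows "riesz g l = u"
  unfolding riesz_def
proof (rule the_equality)
  show "\<forall>w. g u w = l w" using assms(2) by blast
  show "v = u" if "\<forall>w. g v w = l w" for v
    by (rule inner_form_eqI[OF assms(1)]) (use that assms(2) in metis)
qed

section \<open>Bilinear and linear maps depending on a parameter\<close>

lemma bilinear_basis_sum:
  fixes g :: "'u::euclidean_space \<Rightarrow> 'v::euclidean_space \<Rightarrow> 'b::real_vector"
  assumes "bilinear g"
  shows "g v w = (\<Sum>i\<in>Basis. \<Sum>j\<in>Basis. ((v \<bullet> i) * (w \<bullet> j)) *\<^sub>R g i j)"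
proof -
  have "g v w = (\<Sum>i\<in>Basis. (v \<bullet> i) *\<^sub>R g i w)"
    using assms linear_basis_sum[of "\<lambda>v. g v w" v] by (simp add: bilinear_def)
  also have "\<dots> = (\<Sum>i\<in>Basis. (v \<bullet> i) *\<^sub>R (\<Sum>j\<in>Basis. (w \<bullet> j) *\<^sub>R g i j))"
    using assms linear_basis_sum[of "g _" w] by (simp add: bilinear_def)
  finally show ?thesis by (simp add: scaleR_right.sum)
qed

text \<open>On \<open>S\<close> the family is a finite combination of coefficient functions.
  Differentiating these will show that the derivative in the parameter is again bilinear in
  \<open>v\<close> and \<open>w\<close>.\<close>

lemma fder_bilinear_family_sum:
  fixes g :: "'y::real_normed_vector \<Rightarrow> 'u::euclidean_space \<Rightarrow> 'v::euclidean_space \<Rightarrow> 'b::real_normed_vector"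
  assumes S: "open S" "y \<in> S" and bil: "\<And>y. y \<in> S \<Longrightarrow> bilinear (g y)"
    and g: "\<And>v w. Ck_on (Suc k) (\<lambda>y. g y v w) S"
  shows "fder (\<lambda>y. g y v w) y h = (\<Sum>i\<in>Basis. \<Sum>j\<in>Basis. ((v \<bullet> i) * (w \<bullet> j)) *\<^sub>R fder (\<lambda>y. g y i j) y h)"
proof -
  have "((\<lambda>y. \<Sum>i\<in>Basis. \<Sum>j\<in>Basis. ((v \<bullet> i) * (w \<bullet> j)) *\<^sub>R g y i j) has_derivative
      (\<lambda>h. \<Sum>i\<in>Basis. \<Sum>j\<in>Basis. ((v \<bullet> i) * (w \<bullet> j)) *\<^sub>R fder (\<lambda>y. g y i j) y h)) (at y)"
    (is "(_ has_derivative ?D) _")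
    by (intro has_derivative_sum has_derivative_scaleR_right Ck_on_has_derivative[OF g S(2)])
  then have "((\<lambda>y. g y v w) has_derivative ?D) (at y)"
    by (rule has_derivative_transform_within_open[OF _ S]) (simp add: bilinear_basis_sum[OF bil, symmetric])
  from fder_eqI[OF this] show ?thesis by simp
qed

lemma bilinear_sum_inner:
  fixes c :: "'u::euclidean_space \<Rightarrow> 'v::euclidean_space \<Rightarrow> 'b::real_vector"
  shows "bilinear (\<lambda>v w. \<Sum>i\<in>Basis. \<Sum>j\<in>Basis. ((v \<bullet> i) * (w \<bullet> j)) *\<^sub>R c i j)"
  unfolding bilinear_def
  by (intro conjI allI linearI)
    (simp_all only: inner_add_left inner_scaleR_left distrib_left distrib_right scaleR_add_left sum.distrib
      scaleR_right.sum scaleR_scaleR mult.assoc mult.left_commute)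

lemma bilinear_fder_family:
  fixes g :: "'y::real_normed_vector \<Rightarrow> 'u::euclidean_space \<Rightarrow> 'v::euclidean_space \<Rightarrow> 'b::real_normed_vector"
  assumes S: "open S" "y \<in> S" and bil: "\<And>y. y \<in> S \<Longrightarrow> bilinear (g y)"
    and g: "\<And>v w. Ck_on (Suc k) (\<lambda>y. g y v w) S"
  shows "bilinear (\<lambda>v w. fder (\<lambda>y. g y v w) y h)"
proof -
  have "fder (\<lambda>y. g y v w) y h = (\<Sum>i\<in>Basis. \<Sum>j\<in>Basis. ((v \<bullet> i) * (w \<bullet> j)) *\<^sub>R fder (\<lambda>y. g y i j) y h)" for v w
    by (rule fder_bilinear_family_sum[OF S bil g])
  then have "(\<lambda>v w. fder (\<lambda>y. g y v w) y h)
      = (\<lambda>v w. \<Sum>i\<in>Basis. \<Sum>j\<in>Basis. ((v \<bullet> i) * (w \<bullet> j)) *\<^sub>R fder (\<lambda>y. g y i j) y h)" by blast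
  then show ?thesis by (rule ssubst[where P=bilinear, OF _ bilinear_sum_inner])
qed

text \<open>Regularity of \<open>g\<close> is known only for fixed \<open>v\<close> and
  \<open>w\<close>. Expanding in bases separates the moving arguments from the coefficients, so the
  ordinary product rule suffices. The filter within \<open>T\<close> admits end points of time
  intervals.\<close>

lemma has_derivative_bilinear_family:
  fixes g :: "'y::real_normed_vector \<Rightarrow> 'u::euclidean_space \<Rightarrow> 'v::euclidean_space \<Rightarrow> 'b::real_normed_vector"
  assumes S: "open S" "\<psi> x \<in> S" and bil: "\<And>y. y \<in> S \<Longrightarrow> bilinear (g y)"
    and g: "\<And>v w. Ck_on (Suc k) (\<lambda>y. g y v w) S"
    and \<psi>: "(\<psi> has_derivative \<psi>') (at x within T)" and a: "(a has_derivative a') (at x within T)"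
    and b: "(b has_derivative b') (at x within T)" and T: "x \<in> T"
  shows "((\<lambda>x. g (\<psi> x) (a x) (b x)) has_derivative
    (\<lambda>h. fder (\<lambda>y. g y (a x) (b x)) (\<psi> x) (\<psi>' h) + g (\<psi> x) (a' h) (b x) + g (\<psi> x) (a x) (b' h))) (at x within T)"
proof -
  have ev: "\<forall>\<^sub>F z in at x within T. \<psi> z \<in> S"
    using has_derivative_continuous[OF \<psi>] S by (auto simp: continuous_within topological_tendstoD)
  have gd: "((\<lambda>y. g y i j) has_derivative fder (\<lambda>y. g y i j) (\<psi> x)) (at (\<psi> x))" for i j
    using Ck_on_has_derivative[OF g S(2)] .
  have c: "((\<lambda>z. g (\<psi> z) i j) has_derivative (\<lambda>h. fder (\<lambda>y. g y i j) (\<psi> x) (\<psi>' h))) (at x within T)" for i j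
    by (rule has_derivative_compose[OF \<psi> gd])
  have "((\<lambda>z. \<Sum>i\<in>Basis. \<Sum>j\<in>Basis. ((a z \<bullet> i) * (b z \<bullet> j)) *\<^sub>R g (\<psi> z) i j) has_derivative
      (\<lambda>h. \<Sum>i\<in>Basis. \<Sum>j\<in>Basis. ((a x \<bullet> i) * (b x \<bullet> j)) *\<^sub>R fder (\<lambda>y. g y i j) (\<psi> x) (\<psi>' h)
        + ((a x \<bullet> i) * (b' h \<bullet> j) + (a' h \<bullet> i) * (b x \<bullet> j)) *\<^sub>R g (\<psi> x) i j)) (at x within T)"
    (is "(_ has_derivative ?D) _")
    by (intro has_derivative_sum has_derivative_scaleR has_derivative_mult has_derivative_inner_left a b c)
  then have "((\<lambda>z. g (\<psi> z) (a z) (b z)) has_derivative ?D) (at x within T)"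
  proof (rule has_derivative_transform_eventually)
    show "\<forall>\<^sub>F z in at x within T. (\<Sum>i\<in>Basis. \<Sum>j\<in>Basis. ((a z \<bullet> i) * (b z \<bullet> j)) *\<^sub>R g (\<psi> z) i j) = g (\<psi> z) (a z) (b z)"
      using ev by eventually_elim (simp add: bilinear_basis_sum[OF bil, symmetric])
  qed (use S T in \<open>auto simp: bilinear_basis_sum[OF bil, symmetric]\<close>)
  then show ?thesis
  proof (rule has_derivative_eqI)
    fix h
    have "(\<Sum>i\<in>Basis. \<Sum>j\<in>Basis. ((a x \<bullet> i) * (b x \<bullet> j)) *\<^sub>R fder (\<lambda>y. g y i j) (\<psi> x) (\<psi>' h))
        = fder (\<lambda>y. g y (a x) (b x)) (\<psi> x) (\<psi>' h)"
      by (rule fder_bilinear_family_sum[OF S bil g, symmetric])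
    moreover have "(\<Sum>i\<in>Basis. \<Sum>j\<in>Basis. ((a x \<bullet> i) * (b' h \<bullet> j)) *\<^sub>R g (\<psi> x) i j) = g (\<psi> x) (a x) (b' h)"
      "(\<Sum>i\<in>Basis. \<Sum>j\<in>Basis. ((a' h \<bullet> i) * (b x \<bullet> j)) *\<^sub>R g (\<psi> x) i j) = g (\<psi> x) (a' h) (b x)"
      using bilinear_basis_sum[OF bil[OF S(2)]] by metis+
    ultimately show "?D h = fder (\<lambda>y. g y (a x) (b x)) (\<psi> x) (\<psi>' h) + g (\<psi> x) (a' h) (b x) + g (\<psi> x) (a x) (b' h)"
      by (simp add: sum.distrib scaleR_add_left)
  qed
qed

text \<open>This is the bilinear rule for \<open>(r, w) \<mapsto> r *\<^sub>R A y w\<close>, with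
  the first argument constantly 1.\<close>

lemma has_derivative_linear_family:
  fixes A :: "'y::real_normed_vector \<Rightarrow> 'v::euclidean_space \<Rightarrow> 'b::real_normed_vector"
  assumes S: "open S" "\<psi> x \<in> S" and lin: "\<And>y. y \<in> S \<Longrightarrow> linear (A y)"
    and A: "\<And>w. Ck_on (Suc k) (\<lambda>y. A y w) S"
    and \<psi>: "(\<psi> has_derivative \<psi>') (at x within T)" and b: "(b has_derivative b') (at x within T)" and T: "x \<in> T"
  shows "((\<lambda>x. A (\<psi> x) (b x)) has_derivative
    (\<lambda>h. fder (\<lambda>y. A y (b x)) (\<psi> x) (\<psi>' h) + A (\<psi> x) (b' h))) (at x within T)"
proof -
  have bil: "bilinear (\<lambda>r w. r *\<^sub>R A y w)" if "y \<in> S" for y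
    using lin[OF that] by (auto simp: bilinear_def intro!: linearI simp: linear_add linear_scale algebra_simps)
  have "Ck_on (Suc k) (\<lambda>y. r *\<^sub>R A y w) S" for r :: real and w
    by (rule Ck_on_linear_comp[OF bounded_linear_scaleR_right S(1) A])
  from has_derivative_bilinear_family[where g="\<lambda>y r w. r *\<^sub>R A y w" and a="\<lambda>_. 1" and \<psi>=\<psi>, OF S bil this \<psi> has_derivative_const b T]
  show ?thesis by simp
qed

lemma linear_fder_family:
  fixes A :: "'y::real_normed_vector \<Rightarrow> 'v::euclidean_space \<Rightarrow> 'b::real_normed_vector"
  assumes S: "open S" "y \<in> S" and lin: "\<And>y. y \<in> S \<Longrightarrow> linear (A y)" and A: "\<And>w. Ck_on (Suc k) (\<lambda>y. A y w) S"
  shows "linear (\<lambda>w. fder (\<lambda>y. A y w) y h)"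
proof (rule linearI)
  have "fder (\<lambda>y. A y w) y h = (\<Sum>i\<in>Basis. (w \<bullet> i) *\<^sub>R fder (\<lambda>y. A y i) y h)" for w
  proof -
    have "((\<lambda>y. \<Sum>i\<in>Basis. (w \<bullet> i) *\<^sub>R A y i) has_derivative (\<lambda>h. \<Sum>i\<in>Basis. (w \<bullet> i) *\<^sub>R fder (\<lambda>y. A y i) y h)) (at y)"
      by (intro has_derivative_sum has_derivative_scaleR_right Ck_on_has_derivative[OF A S(2)])
    from has_derivative_transform_within_open[OF this S, of "\<lambda>y. A y w"] show ?thesis
      by (simp add: fder_eqI linear_basis_sum[OF lin, symmetric])
  qed
  note sum = this
  show "fder (\<lambda>y. A y (v + w)) y h = fder (\<lambda>y. A y v) y h + fder (\<lambda>y. A y w) y h" for v w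
    unfolding sum[of "v + w"] sum[of v] sum[of w] by (simp add: inner_add_left scaleR_add_left sum.distrib)
  show "fder (\<lambda>y. A y (r *\<^sub>R v)) y h = r *\<^sub>R fder (\<lambda>y. A y v) y h" for r v
    unfolding sum[of "r *\<^sub>R v"] sum[of v] by (simp add: scaleR_right.sum)
qed

lemma Ck_on_bilinear_family:
  fixes g :: "'y \<Rightarrow> 'u::euclidean_space \<Rightarrow> 'v::euclidean_space \<Rightarrow> 'b::real_normed_vector"
  assumes T: "open T" and bil: "\<And>x. x \<in> T \<Longrightarrow> bilinear (g (\<psi> x))"
    and g: "\<And>v w. Ck_on k (\<lambda>x. g (\<psi> x) v w) T" and a: "Ck_on k a T" and b: "Ck_on k b T"
  shows "Ck_on k (\<lambda>x. g (\<psi> x) (a x) (b x)) T"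
proof -
  have "Ck_on k (\<lambda>x. \<Sum>i\<in>Basis. \<Sum>j\<in>Basis. ((a x \<bullet> i) * (b x \<bullet> j)) *\<^sub>R g (\<psi> x) i j) T"
    by (intro Ck_on_sum Ck_on_scaleR Ck_on_mult T g Ck_on_linear_comp[OF bounded_linear_inner_left T] a b)
  then show ?thesis
    by (rule Ck_on_cong[OF T, rotated]) (simp add: bilinear_basis_sum[OF bil, symmetric])
qed

lemma Ck_on_linear_family:
  fixes A :: "'y \<Rightarrow> 'v::euclidean_space \<Rightarrow> 'b::real_normed_vector"
  assumes T: "open T" and lin: "\<And>x. x \<in> T \<Longrightarrow> linear (A (\<psi> x))"
    and A: "\<And>w. Ck_on k (\<lambda>x. A (\<psi> x) w) T" and b: "Ck_on k b T"
  shows "Ck_on k (\<lambda>x. A (\<psi> x) (b x)) T"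
proof -
  have "Ck_on k (\<lambda>x. \<Sum>i\<in>Basis. (b x \<bullet> i) *\<^sub>R A (\<psi> x) i) T"
    by (intro Ck_on_sum Ck_on_scaleR T A Ck_on_linear_comp[OF bounded_linear_inner_left T] b)
  then show ?thesis
    by (rule Ck_on_cong[OF T, rotated]) (simp add: linear_basis_sum[OF lin, symmetric])
qed

text \<open>A positive continuous function has a positive minimum on the compact unit sphere;
  homogeneity extends the bound to all vectors.\<close>

lemma inner_form_coercive:
  fixes g :: "'e::euclidean_space \<Rightarrow> 'e \<Rightarrow> real"
  assumes g: "inner_form g"
  shows "\<exists>c>0. \<forall>v. g v v \<ge> c * (norm v)\<^sup>2"
proof -
  have bb: "bounded_bilinear g"
    using inner_formD(3)[OF g] bilinear_conv_bounded_bilinear by blast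
  have "continuous_on (sphere 0 1) (\<lambda>v. g v v)"
    by (intro bounded_bilinear.continuous_on[OF bb] continuous_intros)
  moreover have "sphere (0::'e) 1 \<noteq> {}" by simp
  ultimately obtain m where m: "m \<in> sphere 0 1" "\<And>v. v \<in> sphere 0 1 \<Longrightarrow> g m m \<le> g v v"
    using continuous_attains_inf[of "sphere (0::'e) 1" "\<lambda>v. g v v"] compact_sphere by blast
  have "m \<noteq> 0" using m(1) by auto
  then have "g m m > 0" using inner_formD(5)[OF g] by blast
  moreover have "g v v \<ge> g m m * (norm v)\<^sup>2" for v
  proof (cases "v = 0")
    case False
    have "g m m \<le> g (v /\<^sub>R norm v) (v /\<^sub>R norm v)" using m(2) False by simp
    also have "\<dots> = g v v / (norm v)\<^sup>2"
      by (simp add: bilinear_lmul[OF inner_formD(3)[OF g]] bilinear_rmul[OF inner_formD(3)[OF g]] power2_eq_square divide_inverse)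
    finally show ?thesis using False by (simp add: field_simps)
  qed (use inner_formD(6)[OF g] in simp)
  ultimately show ?thesis by blast
qed

text \<open>The entries of \<open>g y\<close> converge to those of \<open>g0\<close>, so the
  quadratic forms eventually differ by at most half of the coercivity constant.\<close>

lemma inner_form_coercive_eventually:
  fixes g :: "'x \<Rightarrow> 'e::euclidean_space \<Rightarrow> 'e \<Rightarrow> real"
  assumes g0: "inner_form g0" and bil: "\<forall>\<^sub>F y in F. bilinear (g y)"
    and lim: "\<And>v w. ((\<lambda>y. g y v w) \<longlongrightarrow> g0 v w) F"
  shows "\<exists>c>0. \<forall>\<^sub>F y in F. \<forall>v. g y v v \<ge> c * (norm v)\<^sup>2"
proof -
  obtain c where c: "c > 0" "\<And>v. g0 v v \<ge> c * (norm v)\<^sup>2" using inner_form_coercive[OF g0] by blast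
  define d where "d y = (\<Sum>i\<in>Basis. \<Sum>j\<in>Basis. \<bar>g y i j - g0 i j\<bar>)" for y
  have "(d \<longlongrightarrow> (\<Sum>i::'e\<in>Basis. \<Sum>j::'e\<in>Basis. \<bar>g0 i j - g0 i j\<bar>)) F"
    unfolding d_def by (intro tendsto_intros lim)
  then have "\<forall>\<^sub>F y in F. d y < c / 2" using c(1) by (intro order_tendstoD(2)) auto
  then have "\<forall>\<^sub>F y in F. \<forall>v. g y v v \<ge> c / 2 * (norm v)\<^sup>2"
    using bil
  proof eventually_elim
    case (elim y)
    show ?case
    proof
      fix v :: 'e
      have "g y v v - g0 v v = (\<Sum>i\<in>Basis. \<Sum>j\<in>Basis. ((v \<bullet> i) * (v \<bullet> j)) *\<^sub>R (g y i j - g0 i j))"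
        unfolding bilinear_basis_sum[OF elim(2), of v] bilinear_basis_sum[OF inner_formD(3)[OF g0], of v]
        by (simp add: sum_subtractf algebra_simps)
      also have "\<bar>\<dots>\<bar> \<le> (\<Sum>i\<in>Basis. \<Sum>j\<in>Basis. (norm v)\<^sup>2 * \<bar>g y i j - g0 i j\<bar>)"
      proof (intro order_trans[OF sum_abs] sum_mono)
        fix i j :: 'e assume "i \<in> Basis" "j \<in> Basis"
        then have "\<bar>v \<bullet> i\<bar> * \<bar>v \<bullet> j\<bar> \<le> norm v * norm v" by (intro mult_mono Basis_le_norm) auto
        then show "\<bar>((v \<bullet> i) * (v \<bullet> j)) *\<^sub>R (g y i j - g0 i j)\<bar> \<le> (norm v)\<^sup>2 * \<bar>g y i j - g0 i j\<bar>"
          by (simp add: abs_mult power2_eq_square mult_right_mono)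
      qed
      also have "\<dots> = (norm v)\<^sup>2 * d y" by (simp add: d_def sum_distrib_left)
      also have "\<dots> \<le> (norm v)\<^sup>2 * (c / 2)" using elim(1) by (intro mult_left_mono) auto
      finally have "g0 v v - g y v v \<le> (norm v)\<^sup>2 * (c / 2)" by linarith
      then show "g y v v \<ge> c / 2 * (norm v)\<^sup>2" using c(2)[of v] by (simp add: field_simps)
    qed
  qed
  then show ?thesis using c(1) by (intro exI[of _ "c / 2"]) auto
qed

text \<open>Purpose: the error of an approximate solution is controlled by its residuals against
  basis vectors alone.\<close>

lemma norm_le_of_coercive:
  fixes g :: "'e::euclidean_space \<Rightarrow> 'e \<Rightarrow> real"
  assumes "linear (g a)" "c > 0" "g a a \<ge> c * (norm a)\<^sup>2"
  shows "norm a \<le> (\<Sum>b\<in>Basis. \<bar>g a b\<bar>) / c"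
proof (cases "a = 0")
  case False
  have "c * (norm a)\<^sup>2 \<le> (\<Sum>b\<in>Basis. norm (g a b)) * norm a"
    using assms(3) linear_norm_le_basis[OF assms(1), of a] by simp
  then have "c * norm a \<le> (\<Sum>b\<in>Basis. \<bar>g a b\<bar>)" using False by (simp add: power2_eq_square)
  then show ?thesis using assms(2) by (simp add: field_simps)
qed (use assms(2) in \<open>simp add: sum_nonneg\<close>)

text \<open>The error \<open>G y - G0\<close> solves the system with right-hand side
  \<open>l y w - g y G0 w\<close>, which tends to 0, and the coercivity constant does not depend on
  \<open>y\<close>.\<close>

lemma solve_tendsto:
  fixes g :: "'x \<Rightarrow> 'e::euclidean_space \<Rightarrow> 'e \<Rightarrow> real"
  assumes g0: "inner_form g0" and bil: "\<forall>\<^sub>F y in F. bilinear (g y)"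
    and lim: "\<And>v w. ((\<lambda>y. g y v w) \<longlongrightarrow> g0 v w) F"
    and l: "\<And>w. ((\<lambda>y. l y w) \<longlongrightarrow> g0 G0 w) F"
    and G: "\<forall>\<^sub>F y in F. \<forall>w. g y (G y) w = l y w"
  shows "(G \<longlongrightarrow> G0) F"
proof -
  obtain c where c: "c > 0" "\<forall>\<^sub>F y in F. \<forall>v. g y v v \<ge> c * (norm v)\<^sup>2"
    using inner_form_coercive_eventually[OF g0 bil lim] by blast
  have "((\<lambda>y. (\<Sum>b\<in>Basis. \<bar>l y b - g y G0 b\<bar>) / c) \<longlongrightarrow> (\<Sum>b::'e\<in>Basis. \<bar>g0 G0 b - g0 G0 b\<bar>) / c) F"
    using c(1) by (intro tendsto_intros l lim) auto
  then have "((\<lambda>y. (\<Sum>b\<in>Basis. \<bar>l y b - g y G0 b\<bar>) / c) \<longlongrightarrow> 0) F" by simp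
  then have "((\<lambda>y. G y - G0) \<longlongrightarrow> 0) F"
  proof (rule Lim_null_comparison[rotated])
    show "\<forall>\<^sub>F y in F. norm (G y - G0) \<le> (\<Sum>b\<in>Basis. \<bar>l y b - g y G0 b\<bar>) / c"
      using c(2) bil G
    proof eventually_elim
      case (elim y)
      have "g y (G y - G0) b = l y b - g y G0 b" for b
        using elim by (simp add: bilinear_lsub)
      moreover have "norm (G y - G0) \<le> (\<Sum>b\<in>Basis. \<bar>g y (G y - G0) b\<bar>) / c"
        using elim c(1) by (intro norm_le_of_coercive) (auto simp: bilinear_def)
      ultimately show ?case by simp
    qed
  qed
  then show ?thesis using Lim_null by blast
qed

text \<open>Implicit differentiation of \<open>g y (G y) w = l y w\<close> dictates
  \<open>D\<close>. Derivatives are required at \<open>y0\<close> only, which is what the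
  pulled-back gradient offers.\<close>

lemma solve_has_derivative:
  fixes g :: "'y::euclidean_space \<Rightarrow> 'e::euclidean_space \<Rightarrow> 'e \<Rightarrow> real"
  assumes g0: "inner_form (g y0)" and bil: "\<forall>\<^sub>F y in nhds y0. bilinear (g y)"
    and g': "\<And>v w. ((\<lambda>y. g y v w) has_derivative (\<lambda>h. g' h v w)) (at y0)"
    and l': "\<And>w. ((\<lambda>y. l y w) has_derivative (\<lambda>h. l' h w)) (at y0)"
    and G: "\<forall>\<^sub>F y in nhds y0. \<forall>w. g y (G y) w = l y w"
    and D: "linear D" "\<And>h w. g y0 (D h) w = l' h w - g' h (G y0) w"
  shows "(G has_derivative D) (at y0)"
proof -
  have lim: "((\<lambda>y. g y v w) \<longlongrightarrow> g y0 v w) (nhds y0)" for v w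
    using has_derivative_continuous[OF g', of v w] unfolding isCont_def
    by (rule tendsto_at_iff_tendsto_nhds[THEN iffD1])
  obtain c where c: "c > 0" "\<forall>\<^sub>F y in nhds y0. \<forall>v. g y v v \<ge> c * (norm v)\<^sup>2"
    using inner_form_coercive_eventually[OF g0 bil lim] by blast
  have bD: "bounded_linear D" using D(1) linear_conv_bounded_linear by blast
  \<comment> \<open>The residual of the remainder \<open>a\<close> defined next, with
    \<open>D\<close> written in basis coordinates so that the product rule applies. Its value and
    its derivative at \<open>y0\<close> vanish.\<close>
  define \<epsilon> where "\<epsilon> b y = l y b - g y (G y0) b - (\<Sum>i\<in>Basis. (D (y - y0) \<bullet> i) * g y i b)" for b y
  define a where "a y = G y - G y0 - D (y - y0)" for y
  have G0: "g y0 (G y0) w = l y0 w" for w using eventually_nhds_x_imp_x[OF G] by blast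
  have \<epsilon>0: "\<epsilon> b y0 = 0" for b using G0 linear_0[OF D(1)] by (simp add: \<epsilon>_def)
  have \<epsilon>: "(\<epsilon> b has_derivative (\<lambda>h. 0)) (at y0)" for b
  proof -
    have "((\<lambda>y. D (y - y0)) has_derivative D) (at y0)"
      by (rule has_derivative_eqI[OF bounded_linear.has_derivative[OF bD]]) (auto intro!: derivative_eq_intros)
    then have "(\<epsilon> b has_derivative (\<lambda>h. l' h b - g' h (G y0) b - (\<Sum>i\<in>Basis. (D (y0 - y0) \<bullet> i) * g' h i b + (D h \<bullet> i) * g y0 i b))) (at y0)"
      unfolding \<epsilon>_def
      by (intro has_derivative_diff l' g' has_derivative_sum has_derivative_mult has_derivative_inner_left)
    moreover have "l' h b - g' h (G y0) b - (\<Sum>i\<in>Basis. (D (y0 - y0) \<bullet> i) * g' h i b + (D h \<bullet> i) * g y0 i b) = 0" for h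
    proof -
      have "(\<Sum>i\<in>Basis. (D h \<bullet> i) * g y0 i b) = g y0 (D h) b"
        using linear_basis_sum[OF inner_formD(2)[OF g0, of b], of "D h"] by simp
      then show ?thesis using D linear_0[OF D(1)] by simp
    qed
    ultimately show ?thesis by (rule has_derivative_eqI)
  qed
  have le: "\<forall>\<^sub>F y in nhds y0. norm (a y) \<le> (\<Sum>b\<in>Basis. \<bar>\<epsilon> b y\<bar>) / c"
    using c(2) bil G
  proof eventually_elim
    case (elim y)
    have "g y (a y) b = \<epsilon> b y" for b
      using elim linear_basis_sum[of "\<lambda>v. g y v b" "D (y - y0)"]
      by (simp add: a_def \<epsilon>_def bilinear_lsub bilinear_def)
    moreover have "norm (a y) \<le> (\<Sum>b\<in>Basis. \<bar>g y (a y) b\<bar>) / c"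
      using elim c(1) by (intro norm_le_of_coercive) (auto simp: bilinear_def)
    ultimately show ?case by simp
  qed
  have "((\<lambda>y. norm (\<epsilon> b y) / norm (y - y0)) \<longlongrightarrow> 0) (at y0)" for b
  proof -
    have "((\<lambda>y. (\<epsilon> b y - \<epsilon> b y0 - 0) /\<^sub>R norm (y - y0)) \<longlongrightarrow> 0) (at y0)"
      using \<epsilon>[of b] unfolding has_derivative_at_within by blast
    from tendsto_norm_zero[OF this] show ?thesis
      by (simp add: \<epsilon>0 divide_inverse mult.commute abs_mult)
  qed
  then have "((\<lambda>y. (\<Sum>b\<in>Basis. norm (\<epsilon> b y) / norm (y - y0)) / c) \<longlongrightarrow> (\<Sum>b::'e\<in>Basis. 0) / c) (at y0)"
    using c(1) by (intro tendsto_intros) auto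
  then have lim0: "((\<lambda>y. (\<Sum>b\<in>Basis. norm (\<epsilon> b y) / norm (y - y0)) / c) \<longlongrightarrow> 0) (at y0)" by simp
  have "((\<lambda>y. a y /\<^sub>R norm (y - y0)) \<longlongrightarrow> 0) (at y0)"
  proof (rule Lim_null_comparison[OF _ lim0])
    have "\<forall>\<^sub>F y in at y0. norm (a y) \<le> (\<Sum>b\<in>Basis. \<bar>\<epsilon> b y\<bar>) / c"
      using le by (auto simp: eventually_at_filter elim: eventually_mono)
    then show "\<forall>\<^sub>F y in at y0. norm (a y /\<^sub>R norm (y - y0)) \<le> (\<Sum>b\<in>Basis. norm (\<epsilon> b y) / norm (y - y0)) / c"
    proof eventually_elim
      case (elim y)
      have "norm (a y) / norm (y - y0) \<le> (\<Sum>b\<in>Basis. \<bar>\<epsilon> b y\<bar>) / c / norm (y - y0)"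
        using elim by (intro divide_right_mono) auto
      then show ?case by (simp add: divide_inverse sum_distrib_right[symmetric] ac_simps)
    qed
  qed
  then show ?thesis using bD by (simp add: has_derivative_at_within a_def)
qed

text \<open>The derivative of a solution solves a system with the same forms \<open>g\<close> and a
  new right-hand side that involves the solution itself. The induction hypothesis is therefore used
  twice: for \<open>G\<close>, then for its directional derivatives.\<close>

lemma Ck_on_solve:
  fixes g :: "'y::euclidean_space \<Rightarrow> 'e::euclidean_space \<Rightarrow> 'e \<Rightarrow> real"
  assumes S: "open S" and gf: "\<And>y. y \<in> S \<Longrightarrow> inner_form (g y)"
    and gk: "\<And>v w. Ck_on k (\<lambda>y. g y v w) S"
    and "\<And>w. Ck_on k (\<lambda>y. l y w) S"
    and "\<And>y w. y \<in> S \<Longrightarrow> g y (G y) w = l y w"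
  shows "Ck_on k G S"
  using gk assms(4,5)
proof (induction k arbitrary: l G)
  case 0
  have "(G \<longlongrightarrow> G y) (at y)" if "y \<in> S" for y
  proof (rule solve_tendsto)
    have ev: "\<forall>\<^sub>F z in at y. z \<in> S" using S that by (simp add: eventually_at_in_open')
    show "inner_form (g y)" using gf that by blast
    show "\<forall>\<^sub>F z in at y. bilinear (g z)" using ev by eventually_elim (use gf inner_formD(3) in blast)
    show "\<forall>\<^sub>F z in at y. \<forall>w. g z (G z) w = l z w" using ev by eventually_elim (use 0 in blast)
    show "((\<lambda>z. g z v w) \<longlongrightarrow> g y v w) (at y)" for v w
      using 0(1) that S by (simp add: continuous_on_eq_continuous_at isCont_def)
    show "((\<lambda>z. l z w) \<longlongrightarrow> g y (G y) w) (at y)" for w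
      using 0 that S by (simp add: continuous_on_eq_continuous_at isCont_def)
  qed
  then show ?case using S by (simp add: continuous_on_eq_continuous_at isCont_def)
next
  case (Suc k)
  have Gk: "Ck_on k G S"
    using Suc.IH[of l G] Suc.prems by (blast intro: Ck_on_Suc_imp)
  \<comment> \<open>\<open>G y\<close> is expanded in the basis so that the C^k rules for sums and
    products apply; \<open>Leq\<close> recovers the form that implicit differentiation
    gives.\<close>
  define L where "L v y w = fder (\<lambda>y. l y w) y v - (\<Sum>i\<in>Basis. (G y \<bullet> i) * fder (\<lambda>y. g y i w) y v)" for v y w
  have g': "((\<lambda>z. g z v w) has_derivative (\<lambda>h. fder (\<lambda>y. g y v w) y h)) (at y)" if "y \<in> S" for v w y
    using Ck_on_has_derivative[OF Suc.prems(1) that] by simp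
  have bil: "bilinear (g y)" if "y \<in> S" for y using inner_formD(3)[OF gf[OF that]] .
  have g'bil: "bilinear (\<lambda>v w. fder (\<lambda>y. g y v w) y h)" if "y \<in> S" for y h
    by (rule bilinear_fder_family[OF S that bil Suc.prems(1)])
  have "linear (l y)" if "y \<in> S" for y
  proof -
    have "g y (G y) = l y" using Suc.prems(3)[OF that] by blast
    then show ?thesis using inner_formD(1)[OF gf[OF that], of "G y"] by simp
  qed
  then have l'lin: "linear (\<lambda>w. fder (\<lambda>y. l y w) y h)" if "y \<in> S" for y h
    by (rule linear_fder_family[OF S that _ Suc.prems(2)])
  have Leq: "L v y w = fder (\<lambda>y. l y w) y v - fder (\<lambda>z. g z (G y) w) y v" if "y \<in> S" for v y w
    using linear_basis_sum[of "\<lambda>u. fder (\<lambda>y. g y u w) y v" "G y"] g'bil[OF that] by (simp add: L_def bilinear_def)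
  have Llin: "linear (L v y)" if "y \<in> S" for v y
  proof -
    have "linear (\<lambda>w. fder (\<lambda>y. l y w) y v - fder (\<lambda>z. g z (G y) w) y v)"
      by (rule linear_compose_sub[OF l'lin[OF that]]) (use g'bil[OF that] in \<open>simp add: bilinear_def\<close>)
    moreover have "L v y = (\<lambda>w. fder (\<lambda>y. l y w) y v - fder (\<lambda>z. g z (G y) w) y v)"
      using Leq[OF that] by blast
    ultimately show ?thesis by simp
  qed
  define D where "D y v = riesz (g y) (L v y)" for y v
  have D: "g y (D y v) w = L v y w" if "y \<in> S" for y v w
    unfolding D_def using riesz gf Llin that by blast
  show ?case
  proof (rule Ck_on_Suc_has_derivativeI[OF S])
    fix y assume y: "y \<in> S"
    have ev: "\<forall>\<^sub>F z in nhds y. z \<in> S" using S y by (simp add: eventually_nhds_in_open)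
    show "(G has_derivative D y) (at y)"
    proof (rule solve_has_derivative)
      show "inner_form (g y)" using gf y by blast
      show "\<forall>\<^sub>F z in nhds y. bilinear (g z)" using ev by eventually_elim (use gf inner_formD(3) in blast)
      show "\<forall>\<^sub>F z in nhds y. \<forall>w. g z (G z) w = l z w" using ev by eventually_elim (use Suc.prems in blast)
      show "((\<lambda>z. g z v w) has_derivative (\<lambda>h. fder (\<lambda>y. g y v w) y h)) (at y)" for v w using g' y .
      show "((\<lambda>z. l z w) has_derivative (\<lambda>h. fder (\<lambda>y. l y w) y h)) (at y)" for w
        using Ck_on_has_derivative[OF Suc.prems(2) y] by simp
      show "g y (D y h) w = fder (\<lambda>y. l y w) y h - fder (\<lambda>z. g z (G y) w) y h" for h w
        using D[OF y] Leq[OF y] by simp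
      show "linear (D y)"
      proof (rule linearI)
        note bl = inner_formD(3)[OF gf[OF y]]
        have fl: "linear (\<lambda>h. fder (\<lambda>y. l y w) y h - fder (\<lambda>z. g z (G y) w) y h)" for w
          using linear_compose_sub[OF Ck_on_linear_fder[OF Suc.prems(2) y] Ck_on_linear_fder[OF Suc.prems(1) y]] .
        show "D y (a + b) = D y a + D y b" for a b
          by (rule inner_form_eqI[OF gf[OF y]])
            (use linear_add[OF fl] in \<open>simp add: D[OF y] Leq[OF y] bilinear_ladd[OF bl]\<close>)
        show "D y (c *\<^sub>R a) = c *\<^sub>R D y a" for a c
          by (rule inner_form_eqI[OF gf[OF y]])
            (use linear_scale[OF fl] in \<open>simp add: D[OF y] Leq[OF y] bilinear_lmul[OF bl]\<close>)
      qed
    qed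
  next
    fix v
    show "Ck_on k (\<lambda>y. D y v) S"
    proof (rule Suc.IH[of "L v"])
      show "Ck_on k (\<lambda>y. g y v w) S" for v w using Suc.prems(1) Ck_on_Suc_imp by blast
      show "g y (D y v) w = L v y w" if "y \<in> S" for y w using D that .
      show "Ck_on k (\<lambda>y. L v y w) S" for w
        unfolding L_def
        by (intro Ck_on_diff Ck_on_sum Ck_on_mult S Ck_on_fder[OF Suc.prems(2)] Ck_on_fder[OF Suc.prems(1)]
            Ck_on_linear_comp[OF bounded_linear_inner_left S Gk])
    qed
  qed
qed

section \<open>Ordinary differential equations\<close>

text \<open>Real induction: at the infimum of the failures \<open>left\<close> yields
  \<open>P\<close>, and \<open>right\<close> moves past it, a contradiction. It drives the
  continuation arguments along geodesics.\<close>

lemma real_induct_Icc: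
  fixes a b :: real
  assumes "P a"
    and right: "\<And>t. a \<le> t \<Longrightarrow> t < b \<Longrightarrow> \<forall>s\<in>{a..t}. P s \<Longrightarrow> \<exists>u>t. \<forall>s. t < s \<and> s \<le> u \<and> s \<le> b \<longrightarrow> P s"
    and left: "\<And>t. a < t \<Longrightarrow> t \<le> b \<Longrightarrow> \<forall>s\<in>{a..<t}. P s \<Longrightarrow> P t"
    and "t \<in> {a..b}"
  shows "P t"
proof (rule ccontr)
  assume "\<not> P t"
  define S where "S = {s \<in> {a..b}. \<not> P s}"
  have S: "S \<noteq> {}" "bdd_below S" using \<open>\<not> P t\<close> assms(4) by (auto simp: S_def)
  define m where "m = Inf S"
  have le: "m \<le> s" if "s \<in> S" for s using that S(2) by (simp add: m_def cInf_lower)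
  have am: "a \<le> m" unfolding m_def using S(1) by (intro cInf_greatest) (auto simp: S_def)
  have mb: "m \<le> b" using le S(1) by (force simp: S_def)
  have below: "P s" if "a \<le> s" "s < m" for s using le[of s] that mb by (force simp: S_def)
  have "P m"
    using left[of m] below mb am assms(1) by (cases "a = m") auto
  then have "m \<notin> S" by (simp add: S_def)
  obtain s0 where "s0 \<in> S" using S(1) by blast
  then have "m < s0" "s0 \<le> b" using le \<open>m \<notin> S\<close> by (metis order_le_less, auto simp: S_def)
  then have "m < b" by simp
  moreover have "\<forall>s\<in>{a..m}. P s" using below \<open>P m\<close> by (metis atLeastAtMost_iff order_le_less)
  ultimately obtain u where u: "u > m" "\<And>s. m < s \<Longrightarrow> s \<le> u \<Longrightarrow> s \<le> b \<Longrightarrow> P s"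
    using right[OF am] by blast
  obtain s where s: "s \<in> S" "s < u" using u(1) S cInf_less_iff[of S u] by (auto simp: m_def)
  then have "m < s" using le \<open>m \<notin> S\<close> by (metis order_le_less)
  then show False using u(2)[of s] s by (auto simp: S_def)
qed

text \<open>The squared norm is used because the norm itself need not be differentiable at 0. Adding
  \<open>B\<^sup>2\<close> absorbs the inhomogeneity through
  \<open>2 * norm (e s) * B \<le> (norm (e s))\<^sup>2 + B\<^sup>2\<close>, at the price of the rate
  \<open>2 * K + 1\<close>; rounding it up to \<open>2 * (K + 1)\<close> makes the bound a perfect
  square.\<close>

lemma gronwall:
  fixes e :: "real \<Rightarrow> 'f::real_inner"
  assumes e: "\<And>t. t \<in> {a..b} \<Longrightarrow> (e has_vector_derivative e' t) (at t within {a..b})"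
    and bnd: "\<And>t. t \<in> {a..b} \<Longrightarrow> norm (e' t) \<le> K * norm (e t) + B"
    and KB: "K \<ge> 0" "B \<ge> 0" and t: "t \<in> {a..b}"
  shows "norm (e t) \<le> (norm (e a) + B) * exp ((K + 1) * (t - a))"
proof -
  define \<phi> where "\<phi> s = (e s \<bullet> e s + B\<^sup>2) * exp (- (2 * K + 1) * (s - a))" for s
  have d: "(\<phi> has_vector_derivative (2 * (e s \<bullet> e' s) - (2 * K + 1) * (e s \<bullet> e s + B\<^sup>2)) * exp (- (2 * K + 1) * (s - a))) (at s within {a..b})"
    if "s \<in> {a..b}" for s
    using e[OF that] unfolding \<phi>_def has_vector_derivative_def
    by (auto intro!: derivative_eq_intros simp: algebra_simps inner_commute)
  have neg: "2 * (e s \<bullet> e' s) - (2 * K + 1) * (e s \<bullet> e s + B\<^sup>2) \<le> 0" if "s \<in> {a..b}" for s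
  proof -
    have "e s \<bullet> e' s \<le> norm (e s) * norm (e' s)" by (rule norm_cauchy_schwarz)
    also have "\<dots> \<le> norm (e s) * (K * norm (e s) + B)" using bnd[OF that] by (intro mult_left_mono) auto
    finally have "2 * (e s \<bullet> e' s) \<le> 2 * K * (norm (e s))\<^sup>2 + 2 * norm (e s) * B"
      by (simp add: algebra_simps power2_eq_square)
    also have "2 * norm (e s) * B \<le> (norm (e s))\<^sup>2 + B\<^sup>2" by (rule sum_squares_bound)
    finally have "2 * (e s \<bullet> e' s) \<le> 2 * K * (norm (e s))\<^sup>2 + ((norm (e s))\<^sup>2 + B\<^sup>2)" by simp
    moreover have "0 \<le> 2 * K * B\<^sup>2" using KB by simp
    ultimately show ?thesis by (simp add: algebra_simps power2_norm_eq_inner)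
  qed
  have "\<phi> t \<le> \<phi> a"
  proof (cases "a = t")
    case False
    then have at: "a \<le> t" "t \<le> b" using t by auto
    show ?thesis
    proof (rule DERIV_nonpos_imp_decreasing_open[OF at(1)])
      fix s assume s: "a < s" "s < t"
      then have "(\<phi> has_vector_derivative (2 * (e s \<bullet> e' s) - (2 * K + 1) * (e s \<bullet> e s + B\<^sup>2)) * exp (- (2 * K + 1) * (s - a))) (at s)"
        using d[of s] at at_within_Icc_at[of a s b] by auto
      then show "\<exists>y. (\<phi> has_real_derivative y) (at s) \<and> y \<le> 0"
        using neg[of s] s at by (auto simp: has_real_derivative_iff_has_vector_derivative mult_nonpos_nonneg intro!: exI)
    next
      have "continuous_on {a..b} \<phi>"
        unfolding continuous_on_eq_continuous_within using d has_vector_derivative_continuous by blast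
      then show "continuous_on {a..t} \<phi>" using at by (auto intro: continuous_on_subset)
    qed
  qed simp
  then have "e t \<bullet> e t + B\<^sup>2 \<le> (e a \<bullet> e a + B\<^sup>2) * exp ((2 * K + 1) * (t - a))"
  proof -
    define r where "r = (2 * K + 1) * (t - a)"
    have "- (2 * K + 1) * (t - a) = - r" by (simp add: r_def algebra_simps)
    then have "(e t \<bullet> e t + B\<^sup>2) * exp (- r) \<le> e a \<bullet> e a + B\<^sup>2"
      using \<open>\<phi> t \<le> \<phi> a\<close> unfolding \<phi>_def by simp
    from mult_right_mono[OF this, of "exp r"] show ?thesis
      by (simp add: exp_minus mult.assoc r_def)
  qed
  then have "(norm (e t))\<^sup>2 \<le> (e a \<bullet> e a + B\<^sup>2) * exp ((2 * K + 1) * (t - a))"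
    by (simp add: power2_norm_eq_inner) (smt (verit) zero_le_power2)
  also have "\<dots> \<le> (norm (e a) + B)\<^sup>2 * exp (2 * ((K + 1) * (t - a)))"
  proof (rule mult_mono)
    show "e a \<bullet> e a + B\<^sup>2 \<le> (norm (e a) + B)\<^sup>2" using KB by (simp add: power2_sum power2_norm_eq_inner)
    have "(2 * K + 1) * (t - a) \<le> (2 * (K + 1)) * (t - a)" using t by (intro mult_right_mono) auto
    also have "\<dots> = 2 * ((K + 1) * (t - a))" by (simp add: algebra_simps)
    finally show "exp ((2 * K + 1) * (t - a)) \<le> exp (2 * ((K + 1) * (t - a)))" by simp
  qed auto
  also have "\<dots> = ((norm (e a) + B) * exp ((K + 1) * (t - a)))\<^sup>2"
    by (simp add: power_mult_distrib exp_double)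
  finally show ?thesis using KB by (auto intro: power2_le_imp_le)
qed

lemma continuous_on_linear_family:
  fixes A :: "'t::topological_space \<Rightarrow> 'e::euclidean_space \<Rightarrow> 'b::real_normed_vector"
  assumes "\<And>t. t \<in> S \<Longrightarrow> linear (A t)" "\<And>v. continuous_on S (\<lambda>t. A t v)" "continuous_on S \<phi>"
  shows "continuous_on S (\<lambda>t. A t (\<phi> t))"
proof -
  have "continuous_on S (\<lambda>t. \<Sum>b\<in>Basis. (\<phi> t \<bullet> b) *\<^sub>R A t b)"
    by (intro continuous_on_sum continuous_on_scaleR continuous_on_inner continuous_on_const assms(2,3))
  moreover have "continuous_on S (\<lambda>t. A t (\<phi> t)) \<longleftrightarrow> continuous_on S (\<lambda>t. \<Sum>b\<in>Basis. (\<phi> t \<bullet> b) *\<^sub>R A t b)"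
    by (intro continuous_on_cong refl linear_basis_sum assms(1))
  ultimately show ?thesis by simp
qed

text \<open>In the norm weighted by \<open>exp (- 2 K t)\<close> the Picard operator is a contraction on the whole
  interval.\<close>

lemma linear_ode_exists:
  fixes A :: "real \<Rightarrow> 'f::euclidean_space \<Rightarrow> 'f"
  assumes ab: "a \<le> b" and lin: "\<And>t. t \<in> {a..b} \<Longrightarrow> linear (A t)"
    and cont: "\<And>v. continuous_on {a..b} (\<lambda>t. A t v)"
  shows "\<exists>z. z a = z0 \<and> (\<forall>t\<in>{a..b}. (z has_vector_derivative A t (z t)) (at t within {a..b}))"
proof -
  obtain K where K: "K > 0" and AK: "\<And>t v. t \<in> {a..b} \<Longrightarrow> norm (A t v) \<le> K * norm v"
    using linear_family_bounded[OF compact_Icc, of a b A] lin cont by blast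
  define h where "h \<phi> t = exp (2 * K * (t - a)) *\<^sub>R A t (\<phi> t)" for \<phi> and t :: real
  define P where "P \<phi> t = exp (- 2 * K * (t - a)) *\<^sub>R (z0 + integral {a..t} (h \<phi>))" for \<phi> t
  have hcont: "continuous_on {a..b} (h \<phi>)" if "continuous_on {a..b} \<phi>" for \<phi>
    unfolding h_def
    by (rule continuous_on_scaleR[OF _ continuous_on_linear_family[OF lin cont that]]) (auto intro!: continuous_intros)
  have hd: "((\<lambda>t. integral {a..t} (h \<phi>)) has_vector_derivative h \<phi> t) (at t within {a..b})"
    if "continuous_on {a..b} \<phi>" "t \<in> {a..b}" for \<phi> t
    using integral_has_vector_derivative[OF hcont[OF that(1)] that(2)] .
  have icont: "continuous_on {a..b} (\<lambda>t. integral {a..t} (h \<phi>))" if "continuous_on {a..b} \<phi>" for \<phi>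
    unfolding continuous_on_eq_continuous_within using hd[OF that] has_vector_derivative_continuous by blast
  have Pcont: "continuous_on {a..b} (P \<phi>)" if "continuous_on {a..b} \<phi>" for \<phi>
    unfolding P_def by (intro continuous_intros icont that)
  \<comment> \<open>Clamping the argument extends \<open>P \<phi>\<close> to a bounded continuous
    function on the whole line, so the fixed point can be sought in the complete space of such
    functions.\<close>
  define T where "T \<phi> = Bcontfun (\<lambda>t. P (apply_bcontfun \<phi>) (clamp a b t))" for \<phi>
  have ac: "continuous_on {a..b} (apply_bcontfun \<phi>)" for \<phi> :: "real \<Rightarrow>\<^sub>C 'f"
    by (rule continuous_on_apply_bcontfun)
  have T: "apply_bcontfun (T \<phi>) t = P (apply_bcontfun \<phi>) (clamp a b t)" for \<phi> t
  proof -
    have "(\<lambda>t. P (apply_bcontfun \<phi>) (clamp a b t)) \<in> bcontfun"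
    proof -
      have c: "continuous_on (cbox a b) (P (apply_bcontfun \<phi>))" using Pcont[OF ac, of \<phi>] by simp
      then have "bounded (P (apply_bcontfun \<phi>) ` cbox a b)"
        using compact_continuous_image compact_imp_bounded compact_cbox by blast
      then show ?thesis
        using clamp_continuous_on[OF c, of UNIV] clamp_bounded[of "P (apply_bcontfun \<phi>)" a b] unfolding bcontfun_def
        by (intro CollectI conjI)
    qed
    then show ?thesis unfolding T_def by (simp add: Bcontfun_inverse)
  qed
  have contr: "dist (T \<phi>) (T \<psi>) \<le> 1 / 2 * dist \<phi> \<psi>" for \<phi> \<psi>
  proof (rule dist_bound)
    fix t :: real
    define \<tau> where "\<tau> = clamp a b t"
    have \<tau>: "\<tau> \<in> {a..b}" using clamp_in_interval[of a b t] ab by (simp add: \<tau>_def)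
    define d where "d = dist \<phi> \<psi>"
    define I where "I s = integral {a..s} (h \<phi>) - integral {a..s} (h \<psi>)" for s
    \<comment> \<open>The integrands differ by at most \<open>d * K * exp (2 * K * (s - a))\<close>,
      whose antiderivative carries the factor \<open>d / 2\<close>: hence the contraction constant
      1/2.\<close>
    have "norm (I \<tau> - I a) \<le> d / 2 * exp (2 * K * (\<tau> - a)) - d / 2 * exp (2 * K * (a - a))"
    proof (cases "a = \<tau>")
      case False
      then have at: "a < \<tau>" "\<tau> \<le> b" using \<tau> by auto
      show ?thesis
      proof (rule differentiable_bound_general[OF at(1), where \<phi>="\<lambda>s. d / 2 * exp (2 * K * (s - a))"])
        show "continuous_on {a..\<tau>} I" unfolding I_def
          using at by (intro continuous_intros continuous_on_subset[OF icont[OF ac]]) auto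
        show "(I has_vector_derivative (h \<phi> s - h \<psi> s)) (at s)" if "a < s" "s < \<tau>" for s
          unfolding I_def using hd[OF ac, of s] that at at_within_Icc_at[of a s b]
          by (auto intro!: has_vector_derivative_diff)
        show "((\<lambda>s. d / 2 * exp (2 * K * (s - a))) has_vector_derivative d * K * exp (2 * K * (s - a))) (at s)" for s
          by (auto intro!: derivative_eq_intros simp: has_real_derivative_iff_has_vector_derivative[symmetric])
        show "norm (h \<phi> s - h \<psi> s) \<le> d * K * exp (2 * K * (s - a))" if "a < s" "s < \<tau>" for s
        proof -
          have s: "s \<in> {a..b}" using that at by auto
          have "norm (h \<phi> s - h \<psi> s) = exp (2 * K * (s - a)) * norm (A s (apply_bcontfun \<phi> s - apply_bcontfun \<psi> s))"
            unfolding h_def by (simp add: linear_diff[OF lin[OF s]] scaleR_diff_right[symmetric])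
          also have "\<dots> \<le> exp (2 * K * (s - a)) * (K * d)"
          proof (rule mult_left_mono)
            have "norm (A s (apply_bcontfun \<phi> s - apply_bcontfun \<psi> s)) \<le> K * norm (apply_bcontfun \<phi> s - apply_bcontfun \<psi> s)"
              using AK[OF s] .
            also have "\<dots> \<le> K * d" using K dist_bounded[of \<phi> s \<psi>] by (simp add: d_def dist_norm)
            finally show "norm (A s (apply_bcontfun \<phi> s - apply_bcontfun \<psi> s)) \<le> K * d" .
          qed simp
          finally show ?thesis by (simp add: ac_simps)
        qed
      qed (intro continuous_intros)
    qed simp
    also have "\<dots> \<le> d / 2 * exp (2 * K * (\<tau> - a))" by (simp add: d_def)
    finally have Ib: "norm (I \<tau>) \<le> d / 2 * exp (2 * K * (\<tau> - a))" by (simp add: I_def)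
    have "dist (P \<phi> \<tau>) (P \<psi> \<tau>) = exp (- 2 * K * (\<tau> - a)) * norm (I \<tau>)"
      unfolding P_def I_def dist_norm scaleR_diff_right[symmetric] by simp
    also have "\<dots> \<le> exp (- 2 * K * (\<tau> - a)) * (d / 2 * exp (2 * K * (\<tau> - a)))"
      using Ib by (intro mult_left_mono) auto
    also have "\<dots> = d / 2 * (exp (- 2 * K * (\<tau> - a)) * exp (2 * K * (\<tau> - a)))" by simp
    also have "exp (- 2 * K * (\<tau> - a)) * exp (2 * K * (\<tau> - a)) = 1" by (simp add: exp_minus)
    finally show "dist (apply_bcontfun (T \<phi>) t) (apply_bcontfun (T \<psi>) t) \<le> 1 / 2 * dist \<phi> \<psi>"
      by (simp add: T \<tau>_def d_def)
  qed
  obtain \<phi> where \<phi>: "T \<phi> = \<phi>" using banach_fix_type[of "1/2" T] contr by auto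
  define z where "z t = z0 + integral {a..t} (h \<phi>)" for t
  have h: "h \<phi> t = A t (z t)" if "t \<in> {a..b}" for t
  proof -
    have "apply_bcontfun \<phi> t = exp (- 2 * K * (t - a)) *\<^sub>R z t"
      using T[of \<phi> t] that ab unfolding \<phi> by (simp add: P_def z_def)
    then show ?thesis unfolding h_def using lin[OF that]
      by (simp add: linear_scale exp_minus)
  qed
  have "(z has_vector_derivative A t (z t)) (at t within {a..b})" if "t \<in> {a..b}" for t
    unfolding h[OF that, symmetric] unfolding z_def
    using has_vector_derivative_add[OF has_vector_derivative_const hd[OF ac that]] by simp
  moreover have "z a = z0" by (simp add: z_def)
  ultimately show ?thesis by blast
qed

lemma ode_unique:
  fixes Y Z :: "real \<Rightarrow> 'f::euclidean_space"
  assumes "Ck_on (Suc k) X W" "compact K" "convex K" "K \<subseteq> W"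
    and Y: "\<And>t. t \<in> {a..b} \<Longrightarrow> Y t \<in> K" "\<And>t. t \<in> {a..b} \<Longrightarrow> (Y has_vector_derivative X (Y t)) (at t within {a..b})"
    and Z: "\<And>t. t \<in> {a..b} \<Longrightarrow> Z t \<in> K" "\<And>t. t \<in> {a..b} \<Longrightarrow> (Z has_vector_derivative X (Z t)) (at t within {a..b})"
    and "Y a = Z a" "t \<in> {a..b}"
  shows "Y t = Z t"
proof -
  obtain C where C: "C \<ge> 0" "\<And>x y. x \<in> K \<Longrightarrow> y \<in> K \<Longrightarrow> norm (X x - X y) \<le> C * norm (x - y)"
    using Ck_on_lipschitz[OF assms(1-4)] by blast
  have "norm (Y t - Z t) \<le> (norm (Y a - Z a) + 0) * exp ((C + 1) * (t - a))"
    by (rule gronwall[where e'="\<lambda>t. X (Y t) - X (Z t)"])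
      (use C Y Z assms in \<open>auto intro!: has_vector_derivative_diff\<close>)
  then show ?thesis using assms by simp
qed

text \<open>Confinement to \<open>K\<close> is part of the notion, since for compact convex
  \<open>K\<close> the Lipschitz and Taylor constants of \<open>X\<close> are uniform there.\<close>

definition sol_in :: "('f::euclidean_space \<Rightarrow> 'f) \<Rightarrow> 'f set \<Rightarrow> (real \<Rightarrow> 'f) \<Rightarrow> bool" where
  "sol_in X K Y \<longleftrightarrow> (\<forall>t\<in>{0..1}. Y t \<in> K \<and> (Y has_vector_derivative X (Y t)) (at t within {0..1}))"

definition linearized_sol :: "('f::euclidean_space \<Rightarrow> 'f) \<Rightarrow> (real \<Rightarrow> 'f) \<Rightarrow> (real \<Rightarrow> 'f) \<Rightarrow> bool" where
  "linearized_sol X Y z \<longleftrightarrow> (\<forall>t\<in>{0..1}. (z has_vector_derivative fder X (Y t) (z t)) (at t within {0..1}))"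

text \<open>The remainder \<open>Y' t - Y t - z t\<close> satisfies the linearized equation up to
  the Taylor error of \<open>X\<close>, which is quadratic in the difference of the solutions and
  so, by the first estimate, in their initial difference. \<open>gronwall\<close> bounds each of the
  three quantities.\<close>

lemma flow_linearization:
  fixes X :: "'f::euclidean_space \<Rightarrow> 'f"
  assumes X: "Ck_on (Suc (Suc k)) X W" and K: "compact K" "convex K" "K \<subseteq> W"
  obtains C where "C \<ge> 0"
    "\<And>Y Y' t. sol_in X K Y \<Longrightarrow> sol_in X K Y' \<Longrightarrow> t \<in> {0..1} \<Longrightarrow> norm (Y' t - Y t) \<le> C * norm (Y' 0 - Y 0)"
    "\<And>Y z t. sol_in X K Y \<Longrightarrow> linearized_sol X Y z \<Longrightarrow> t \<in> {0..1} \<Longrightarrow> norm (z t) \<le> C * norm (z 0)"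
    "\<And>Y Y' z t. sol_in X K Y \<Longrightarrow> sol_in X K Y' \<Longrightarrow> linearized_sol X Y z \<Longrightarrow> z 0 = Y' 0 - Y 0 \<Longrightarrow> t \<in> {0..1}
      \<Longrightarrow> norm (Y' t - Y t - z t) \<le> C * (norm (Y' 0 - Y 0))\<^sup>2"
proof -
  obtain L where L: "L \<ge> 0" "\<And>x y. x \<in> K \<Longrightarrow> y \<in> K \<Longrightarrow> norm (X x - X y) \<le> L * norm (x - y)"
    using Ck_on_lipschitz[OF X K] by blast
  obtain B where B: "B \<ge> 0" "\<And>x h. x \<in> K \<Longrightarrow> norm (fder X x h) \<le> B * norm h"
    using Ck_on_fder_bounded[OF X K(1,3)] less_imp_le by metis
  obtain D where D: "D \<ge> 0" "\<And>x y. x \<in> K \<Longrightarrow> y \<in> K \<Longrightarrow> norm (X y - X x - fder X x (y - x)) \<le> D * (norm (y - x))\<^sup>2"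
    using Ck_on_2_taylor[OF X K] by metis
  define E where "E = exp (L + 1)"
  define E' where "E' = exp (B + 1)"
  have EE: "E \<ge> 0" "E' \<ge> 0" by (auto simp: E_def E'_def)
  have exp_le: "r * exp ((c + 1) * (t - 0)) \<le> r * exp (c + 1)" if "t \<in> {0..1}" "c \<ge> 0" "r \<ge> 0" for c t r :: real
    using that by (auto intro!: mult_left_mono mult_left_le)
  have 1: "norm (Y' t - Y t) \<le> E * norm (Y' 0 - Y 0)" if Y: "sol_in X K Y" "sol_in X K Y'" "t \<in> {0..1}" for Y Y' t
  proof -
    have "norm (Y' t - Y t) \<le> (norm (Y' 0 - Y 0) + 0) * exp ((L + 1) * (t - 0))"
      by (rule gronwall[where e'="\<lambda>t. X (Y' t) - X (Y t)"])
        (use L Y in \<open>auto simp: sol_in_def intro!: has_vector_derivative_diff\<close>)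
    also have "\<dots> \<le> (norm (Y' 0 - Y 0) + 0) * exp (L + 1)" using exp_le[OF Y(3) L(1)] by simp
    finally show ?thesis by (simp add: E_def mult.commute)
  qed
  have 2: "norm (z t) \<le> E' * norm (z 0)" if Y: "sol_in X K Y" "linearized_sol X Y z" "t \<in> {0..1}" for Y z t
  proof -
    have "norm (z t) \<le> (norm (z 0) + 0) * exp ((B + 1) * (t - 0))"
      by (rule gronwall[where e'="\<lambda>t. fder X (Y t) (z t)"])
        (use B Y in \<open>auto simp: sol_in_def linearized_sol_def\<close>)
    also have "\<dots> \<le> (norm (z 0) + 0) * exp (B + 1)" using exp_le[OF Y(3) B(1)] by simp
    finally show ?thesis by (simp add: E'_def mult.commute)
  qed
  have 3: "norm (Y' t - Y t - z t) \<le> D * E\<^sup>2 * E' * (norm (Y' 0 - Y 0))\<^sup>2"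
    if Y: "sol_in X K Y" "sol_in X K Y'" "linearized_sol X Y z" "z 0 = Y' 0 - Y 0" "t \<in> {0..1}" for Y Y' z t
  proof -
    define N where "N = norm (Y' 0 - Y 0)"
    have "norm (Y' t - Y t - z t) \<le> (norm (Y' 0 - Y 0 - z 0) + D * (E * N)\<^sup>2) * exp ((B + 1) * (t - 0))"
    proof (rule gronwall[where e'="\<lambda>t. X (Y' t) - X (Y t) - fder X (Y t) (z t)"])
      fix s :: real assume s: "s \<in> {0..1}"
      have inK: "Y s \<in> K" "Y' s \<in> K" using Y s by (auto simp: sol_in_def)
      have lin: "linear (fder X (Y s))" using Ck_on_linear_fder[OF X] inK K by blast
      show "((\<lambda>t. Y' t - Y t - z t) has_vector_derivative X (Y' s) - X (Y s) - fder X (Y s) (z s)) (at s within {0..1})"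
        using Y s by (auto simp: sol_in_def linearized_sol_def intro!: has_vector_derivative_diff)
      have "X (Y' s) - X (Y s) - fder X (Y s) (z s) =
          fder X (Y s) (Y' s - Y s - z s) + (X (Y' s) - X (Y s) - fder X (Y s) (Y' s - Y s))"
        by (simp add: linear_diff[OF lin])
      also have "norm \<dots> \<le> B * norm (Y' s - Y s - z s) + D * (norm (Y' s - Y s))\<^sup>2"
        using norm_triangle_mono[OF B(2)[OF inK(1)] D(2)[OF inK]] .
      also have "\<dots> \<le> B * norm (Y' s - Y s - z s) + D * (E * N)\<^sup>2"
        using 1[OF Y(1,2) s] D(1) by (auto simp: N_def intro!: mult_left_mono power_mono)
      finally show "norm (X (Y' s) - X (Y s) - fder X (Y s) (z s)) \<le> B * norm (Y' s - Y s - z s) + D * (E * N)\<^sup>2" .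
    qed (use B D Y in auto)
    also have "\<dots> \<le> (norm (Y' 0 - Y 0 - z 0) + D * (E * N)\<^sup>2) * exp (B + 1)"
      using D(1) by (intro exp_le[OF Y(5) B(1)]) auto
    finally show ?thesis using Y(4) by (simp add: E'_def N_def power_mult_distrib ac_simps)
  qed
  define C where "C = max (max E E') (D * E\<^sup>2 * E')"
  show thesis
  proof (rule that[of C])
    show "C \<ge> 0" using EE by (simp add: C_def)
    show "norm (Y' t - Y t) \<le> C * norm (Y' 0 - Y 0)" if "sol_in X K Y" "sol_in X K Y'" "t \<in> {0..1}" for Y Y' t
      by (rule order_trans[OF 1[OF that]]) (auto simp: C_def intro!: mult_right_mono)
    show "norm (z t) \<le> C * norm (z 0)" if "sol_in X K Y" "linearized_sol X Y z" "t \<in> {0..1}" for Y z t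
      by (rule order_trans[OF 2[OF that]]) (auto simp: C_def intro!: mult_right_mono)
    show "norm (Y' t - Y t - z t) \<le> C * (norm (Y' 0 - Y 0))\<^sup>2"
      if "sol_in X K Y" "sol_in X K Y'" "linearized_sol X Y z" "z 0 = Y' 0 - Y 0" "t \<in> {0..1}" for Y Y' z t
      by (rule order_trans[OF 3[OF that]]) (auto simp: C_def intro!: mult_right_mono)
  qed
qed

lemma linearized_sol_exists:
  fixes X :: "'f::euclidean_space \<Rightarrow> 'f"
  assumes X: "Ck_on (Suc k) X W" and "K \<subseteq> W" "sol_in X K Y"
  shows "\<exists>z. linearized_sol X Y z \<and> z 0 = z0"
proof -
  have YW: "Y t \<in> W" if "t \<in> {0..1}" for t using that assms by (auto simp: sol_in_def)
  have Yc: "continuous_on {0..1} Y"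
    using assms(3) by (auto simp: sol_in_def continuous_on_eq_continuous_within intro: has_vector_derivative_continuous)
  have "\<exists>z. z 0 = z0 \<and> (\<forall>t\<in>{0..1}. (z has_vector_derivative fder X (Y t) (z t)) (at t within {0..1}))"
  proof (rule linear_ode_exists)
    show "linear (fder X (Y t))" if "t \<in> {0..1}" for t using Ck_on_linear_fder[OF X YW[OF that]] .
    show "continuous_on {0..1} (\<lambda>t. fder X (Y t) v)" for v
      by (rule continuous_on_compose2[OF Ck_on_continuous[OF Ck_on_fder[OF X, of v]] Yc]) (use YW in auto)
  qed simp
  then show ?thesis by (auto simp: linearized_sol_def)
qed

lemma has_derivative_of_quadratic_bound:
  fixes f :: "'a::real_normed_vector \<Rightarrow> 'b::real_normed_vector"
  assumes "bounded_linear f'" "d > 0" "\<And>y. norm (y - x) < d \<Longrightarrow> norm (f y - f x - f' (y - x)) \<le> C * (norm (y - x))\<^sup>2"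
  shows "(f has_derivative f') (at x)"
proof -
  have "((\<lambda>y. (f y - f x - f' (y - x)) /\<^sub>R norm (y - x)) \<longlongrightarrow> 0) (at x)"
  proof (rule Lim_null_comparison)
    have "((\<lambda>y. C * norm (y - x)) \<longlongrightarrow> C * norm (x - x)) (at x)" by (intro tendsto_intros)
    then show "((\<lambda>y. C * norm (y - x)) \<longlongrightarrow> 0) (at x)" by simp
    have "norm ((f y - f x - f' (y - x)) /\<^sub>R norm (y - x)) \<le> C * norm (y - x)" if "norm (y - x) < d" "y \<noteq> x" for y
    proof -
      have "norm (f y - f x - f' (y - x)) / norm (y - x) \<le> C * norm (y - x)"
        using assms(3)[OF that(1)] that(2) by (simp add: divide_le_eq power2_eq_square ac_simps)
      then show ?thesis by (simp add: divide_inverse mult.commute)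
    qed
    then show "\<forall>\<^sub>F y in at x. norm ((f y - f x - f' (y - x)) /\<^sub>R norm (y - x)) \<le> C * norm (y - x)"
      using assms(2) by (auto simp: eventually_at dist_norm)
  qed
  then show ?thesis using assms(1) by (simp add: has_derivative_at_within)
qed

section \<open>Differentiability of the geodesic flow\<close>

text \<open>Differentiating twice with respect to the initial value: the pair of a solution and a solution
  of its linearization solves the augmented equation \<open>(z, \<zeta>)' = (X z, DX(z) \<zeta>)\<close>, to which the first-order
  result applies again.\<close>

definition augmented :: "('f::euclidean_space \<Rightarrow> 'f) \<Rightarrow> 'f \<times> 'f \<Rightarrow> 'f \<times> 'f" where
  "augmented X = (\<lambda>(z, \<zeta>). (X z, fder X z \<zeta>))"

lemma Ck_on_fst:
  fixes W :: "'a::real_normed_vector set"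
  assumes "open W" "Ck_on k f W"
  shows "Ck_on k (\<lambda>z. f (fst z)) (W \<times> (UNIV :: 'b::real_normed_vector set))"
proof -
  have "(fst :: 'a \<times> 'b \<Rightarrow> 'a) -` W = W \<times> UNIV" by auto
  then show ?thesis using Ck_on_comp_linear[of "fst :: 'a \<times> 'b \<Rightarrow> 'a", OF bounded_linear_fst assms] by simp
qed

lemma Ck_on_augmented:
  assumes W: "open W" and X: "Ck_on (Suc k) X W"
  shows "Ck_on k (augmented X) (W \<times> UNIV)"
proof -
  have o: "open (W \<times> (UNIV::'a set))" using W by (simp add: open_Times)
  have "Ck_on k (\<lambda>z. fder X (fst z) (snd z)) (W \<times> (UNIV::'a set))"
    by (rule Ck_on_linear_family[where A="fder X", OF o _ Ck_on_fst[OF W Ck_on_fder[OF X]] Ck_on_bounded_linear[OF bounded_linear_snd o]])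
      (auto intro: Ck_on_linear_fder[OF X])
  then show ?thesis
    using Ck_on_Pair[OF o Ck_on_fst[OF W Ck_on_Suc_imp[OF X]]] by (simp add: augmented_def case_prod_beta')
qed

text \<open>Read along a solution, the second component is the equation of the second variation,
  forced by the second derivative of \<open>X\<close>.\<close>

lemma fder_augmented:
  assumes W: "open W" and X: "Ck_on (Suc (Suc k)) X W" and z: "z \<in> W"
  shows "fder (augmented X) (z, \<zeta>) (\<upsilon>, q) = (fder X z \<upsilon>, fder X z q + fder (\<lambda>z. fder X z \<zeta>) z \<upsilon>)"
proof -
  have dfst: "(fst has_derivative fst) (at (z, \<zeta>))" and dsnd: "(snd has_derivative snd) (at (z, \<zeta>))"
    by (auto intro!: derivative_eq_intros)
  have c1: "((\<lambda>p. X (fst p)) has_derivative (\<lambda>h. fder X z (fst h))) (at (z, \<zeta>))"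
    by (rule has_derivative_compose[OF dfst]) (use Ck_on_has_derivative[OF X z] in simp)
  have c2: "((\<lambda>p. fder X (fst p) (snd p)) has_derivative
      (\<lambda>h. fder (\<lambda>y. fder X y (snd (z, \<zeta>))) (fst (z, \<zeta>)) (fst h) + fder X (fst (z, \<zeta>)) (snd h))) (at (z, \<zeta>))"
    by (rule has_derivative_linear_family[where A="fder X" and \<psi>=fst, OF W _ Ck_on_linear_fder[OF X] Ck_on_fder[OF X] dfst dsnd UNIV_I])
      (use z in auto)
  show ?thesis
    using fder_eqI[OF has_derivative_Pair[OF c1 c2]] by (simp add: augmented_def case_prod_beta')
qed

text \<open>Only the part \<open>\<iota> u\<close> of the initial value varies. Along the constant
  solution the linearized equation has constant coefficients; its solutions and those of the second
  variation enter as hypotheses, so that explicit ones can be supplied. The first-order estimate is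
  used for \<open>X\<close> and, to differentiate \<open>Z\<close>, for \<open>augmented X\<close>,
  which costs one more derivative of \<open>X\<close>.\<close>

lemma flow_near_equilibrium:
  fixes X :: "'f::euclidean_space \<Rightarrow> 'f" and \<iota> :: "'p::euclidean_space \<Rightarrow> 'f"
  assumes W: "open W" and X: "Ck_on (Suc (Suc (Suc k))) X W" and K: "compact K" "convex K" "K \<subseteq> W"
    and z0: "z0 \<in> K" "X z0 = 0" and \<iota>: "linear \<iota>" and \<delta>: "\<delta> > 0"
    and Y: "\<And>u. norm u < \<delta> \<Longrightarrow> sol_in X K (Y u)" "\<And>u. norm u < \<delta> \<Longrightarrow> Y u 0 = z0 + \<iota> u"
  shows "\<exists>Z. (\<forall>u. norm u < \<delta> \<longrightarrow> ((\<lambda>u. Y u 1) has_derivative Z u) (at u)) \<and>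
      (\<forall>w \<zeta>. linearized_sol X (\<lambda>t. z0) \<zeta> \<longrightarrow> \<zeta> 0 = \<iota> w \<longrightarrow> Z 0 w = \<zeta> 1) \<and>
      (\<forall>w \<zeta> \<upsilon> q. linearized_sol X (\<lambda>t. z0) \<zeta> \<longrightarrow> \<zeta> 0 = \<iota> w \<longrightarrow>
        (\<forall>u. linearized_sol X (\<lambda>t. z0) (\<upsilon> u) \<and> \<upsilon> u 0 = \<iota> u \<and> q u 0 = 0 \<and>
          (\<forall>t\<in>{0..1}. (q u has_vector_derivative
            fder X z0 (q u t) + fder (\<lambda>z. fder X z (\<zeta> t)) z0 (\<upsilon> u t)) (at t within {0..1}))) \<longrightarrow>
        linear (\<lambda>u. q u 1) \<longrightarrow> ((\<lambda>u. Z u w) has_derivative (\<lambda>u. q u 1)) (at 0))"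
proof -
  have X2: "Ck_on (Suc (Suc k)) X W" using Ck_on_Suc_imp[OF X] .
  obtain C where C: "C \<ge> 0"
    "\<And>Y Y' t. sol_in X K Y \<Longrightarrow> sol_in X K Y' \<Longrightarrow> t \<in> {0..1} \<Longrightarrow> norm (Y' t - Y t) \<le> C * norm (Y' 0 - Y 0)"
    "\<And>Y z t. sol_in X K Y \<Longrightarrow> linearized_sol X Y z \<Longrightarrow> t \<in> {0..1} \<Longrightarrow> norm (z t) \<le> C * norm (z 0)"
    "\<And>Y Y' z t. sol_in X K Y \<Longrightarrow> sol_in X K Y' \<Longrightarrow> linearized_sol X Y z \<Longrightarrow> z 0 = Y' 0 - Y 0 \<Longrightarrow> t \<in> {0..1}
      \<Longrightarrow> norm (Y' t - Y t - z t) \<le> C * (norm (Y' 0 - Y 0))\<^sup>2"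
    using flow_linearization[OF X2 K] by (smt (verit))
  have solz0: "sol_in X K (\<lambda>t. z0)" using z0 by (simp add: sol_in_def)
  \<comment> \<open>Some linearized solution with initial value \<open>\<iota> w\<close>;
    \<open>zuniq\<close> shows that the choice does not affect its value at time 1, which makes
    \<open>Z u\<close> linear.\<close>
  define zs where "zs u w = (SOME z. linearized_sol X (Y u) z \<and> z 0 = \<iota> w)" for u w
  have zs: "linearized_sol X (Y u) (zs u w)" "zs u w 0 = \<iota> w" if "norm u < \<delta>" for u w
    using someI_ex[OF linearized_sol_exists[OF X2 K(3) Y(1)[OF that], of "\<iota> w"]] by (auto simp: zs_def)
  have Y0: "Y 0 t = z0" if "t \<in> {0..1}" for t
    using C(2)[OF solz0 Y(1)[of 0] that] Y(2)[of 0] \<delta> linear_0[OF \<iota>] by simp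
  have inW: "Y u t \<in> W" if "norm u < \<delta>" "t \<in> {0..1}" for u t
    using Y(1)[OF that(1)] that(2) K by (auto simp: sol_in_def)
  have flin: "linear (fder X (Y u t))" if "norm u < \<delta>" "t \<in> {0..1}" for u t
    using Ck_on_linear_fder[OF X inW[OF that]] .
  have zuniq: "z 1 = zs u w 1" if u: "norm u < \<delta>" and z: "linearized_sol X (Y u) z" "z 0 = \<iota> w" for u w z
  proof -
    have "linearized_sol X (Y u) (\<lambda>t. z t - zs u w t)"
      using z zs(1)[OF u, of w] linear_diff[OF flin[OF u]]
      by (auto simp: linearized_sol_def intro!: derivative_eq_intros)
    from C(3)[OF Y(1)[OF u] this, of 1] z zs(2)[OF u] show ?thesis by simp
  qed
  define Z where "Z u w = zs u w 1" for u w
  have Zlin: "linear (Z u)" if u: "norm u < \<delta>" for u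
  proof (rule linearI)
    fix w w' c
    have "linearized_sol X (Y u) (\<lambda>t. zs u w t + zs u w' t)"
      using zs(1)[OF u] linear_add[OF flin[OF u]]
      by (auto simp: linearized_sol_def intro!: derivative_eq_intros)
    from zuniq[OF u this, of "w + w'"] show "Z u (w + w') = Z u w + Z u w'"
      by (simp add: Z_def zs(2)[OF u] linear_add[OF \<iota>])
    have "linearized_sol X (Y u) (\<lambda>t. c *\<^sub>R zs u w t)"
      using zs(1)[OF u] linear_scale[OF flin[OF u]]
      by (auto simp: linearized_sol_def intro!: derivative_eq_intros)
    from zuniq[OF u this, of "c *\<^sub>R w"] show "Z u (c *\<^sub>R w) = c *\<^sub>R Z u w"
      by (simp add: Z_def zs(2)[OF u] linear_scale[OF \<iota>])
  qed
  obtain I where I: "\<And>u. norm (\<iota> u) \<le> I * norm u" "I \<ge> 0"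
    using linear_conv_bounded_linear[THEN iffD1, OF \<iota>] bounded_linear.nonneg_bounded[of \<iota>] by (metis mult.commute)
  have Zder: "((\<lambda>u. Y u 1) has_derivative Z u) (at u)" if u: "norm u < \<delta>" for u
  proof (rule has_derivative_of_quadratic_bound)
    show "bounded_linear (Z u)" using Zlin[OF u] linear_conv_bounded_linear by blast
    show "\<delta> - norm u > 0" using u by simp
    fix y assume "norm (y - u) < \<delta> - norm u"
    then have y: "norm y < \<delta>" by norm
    have "norm (Y y 1 - Y u 1 - zs u (y - u) 1) \<le> C * (norm (Y y 0 - Y u 0))\<^sup>2"
      by (rule C(4)[OF Y(1)[OF u] Y(1)[OF y] zs(1)[OF u]])
        (use zs(2)[OF u] Y(2)[OF u] Y(2)[OF y] linear_diff[OF \<iota>] in auto)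
    also have "Y y 0 - Y u 0 = \<iota> (y - u)" using Y(2) u y linear_diff[OF \<iota>] by simp
    also have "C * (norm (\<iota> (y - u)))\<^sup>2 \<le> C * (I * norm (y - u))\<^sup>2"
      using C(1) I by (intro mult_left_mono power_mono) auto
    finally show "norm (Y y 1 - Y u 1 - Z u (y - u)) \<le> (C * I\<^sup>2) * (norm (y - u))\<^sup>2"
      by (simp add: Z_def power_mult_distrib ac_simps)
  qed
  have lin0: "linearized_sol X (Y 0) \<zeta> \<longleftrightarrow> linearized_sol X (\<lambda>t. z0) \<zeta>" for \<zeta>
    using Y0 by (simp add: linearized_sol_def)
  have Z0: "Z 0 w = \<zeta> 1" if "linearized_sol X (\<lambda>t. z0) \<zeta>" "\<zeta> 0 = \<iota> w" for w \<zeta>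
    using zuniq[of 0 \<zeta> w] \<delta> that by (simp add: Z_def lin0)
  have Zder2: "((\<lambda>u. Z u w) has_derivative (\<lambda>u. q u 1)) (at 0)"
    if \<zeta>: "linearized_sol X (\<lambda>t. z0) \<zeta>" "\<zeta> 0 = \<iota> w"
      and \<upsilon>: "\<And>u. linearized_sol X (\<lambda>t. z0) (\<upsilon> u)" "\<And>u. \<upsilon> u 0 = \<iota> u"
      and q: "\<And>u. q u 0 = 0" "\<And>u t. t \<in> {0..1} \<Longrightarrow> (q u has_vector_derivative
          fder X z0 (q u t) + fder (\<lambda>z. fder X z (\<zeta> t)) z0 (\<upsilon> u t)) (at t within {0..1})"
      and qlin: "linear (\<lambda>u. q u 1)" for w \<zeta> \<upsilon> q
  proof -
    \<comment> \<open>Bounds the linearized solutions uniformly in \<open>u\<close>, so that all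
      augmented solutions share one compact convex set.\<close>
    define R where "R = C * norm (\<iota> w)"
    have zR: "norm (zs u w t) \<le> R" if "norm u < \<delta>" "t \<in> {0..1}" for u t
      using C(3)[OF Y(1) zs(1)] zs(2) that unfolding R_def by metis
    define K' where "K' = K \<times> cball (0::'f) R"
    have K': "compact K'" "convex K'" "K' \<subseteq> W \<times> UNIV"
      unfolding K'_def using K by (auto intro: compact_Times convex_Times)
    have z0W: "z0 \<in> W" using z0 K by blast
    have solA: "sol_in (augmented X) K' (\<lambda>t. (Y u t, zs u w t))" if u: "norm u < \<delta>" for u
      using Y(1)[OF u] zs(1)[OF u, of w] zR[OF u] inW[OF u] unfolding sol_in_def linearized_sol_def K'_def
      by (auto simp: augmented_def intro!: has_vector_derivative_Pair)
    have Y'0: "sol_in (augmented X) K' (\<lambda>t. (z0, \<zeta> t))"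
    proof -
      have "norm (\<zeta> t) \<le> R" if "t \<in> {0..1}" for t
        using C(3)[OF solz0 \<zeta>(1) that] \<zeta>(2) by (simp add: R_def)
      then show ?thesis using \<zeta>(1) z0 z0W unfolding sol_in_def linearized_sol_def K'_def
        by (auto simp: augmented_def intro!: has_vector_derivative_Pair)
    qed
    have lA: "linearized_sol (augmented X) (\<lambda>t. (z0, \<zeta> t)) (\<lambda>t. (\<upsilon> u t, q u t))" for u
      using \<upsilon>(1)[of u] q(2)[of _ u] unfolding linearized_sol_def
      by (auto simp: fder_augmented[OF W X2 z0W] intro!: has_vector_derivative_Pair)
    obtain C' where C': "C' \<ge> 0" "\<And>Y Y' z t. sol_in (augmented X) K' Y \<Longrightarrow> sol_in (augmented X) K' Y' \<Longrightarrow>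
        linearized_sol (augmented X) Y z \<Longrightarrow> z 0 = Y' 0 - Y 0 \<Longrightarrow> t \<in> {0..1}
        \<Longrightarrow> norm (Y' t - Y t - z t) \<le> C' * (norm (Y' 0 - Y 0))\<^sup>2"
      using flow_linearization[OF Ck_on_augmented[OF W X] K'] by (smt (verit))
    show ?thesis
    proof (rule has_derivative_of_quadratic_bound[OF _ \<delta>])
      show "bounded_linear (\<lambda>u. q u 1)" using qlin linear_conv_bounded_linear by blast
      fix u :: 'p assume "norm (u - 0) < \<delta>"
      then have u: "norm u < \<delta>" by simp
      \<comment> \<open>Both augmented solutions start with the second component
        \<open>\<iota> w\<close>, so their initial difference is \<open>(\<iota> u, 0)\<close> and
        the error is quadratic in \<open>u\<close>.\<close>
      have "norm ((Y u 1, zs u w 1) - (z0, \<zeta> 1) - (\<upsilon> u 1, q u 1)) \<le> C' * (norm ((Y u 0, zs u w 0) - (z0, \<zeta> 0)))\<^sup>2"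
        by (rule C'(2)[OF Y'0 solA[OF u] lA]) (use Y(2)[OF u] zs(2)[OF u] \<zeta>(2) \<upsilon>(2) q(1) in auto)
      also have "(Y u 0, zs u w 0) - (z0, \<zeta> 0) = (\<iota> u, 0)" using Y(2)[OF u] zs(2)[OF u] \<zeta>(2) by simp
      also have "norm (\<iota> u, 0::'f) = norm (\<iota> u)" by (simp add: norm_Pair)
      also have "C' * (norm (\<iota> u))\<^sup>2 \<le> C' * (I * norm u)\<^sup>2"
        using C'(1) I by (intro mult_left_mono power_mono) auto
      finally have "norm (Y u 1 - z0 - \<upsilon> u 1, zs u w 1 - \<zeta> 1 - q u 1) \<le> C' * (I * norm u)\<^sup>2" by simp
      then have "norm (zs u w 1 - \<zeta> 1 - q u 1) \<le> C' * (I * norm u)\<^sup>2"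
        using norm_snd_le order_trans by (metis snd_conv)
      then show "norm (Z u w - Z 0 w - q (u - 0) 1) \<le> (C' * I\<^sup>2) * (norm (u - 0))\<^sup>2"
        using Z0[OF \<zeta>] by (simp add: Z_def power_mult_distrib ac_simps)
    qed
  qed
  show ?thesis
  proof (intro exI[of _ Z] conjI allI impI)
    fix w \<zeta> \<upsilon> q
    assume "linearized_sol X (\<lambda>t. z0) \<zeta>" "\<zeta> 0 = \<iota> w" "linear (\<lambda>u. q u 1)"
      and "\<forall>u. linearized_sol X (\<lambda>t. z0) (\<upsilon> u) \<and> \<upsilon> u 0 = \<iota> u \<and> q u 0 = 0 \<and>
          (\<forall>t\<in>{0..1}. (q u has_vector_derivative
            fder X z0 (q u t) + fder (\<lambda>z. fder X z (\<zeta> t)) z0 (\<upsilon> u t)) (at t within {0..1}))"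
    then show "((\<lambda>u. Z u w) has_derivative (\<lambda>u. q u 1)) (at 0)"
      by (intro Zder2[where \<zeta>=\<zeta> and \<upsilon>=\<upsilon>]) auto
  qed (use Zder Z0 in auto)
qed

text \<open>The geodesic equation \<open>y'' = - \<Gamma> y y' y'\<close> as a first-order field on
  positions and velocities. For bilinear \<open>\<Gamma> y\<close> the states of velocity 0 are
  equilibria.\<close>

definition geo_field :: "('e::euclidean_space \<Rightarrow> 'e \<Rightarrow> 'e \<Rightarrow> 'e) \<Rightarrow> 'e \<times> 'e \<Rightarrow> 'e \<times> 'e" where
  "geo_field \<Gamma> = (\<lambda>(y, p). (p, - \<Gamma> y p p))"

lemma Ck_on_geo_field:
  assumes U: "open U" and bil: "\<And>y. y \<in> U \<Longrightarrow> bilinear (\<Gamma> y)"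
    and \<Gamma>: "\<And>v w. Ck_on k (\<lambda>y. \<Gamma> y v w) U"
  shows "Ck_on k (geo_field \<Gamma>) (U \<times> UNIV)"
proof -
  have o: "open (U \<times> (UNIV::'a set))" using U by (simp add: open_Times)
  note snd = Ck_on_bounded_linear[OF bounded_linear_snd o]
  have "Ck_on k (\<lambda>z. \<Gamma> (fst z) (snd z) (snd z)) (U \<times> UNIV)"
    by (rule Ck_on_bilinear_family[where g=\<Gamma>, OF o _ Ck_on_fst[OF U \<Gamma>] snd snd]) (use bil in auto)
  from Ck_on_Pair[OF o snd Ck_on_linear_comp[OF bounded_linear_minus[OF bounded_linear_ident] o this]]
  show ?thesis by (simp add: geo_field_def case_prod_beta')
qed

lemma fder_geo_field:
  assumes U: "open U" and bil: "\<And>y. y \<in> U \<Longrightarrow> bilinear (\<Gamma> y)"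
    and \<Gamma>: "\<And>v w. Ck_on (Suc k) (\<lambda>y. \<Gamma> y v w) U" and y: "y \<in> U"
  shows "fder (geo_field \<Gamma>) (y, p) (J, P) = (P, - (fder (\<lambda>y. \<Gamma> y p p) y J + \<Gamma> y P p + \<Gamma> y p P))"
proof -
  have dfst: "(fst has_derivative fst) (at (y, p))" and dsnd: "(snd has_derivative snd) (at (y, p))"
    by (auto intro!: derivative_eq_intros)
  have "fst (y, p) \<in> U" using y by simp
  note has_derivative_bilinear_family[where g=\<Gamma> and \<psi>=fst, OF U this bil \<Gamma> dfst dsnd dsnd UNIV_I]
  from fder_eqI[OF has_derivative_Pair[OF dsnd has_derivative_minus[OF this]]]
  show ?thesis by (simp add: geo_field_def case_prod_beta')
qed

text \<open>At velocity 0 every term that contains a derivative of \<open>\<Gamma>\<close> still has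
  an argument 0 and vanishes by bilinearity; only the two terms in which \<open>P'\<close> replaces
  the velocity remain.\<close>

lemma fder_fder_geo_field:
  assumes U: "open U" and bil: "\<And>y. y \<in> U \<Longrightarrow> bilinear (\<Gamma> y)"
    and \<Gamma>: "\<And>v w. Ck_on (Suc (Suc k)) (\<lambda>y. \<Gamma> y v w) U" and y: "y \<in> U"
  shows "fder (\<lambda>z. fder (geo_field \<Gamma>) z (J, P)) (y, 0) (J', P') = (0, - (\<Gamma> y P P' + \<Gamma> y P' P))"
proof -
  have o: "open (U \<times> (UNIV::'a set))" using U by (simp add: open_Times)
  have \<Gamma>1: "Ck_on (Suc k) (\<lambda>y. \<Gamma> y v w) U" for v w using Ck_on_Suc_imp[OF \<Gamma>] .
  define \<Lambda> where "\<Lambda> y v w = fder (\<lambda>y. \<Gamma> y v w) y J" for y v w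
  have \<Lambda>: "bilinear (\<Lambda> y)" if "y \<in> U" for y
    unfolding \<Lambda>_def by (rule bilinear_fder_family[OF U that bil \<Gamma>])
  have \<Lambda>1: "Ck_on (Suc k) (\<lambda>y. \<Lambda> y v w) U" for v w
    unfolding \<Lambda>_def by (rule Ck_on_fder[OF \<Gamma>])
  have \<Lambda>0: "fder (\<lambda>y. \<Lambda> y 0 0) y h = 0" and \<Gamma>0: "fder (\<lambda>y. \<Gamma> y P 0) y h = 0" "fder (\<lambda>y. \<Gamma> y 0 P) y h = 0" for h
    using fder_bilinear_family_sum[OF U y \<Lambda> \<Lambda>1, of 0 0 h] fder_bilinear_family_sum[OF U y bil \<Gamma>, of P 0 h]
      fder_bilinear_family_sum[OF U y bil \<Gamma>, of 0 P h] by simp_all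
  have dfst: "(fst has_derivative fst) (at (y, 0::'a))" and dsnd: "(snd has_derivative snd) (at (y, 0::'a))"
    by (auto intro!: derivative_eq_intros)
  have fy: "fst (y, 0::'a) \<in> U" using y by simp
  note d = has_derivative_bilinear_family[where \<psi>=fst, OF U fy _ _ dfst _ _ UNIV_I]
  have "((\<lambda>z. \<Lambda> (fst z) (snd z) (snd z) + \<Gamma> (fst z) P (snd z) + \<Gamma> (fst z) (snd z) P) has_derivative
      (\<lambda>h. \<Gamma> y P (snd h) + \<Gamma> y (snd h) P)) (at (y, 0))"
    by (rule has_derivative_eqI[OF has_derivative_add[OF has_derivative_add[OF
              d[OF \<Lambda> \<Lambda>1 dsnd dsnd] d[OF bil \<Gamma>1 has_derivative_const dsnd]] d[OF bil \<Gamma>1 dsnd has_derivative_const]]])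
      (simp_all add: \<Lambda>0 \<Gamma>0 bilinear_lzero bilinear_rzero \<Lambda>[OF y] bil[OF y])
  from has_derivative_Pair[OF has_derivative_const has_derivative_minus[OF this]]
  have "((\<lambda>z. fder (geo_field \<Gamma>) z (J, P)) has_derivative (\<lambda>h. (0, - (\<Gamma> y P (snd h) + \<Gamma> y (snd h) P)))) (at (y, 0))"
    by (rule has_derivative_transform_within_open[OF _ o])
      (use y in \<open>auto simp: fder_geo_field[OF U bil \<Gamma>1] \<Lambda>_def\<close>)
  from fder_eqI[OF this] show ?thesis by simp
qed

text \<open>The geodesic of initial velocity 0 rests at \<open>y0\<close>. There the first variation
  in direction \<open>w\<close> is \<open>(t *\<^sub>R w, w)\<close>, whose position at time 1 gives
  the identity, and the second variation is forced by the constant -2 \<Gamma>(u, w) in the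
  velocity.\<close>

lemma geodesic_flow_derivatives:
  fixes \<Gamma> :: "'e::euclidean_space \<Rightarrow> 'e \<Rightarrow> 'e \<Rightarrow> 'e"
  assumes U: "open U" and bil: "\<And>y. y \<in> U \<Longrightarrow> bilinear (\<Gamma> y)"
    and \<Gamma>: "\<And>v w. Ck_on (Suc (Suc (Suc k))) (\<lambda>y. \<Gamma> y v w) U"
    and sym: "\<And>v w. \<Gamma> y0 v w = \<Gamma> y0 w v"
    and K: "compact K" "convex K" "K \<subseteq> U \<times> UNIV" "(y0, 0) \<in> K" and \<delta>: "\<delta> > 0"
    and Y: "\<And>u. norm u < \<delta> \<Longrightarrow> sol_in (geo_field \<Gamma>) K (Y u)" "\<And>u. norm u < \<delta> \<Longrightarrow> Y u 0 = (y0, u)"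
  obtains F' where "\<And>u. norm u < \<delta> \<Longrightarrow> ((\<lambda>u. fst (Y u 1)) has_derivative F' u) (at u)"
    and "\<And>w. F' 0 w = w" and "\<And>w. ((\<lambda>u. F' u w) has_derivative (\<lambda>u. - \<Gamma> y0 u w)) (at 0)"
proof -
  have o: "open (U \<times> (UNIV::'e set))" using U by (simp add: open_Times)
  have y0: "y0 \<in> U" using K by blast
  note b0 = bil[OF y0]
  have D1: "fder (geo_field \<Gamma>) (y0, 0) (J, P) = (P, 0)" for J P
    using fder_geo_field[OF U bil \<Gamma> y0, of 0 J P] fder_bilinear_family_sum[OF U y0 bil \<Gamma>, of 0 0 J] b0
    by (simp add: bilinear_lzero bilinear_rzero)
  have D2: "fder (\<lambda>z. fder (geo_field \<Gamma>) z (J, P)) (y0, 0) (J', P') = (0, - (\<Gamma> y0 P P' + \<Gamma> y0 P' P))" for J P J' P'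
    by (rule fder_fder_geo_field[OF U bil \<Gamma> y0])
  have lin\<iota>: "linear (\<lambda>u::'e. (0::'e, u))" by (intro linearI) auto
  have g0: "geo_field \<Gamma> (y0, 0) = 0" using b0 by (simp add: geo_field_def bilinear_lzero zero_prod_def)
  have Y0: "\<And>u. norm u < \<delta> \<Longrightarrow> Y u 0 = (y0, 0) + (0, u)" using Y(2) by simp
  have Xk: "Ck_on (Suc (Suc (Suc k))) (geo_field \<Gamma>) (U \<times> UNIV)" by (rule Ck_on_geo_field[OF U bil \<Gamma>])
  have "\<exists>Z. (\<forall>u. norm u < \<delta> \<longrightarrow> ((\<lambda>u. Y u 1) has_derivative Z u) (at u)) \<and>
      (\<forall>w \<zeta>. linearized_sol (geo_field \<Gamma>) (\<lambda>t. (y0, 0)) \<zeta> \<longrightarrow> \<zeta> 0 = (0, w) \<longrightarrow> Z 0 w = \<zeta> 1) \<and>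
      (\<forall>w \<zeta> \<upsilon> q. linearized_sol (geo_field \<Gamma>) (\<lambda>t. (y0, 0)) \<zeta> \<longrightarrow> \<zeta> 0 = (0, w) \<longrightarrow>
        (\<forall>u. linearized_sol (geo_field \<Gamma>) (\<lambda>t. (y0, 0)) (\<upsilon> u) \<and> \<upsilon> u 0 = (0, u) \<and> q u 0 = 0 \<and>
          (\<forall>t\<in>{0..1}. (q u has_vector_derivative
            fder (geo_field \<Gamma>) (y0, 0) (q u t) + fder (\<lambda>z. fder (geo_field \<Gamma>) z (\<zeta> t)) (y0, 0) (\<upsilon> u t)) (at t within {0..1}))) \<longrightarrow>
        linear (\<lambda>u. q u 1) \<longrightarrow> ((\<lambda>u. Z u w) has_derivative (\<lambda>u. q u 1)) (at 0))"
    (is "\<exists>Z. ?P Z")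
    by (rule flow_near_equilibrium[OF o Xk K(1,2,3,4) g0 lin\<iota> \<delta> Y(1) Y0])
  then obtain Z where Z: "?P Z" by (elim exE) (rule that)
  have Z0: "Z 0 w = \<zeta> 1" if "linearized_sol (geo_field \<Gamma>) (\<lambda>t. (y0, 0)) \<zeta>" "\<zeta> 0 = (0, w)" for w \<zeta>
    using Z that by blast
  define \<zeta> where "\<zeta> w t = (t *\<^sub>R w, w)" for w :: 'e and t :: real
  have \<zeta>: "linearized_sol (geo_field \<Gamma>) (\<lambda>t. (y0, 0)) (\<zeta> w)" "\<zeta> w 0 = (0, w)" for w
    unfolding linearized_sol_def \<zeta>_def D1 by (auto intro!: has_vector_derivative_Pair derivative_eq_intros)
  \<comment> \<open>Integrating the constant force twice from 0 gives the position
    \<open>- (t\<^sup>2 *\<^sub>R \<Gamma> y0 u w)\<close>; \<open>sym\<close> merges the two terms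
    of \<open>D2\<close> into the factor 2.\<close>
  define q where "q w u t = (- (t\<^sup>2 *\<^sub>R \<Gamma> y0 u w), - ((2 * t) *\<^sub>R \<Gamma> y0 u w))" for w u :: 'e and t :: real
  have q: "(q w u has_vector_derivative fder (geo_field \<Gamma>) (y0, 0) (q w u t)
      + fder (\<lambda>z. fder (geo_field \<Gamma>) z (\<zeta> w t)) (y0, 0) (\<zeta> u t)) (at t within {0..1})" for w u t
  proof -
    have "fder (geo_field \<Gamma>) (y0, 0) (q w u t) + fder (\<lambda>z. fder (geo_field \<Gamma>) z (\<zeta> w t)) (y0, 0) (\<zeta> u t)
      = (- ((2 * t) *\<^sub>R \<Gamma> y0 u w), - (2 *\<^sub>R \<Gamma> y0 u w))"
      unfolding \<zeta>_def q_def D1 D2 using sym[of w u] by (simp add: scaleR_2)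
    then show ?thesis unfolding q_def
      by (auto intro!: has_vector_derivative_Pair derivative_eq_intros simp: has_vector_derivative_def)
  qed
  have qlin: "linear (\<lambda>u. q w u 1)" for w
    unfolding q_def using b0 by (intro linearI) (auto simp: bilinear_ladd bilinear_lmul algebra_simps)
  have q0: "q w u 0 = 0" for w u by (simp add: q_def zero_prod_def)
  have d2: "((\<lambda>u. Z u w) has_derivative (\<lambda>u. q w u 1)) (at 0)" for w
    using Z[THEN conjunct2, THEN conjunct2, rule_format, of "\<zeta> w" w \<zeta> "q w"] \<zeta> q0 q qlin by simp
  show thesis
  proof (rule that[of "\<lambda>u w. fst (Z u w)"])
    show "((\<lambda>u. fst (Y u 1)) has_derivative (\<lambda>w. fst (Z u w))) (at u)" if "norm u < \<delta>" for u
      using has_derivative_fst[OF Z[THEN conjunct1, rule_format, OF that]] .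
    show "fst (Z 0 w) = w" for w using Z0[OF \<zeta>] by (simp add: \<zeta>_def)
    show "((\<lambda>u. fst (Z u w)) has_derivative (\<lambda>u. - \<Gamma> y0 u w)) (at 0)" for w
      using has_derivative_fst[OF d2[of w]] by (simp add: q_def)
  qed
qed

section \<open>Charts and Christoffel symbols\<close>

locale riemannian =
  fixes M :: "('a::{t2_space, second_countable_topology}, 'e::euclidean_space) riem"
  assumes mfd: "riemannian_manifold M"
begin

abbreviation cimg :: "('a, 'e) chart \<Rightarrow> 'e set" where "cimg c \<equiv> chart_map c ` chart_dom c"

text \<open>\<open>to_chart\<close> and \<open>from_chart\<close> are the cases in which one of the
  charts is \<open>chart_at M x\<close>, so their laws follow from the cocycle law
  \<open>tr_comp\<close>.\<close>

definition tr :: "('a, 'e) chart \<Rightarrow> ('a, 'e) chart \<Rightarrow> 'e \<Rightarrow> 'e \<Rightarrow> 'e" where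
  "tr c d y = fder (chart_map d \<circ> chart_inv c) y"

abbreviation ov :: "('a, 'e) chart \<Rightarrow> ('a, 'e) chart \<Rightarrow> 'e set" where
  "ov c d \<equiv> chart_map c ` (chart_dom c \<inter> chart_dom d)"

lemma is_chart: "c \<in> charts M \<Longrightarrow> is_chart c"
  using mfd by (simp add: riemannian_manifold_def smooth_atlas_def)

lemma open_dom: "c \<in> charts M \<Longrightarrow> open (chart_dom c)" and open_cimg: "c \<in> charts M \<Longrightarrow> open (cimg c)"
  and continuous_chart_inv: "c \<in> charts M \<Longrightarrow> continuous_on (cimg c) (chart_inv c)"
  and chart_inv_map: "c \<in> charts M \<Longrightarrow> x \<in> chart_dom c \<Longrightarrow> chart_inv c (chart_map c x) = x"
  using is_chart by (auto simp: is_chart_def homeomorphism_def)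

lemma chart_map_inv: "c \<in> charts M \<Longrightarrow> y \<in> cimg c \<Longrightarrow> chart_map c (chart_inv c y) = y"
  and chart_inv_in: "c \<in> charts M \<Longrightarrow> y \<in> cimg c \<Longrightarrow> chart_inv c y \<in> chart_dom c"
  using chart_inv_map by (metis imageE)+

lemma mem_ov:
  assumes "c \<in> charts M"
  shows "y \<in> ov c d \<longleftrightarrow> y \<in> cimg c \<and> chart_inv c y \<in> chart_dom d"
proof
  assume "y \<in> ov c d"
  then obtain x where "x \<in> chart_dom c" "x \<in> chart_dom d" "y = chart_map c x" by blast
  then show "y \<in> cimg c \<and> chart_inv c y \<in> chart_dom d" using chart_inv_map[OF assms, of x] by simp
next
  assume "y \<in> cimg c \<and> chart_inv c y \<in> chart_dom d"
  then show "y \<in> ov c d"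
    using chart_map_inv[OF assms, of y] chart_inv_in[OF assms, of y] by (metis IntI image_eqI)
qed

lemma open_ov: "c \<in> charts M \<Longrightarrow> d \<in> charts M \<Longrightarrow> open (ov c d)"
proof -
  assume c: "c \<in> charts M" and d: "d \<in> charts M"
  have "ov c d = cimg c \<inter> chart_inv c -` chart_dom d" using mem_ov[OF c] by blast
  then show ?thesis
    using continuous_open_preimage[OF continuous_chart_inv[OF c] open_cimg[OF c] open_dom[OF d]] by simp
qed

lemma Ck_on_transition: "c \<in> charts M \<Longrightarrow> d \<in> charts M \<Longrightarrow> Ck_on k (chart_map d \<circ> chart_inv c) (ov c d)"
  using mfd by (simp add: riemannian_manifold_def smooth_atlas_def smooth_on_def)

lemma tr_has_derivative:
  "c \<in> charts M \<Longrightarrow> d \<in> charts M \<Longrightarrow> y \<in> ov c d \<Longrightarrow> ((chart_map d \<circ> chart_inv c) has_derivative tr c d y) (at y)"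
  unfolding tr_def using Ck_on_has_derivative[OF Ck_on_transition[of c d "Suc 0"]] by blast

lemma linear_tr: "c \<in> charts M \<Longrightarrow> d \<in> charts M \<Longrightarrow> y \<in> ov c d \<Longrightarrow> linear (tr c d y)"
  using tr_has_derivative has_derivative_linear by blast

lemma Ck_on_tr: "c \<in> charts M \<Longrightarrow> d \<in> charts M \<Longrightarrow> Ck_on k (\<lambda>y. tr c d y v) (ov c d)"
  unfolding tr_def by (rule Ck_on_fder[OF Ck_on_transition])

lemma tr_comp:
  assumes "c \<in> charts M" "d \<in> charts M" "e \<in> charts M" and x: "x \<in> chart_dom c" "x \<in> chart_dom d" "x \<in> chart_dom e"
  shows "tr d e (chart_map d x) (tr c d (chart_map c x) v) = tr c e (chart_map c x) v"
proof -
  have y: "chart_map c x \<in> ov c d" "chart_map c x \<in> ov c e" "chart_map d x \<in> ov d e" using x by auto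
  have inv: "(chart_map d \<circ> chart_inv c) (chart_map c x) = chart_map d x" using chart_inv_map assms by simp
  have "((chart_map e \<circ> chart_inv d) \<circ> (chart_map d \<circ> chart_inv c) has_derivative
      tr d e (chart_map d x) \<circ> tr c d (chart_map c x)) (at (chart_map c x))"
    by (rule diff_chain_at[OF tr_has_derivative])
      (use assms y inv tr_has_derivative[of d e "chart_map d x"] in auto)
  then have "((chart_map e \<circ> chart_inv c) has_derivative tr d e (chart_map d x) \<circ> tr c d (chart_map c x)) (at (chart_map c x))"
  proof (rule has_derivative_transform_within_open)
    show "open (ov c d \<inter> ov c e)" using open_ov assms by blast
    show "chart_map c x \<in> ov c d \<inter> ov c e" using y by blast
    show "((chart_map e \<circ> chart_inv d) \<circ> (chart_map d \<circ> chart_inv c)) y = (chart_map e \<circ> chart_inv c) y"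
      if "y \<in> ov c d \<inter> ov c e" for y
      using that mem_ov[OF assms(1)] chart_inv_map[OF assms(2)] by auto
  qed
  then show ?thesis using fder_eqI unfolding tr_def by (metis comp_apply)
qed

lemma tr_refl:
  assumes "c \<in> charts M" "x \<in> chart_dom c"
  shows "tr c c (chart_map c x) v = v"
proof -
  have "((chart_map c \<circ> chart_inv c) has_derivative (\<lambda>h. h)) (at (chart_map c x))"
    by (rule has_derivative_transform_within_open[OF has_derivative_ident open_cimg[OF assms(1)]])
      (use assms chart_map_inv in auto)
  then show ?thesis using fder_eqI unfolding tr_def by metis
qed

lemma chart_at: "chart_at M x \<in> charts M" "x \<in> chart_dom (chart_at M x)"
proof -
  have "x \<in> (\<Union>c\<in>charts M. chart_dom c)"
    using mfd by (simp add: riemannian_manifold_def smooth_atlas_def)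
  then have "\<exists>c. c \<in> charts M \<and> x \<in> chart_dom c" by blast
  from someI_ex[OF this] show "chart_at M x \<in> charts M" "x \<in> chart_dom (chart_at M x)"
    unfolding chart_at_def by auto
qed

lemma to_chart_eq: "to_chart M c x v = tr (chart_at M x) c (chart_map (chart_at M x) x) v"
  and from_chart_eq: "from_chart M c x v = tr c (chart_at M x) (chart_map c x) v"
  by (simp_all add: to_chart_def from_chart_def tr_def)

lemma linear_to_chart: "c \<in> charts M \<Longrightarrow> x \<in> chart_dom c \<Longrightarrow> linear (to_chart M c x)"
  using linear_tr[OF chart_at(1)] chart_at(2) by (simp add: to_chart_eq[abs_def])

lemma linear_from_chart: "c \<in> charts M \<Longrightarrow> x \<in> chart_dom c \<Longrightarrow> linear (from_chart M c x)"
  using linear_tr[OF _ chart_at(1)] chart_at(2) by (simp add: from_chart_eq[abs_def])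

lemma to_chart_tr:
  "c \<in> charts M \<Longrightarrow> d \<in> charts M \<Longrightarrow> x \<in> chart_dom c \<Longrightarrow> x \<in> chart_dom d \<Longrightarrow>
    tr c d (chart_map c x) (to_chart M c x v) = to_chart M d x v"
  using tr_comp[OF chart_at(1)] chart_at(2) by (simp add: to_chart_eq)

lemma from_chart_tr:
  "c \<in> charts M \<Longrightarrow> d \<in> charts M \<Longrightarrow> x \<in> chart_dom c \<Longrightarrow> x \<in> chart_dom d \<Longrightarrow>
    from_chart M d x (tr c d (chart_map c x) v) = from_chart M c x v"
  using tr_comp[OF _ _ chart_at(1)] chart_at(2) by (simp add: from_chart_eq)

lemma from_to_chart: "c \<in> charts M \<Longrightarrow> x \<in> chart_dom c \<Longrightarrow> from_chart M c x (to_chart M c x v) = v"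
  and to_from_chart: "c \<in> charts M \<Longrightarrow> x \<in> chart_dom c \<Longrightarrow> to_chart M c x (from_chart M c x v) = v"
  using tr_comp tr_refl chart_at by (simp_all add: to_chart_eq from_chart_eq)

lemma to_chart_at: "to_chart M (chart_at M x) x v = v"
  using tr_refl chart_at by (simp add: to_chart_eq)

lemma metric_inner_form: "inner_form (metric M x)"
  using mfd by (auto simp: riemannian_manifold_def inner_form_def)

lemma metric_coord_eq:
  "metric_coord M c y v w = metric M (chart_inv c y) (from_chart M c (chart_inv c y) v) (from_chart M c (chart_inv c y) w)"
  by (simp add: metric_coord_def Let_def)

lemma metric_coord_sym: "metric_coord M c y v w = metric_coord M c y w v"
  using inner_formD(4)[OF metric_inner_form] by (simp add: metric_coord_eq)

lemma metric_eq_coord: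
  "c \<in> charts M \<Longrightarrow> x \<in> chart_dom c \<Longrightarrow>
    metric M x v w = metric_coord M c (chart_map c x) (to_chart M c x v) (to_chart M c x w)"
  by (simp add: metric_coord_eq chart_inv_map from_to_chart)

lemma metric_coord_inner_form:
  assumes c: "c \<in> charts M" and y: "y \<in> cimg c"
  shows "inner_form (metric_coord M c y)"
proof -
  define x where "x = chart_inv c y"
  have x: "x \<in> chart_dom c" using chart_inv_in c y by (simp add: x_def)
  note l = linear_from_chart[OF c x] and b = inner_formD[OF metric_inner_form[of x]]
  have m: "metric_coord M c y = (\<lambda>v w. metric M x (from_chart M c x v) (from_chart M c x w))"
    by (intro ext) (simp add: metric_coord_eq x_def)
  have "from_chart M c x v \<noteq> 0" if "v \<noteq> 0" for v
    using to_from_chart[OF c x, of v] that linear_0[OF linear_to_chart[OF c x]] by metis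
  moreover have "bilinear (\<lambda>v w. metric M x (from_chart M c x v) (from_chart M c x w))"
    unfolding bilinear_def
    by (auto intro!: linearI simp: linear_add[OF l] linear_scale[OF l] bilinear_ladd[OF b(3)] bilinear_radd[OF b(3)]
        bilinear_lmul[OF b(3)] bilinear_rmul[OF b(3)])
  ultimately show ?thesis unfolding m inner_form_def using b(4,5) by auto
qed

lemma bilinear_metric_coord: "c \<in> charts M \<Longrightarrow> y \<in> cimg c \<Longrightarrow> bilinear (metric_coord M c y)"
  using inner_formD(3)[OF metric_coord_inner_form] .

lemma Ck_on_metric_coord: "c \<in> charts M \<Longrightarrow> Ck_on k (\<lambda>y. metric_coord M c y v w) (cimg c)"
  using mfd by (simp add: riemannian_manifold_def smooth_on_def)

lemma metric_coord_tr:
  assumes c: "c \<in> charts M" and d: "d \<in> charts M" and y: "y \<in> ov c d"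
  shows "metric_coord M d ((chart_map d \<circ> chart_inv c) y) (tr c d y v) (tr c d y w) = metric_coord M c y v w"
proof -
  have x: "chart_inv c y \<in> chart_dom c" "chart_inv c y \<in> chart_dom d" "y \<in> cimg c"
    using mem_ov[OF c] chart_inv_in[OF c] y by auto
  show ?thesis
    using from_chart_tr[OF c d x(1,2)] chart_map_inv[OF c x(3)] chart_inv_map[OF d x(2)]
    by (simp add: metric_coord_eq)
qed

abbreviation dmet :: "('a, 'e) chart \<Rightarrow> 'e \<Rightarrow> 'e \<Rightarrow> 'e \<Rightarrow> 'e \<Rightarrow> real" where
  "dmet c y h v w \<equiv> fder (\<lambda>y. metric_coord M c y v w) y h"

lemma dmet_sym: "dmet c y h v w = dmet c y h w v"
  using metric_coord_sym by metis

lemma bilinear_dmet: "c \<in> charts M \<Longrightarrow> y \<in> cimg c \<Longrightarrow> bilinear (dmet c y h)"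
  using bilinear_fder_family[OF open_cimg _ bilinear_metric_coord Ck_on_metric_coord] by blast

lemma linear_dmet: "c \<in> charts M \<Longrightarrow> y \<in> cimg c \<Longrightarrow> linear (\<lambda>h. dmet c y h v w)"
  by (rule Ck_on_linear_fder[OF Ck_on_metric_coord])

text \<open>Half of the Koszul right-hand side: with the factor 2 moved over,
  \<open>christoffel\<close> is a Riesz vector and \<open>Ck_on_solve\<close> gives its
  smoothness.\<close>

definition koszul :: "('a, 'e) chart \<Rightarrow> 'e \<Rightarrow> 'e \<Rightarrow> 'e \<Rightarrow> 'e \<Rightarrow> real" where
  "koszul c y v w z = (dmet c y v w z + dmet c y w v z - dmet c y z v w) / 2"

lemma christoffel_riesz: "christoffel M c y v w = riesz (metric_coord M c y) (koszul c y v w)"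
proof -
  have "(2 * a = b) = (a = b / 2)" for a b :: real by auto
  then show ?thesis unfolding christoffel_def riesz_def koszul_def by simp
qed

lemma linear_koszul: "c \<in> charts M \<Longrightarrow> y \<in> cimg c \<Longrightarrow> linear (koszul c y v w)"
  using bilinear_radd[OF bilinear_dmet] bilinear_rmul[OF bilinear_dmet] linear_add[OF linear_dmet] linear_scale[OF linear_dmet]
  by (intro linearI) (simp_all add: koszul_def field_simps)

lemma christoffel:
  assumes "c \<in> charts M" "y \<in> cimg c"
  shows "metric_coord M c y (christoffel M c y v w) z = koszul c y v w z"
  unfolding christoffel_riesz using riesz[OF metric_coord_inner_form linear_koszul] assms by blast

lemma christoffel_unique:
  assumes "c \<in> charts M" "y \<in> cimg c" "\<And>z. metric_coord M c y u z = koszul c y v w z"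
  shows "christoffel M c y v w = u"
  unfolding christoffel_riesz using riesz_unique[OF metric_coord_inner_form[OF assms(1,2)] assms(3)] .

lemma christoffel_sym: "christoffel M c y v w = christoffel M c y w v"
proof -
  have "koszul c y v w z = koszul c y w v z" for z
    using dmet_sym[of c v w y z] by (simp add: koszul_def)
  then show ?thesis unfolding christoffel_riesz by presburger
qed

lemma bilinear_christoffel:
  assumes c: "c \<in> charts M" and y: "y \<in> cimg c"
  shows "bilinear (christoffel M c y)"
proof -
  note g = metric_coord_inner_form[OF c y] and b = bilinear_dmet[OF c y] and l = linear_dmet[OF c y]
    and gb = bilinear_metric_coord[OF c y]
  have "linear (\<lambda>v. christoffel M c y v w)" for w
  proof (rule linearI)
    show "christoffel M c y (v + v') w = christoffel M c y v w + christoffel M c y v' w" for v v'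
      by (rule inner_form_eqI[OF g], simp add: bilinear_ladd[OF gb] christoffel[OF c y])
        (simp add: koszul_def bilinear_ladd[OF b] linear_add[OF l] field_simps)
    show "christoffel M c y (r *\<^sub>R v) w = r *\<^sub>R christoffel M c y v w" for r v
      by (rule inner_form_eqI[OF g], simp add: bilinear_lmul[OF gb] christoffel[OF c y])
        (simp add: koszul_def bilinear_lmul[OF b] linear_scale[OF l] field_simps)
  qed
  moreover have "(\<lambda>w. christoffel M c y v w) = (\<lambda>w. christoffel M c y w v)" for v
    using christoffel_sym[of c y] by blast
  ultimately show ?thesis unfolding bilinear_def by metis
qed

lemma Ck_on_christoffel:
  assumes c: "c \<in> charts M"
  shows "Ck_on k (\<lambda>y. christoffel M c y v w) (cimg c)"
proof (rule Ck_on_solve[OF open_cimg[OF c] metric_coord_inner_form[OF c] Ck_on_metric_coord[OF c] _ christoffel[OF c]])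
  show "Ck_on k (\<lambda>y. koszul c y v w z) (cimg c)" for z
    unfolding koszul_def divide_inverse mult.commute[of _ "inverse 2"]
    by (intro Ck_on_linear_comp[OF bounded_linear_mult_right] Ck_on_diff Ck_on_add open_cimg c
        Ck_on_fder[OF Ck_on_metric_coord])
qed

text \<open>In the sum of the two Koszul expressions the derivatives along \<open>a\<close> and
  \<open>b\<close> cancel, and the two halves of the derivative along \<open>v\<close> add
  up.\<close>

lemma metric_compatible:
  assumes "c \<in> charts M" "y \<in> cimg c"
  shows "dmet c y v a b = metric_coord M c y (christoffel M c y v a) b + metric_coord M c y a (christoffel M c y v b)"
proof -
  have "metric_coord M c y a (christoffel M c y v b) = koszul c y v b a"
    using christoffel[OF assms] metric_coord_sym by metis
  then show ?thesis
    using christoffel[OF assms, of v a b] dmet_sym[of c a b y v] by (simp add: koszul_def field_simps)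
qed

text \<open>The product rule applied to \<open>metric_coord_tr\<close>, where the base point and
  both arguments move with \<open>y\<close>.\<close>

lemma dmet_tr:
  assumes c: "c \<in> charts M" and d: "d \<in> charts M" and y: "y \<in> ov c d"
  defines "y' \<equiv> (chart_map d \<circ> chart_inv c) y"
  shows "dmet c y h v w = dmet d y' (tr c d y h) (tr c d y v) (tr c d y w)
    + metric_coord M d y' (fder (\<lambda>y. tr c d y v) y h) (tr c d y w)
    + metric_coord M d y' (tr c d y v) (fder (\<lambda>y. tr c d y w) y h)"
proof -
  have y': "y' \<in> cimg d" using mem_ov[OF c] y by (auto simp: y'_def)
  have dv: "((\<lambda>y. tr c d y v) has_derivative fder (\<lambda>y. tr c d y v) y) (at y)" for v
    using Ck_on_has_derivative[OF Ck_on_tr[OF c d, of "Suc 0"] y] .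
  have "((\<lambda>y. metric_coord M d ((chart_map d \<circ> chart_inv c) y) (tr c d y v) (tr c d y w)) has_derivative
      (\<lambda>h. dmet d y' (tr c d y h) (tr c d y v) (tr c d y w)
        + metric_coord M d y' (fder (\<lambda>y. tr c d y v) y h) (tr c d y w)
        + metric_coord M d y' (tr c d y v) (fder (\<lambda>y. tr c d y w) y h))) (at y)"
    (is "(_ has_derivative ?D) _")
    unfolding y'_def
    by (rule has_derivative_bilinear_family[OF open_cimg[OF d] _ bilinear_metric_coord[OF d] Ck_on_metric_coord[OF d, of "Suc 0"]
          tr_has_derivative[OF c d y] dv dv]) (use y' y'_def in auto)
  then have "((\<lambda>y. metric_coord M c y v w) has_derivative ?D) (at y)"
    by (rule has_derivative_transform_within_open[OF _ open_ov[OF c d] y]) (rule metric_coord_tr[OF c d])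
  from fder_eqI[OF this] show ?thesis by simp
qed

text \<open>\<open>dmet_tr\<close> turns the Koszul expression of \<open>c\<close> into that of
  \<open>d\<close> plus second derivatives of the transition. By their symmetry these cancel except
  for two equal ones, which make up the inhomogeneous term of the transformation law.\<close>

lemma christoffel_tr:
  assumes c: "c \<in> charts M" and d: "d \<in> charts M" and y: "y \<in> ov c d"
  shows "christoffel M d ((chart_map d \<circ> chart_inv c) y) (tr c d y v) (tr c d y w)
    = tr c d y (christoffel M c y v w) - fder (\<lambda>y. tr c d y w) y v"
proof (rule christoffel_unique[OF d])
  define y' where "y' = (chart_map d \<circ> chart_inv c) y"
  have yc: "y \<in> cimg c" and y': "y' \<in> cimg d" and xd: "chart_inv c y \<in> chart_dom d" "chart_inv c y \<in> chart_dom c"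
    using mem_ov[OF c] y chart_inv_in[OF c] by (auto simp: y'_def)
  show "(chart_map d \<circ> chart_inv c) y \<in> cimg d" using y' by (simp add: y'_def)
  fix z'
  \<comment> \<open>Testing against images of \<open>tr c d y\<close> suffices, because every
    \<open>z'\<close> is the image of its transform back to \<open>c\<close>.\<close>
  define z where "z = tr d c y' z'"
  have z': "z' = tr c d y z"
    using tr_comp[OF d c d xd(1,2,1)] tr_refl[OF d xd(1)] chart_map_inv[OF c yc] by (simp add: z_def y'_def)
  note g = bilinear_metric_coord[OF d y']
  have s: "fder (\<lambda>y. tr c d y a) y b = fder (\<lambda>y. tr c d y b) y a" for a b
    unfolding tr_def by (rule fder_fder_sym[OF Ck_on_transition[OF c d] open_ov[OF c d] y])
  note D = dmet_tr[OF c d y, folded y'_def]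
  have "metric_coord M d y' (tr c d y (christoffel M c y v w)) (tr c d y z) = koszul c y v w z"
    using metric_coord_tr[OF c d y] christoffel[OF c yc] by (simp add: y'_def)
  also have "\<dots> = koszul d y' (tr c d y v) (tr c d y w) (tr c d y z)
      + metric_coord M d y' (fder (\<lambda>y. tr c d y w) y v) (tr c d y z)"
    unfolding koszul_def D s[of z] s[of w v]
    using metric_coord_sym[of d y' "tr c d y w" "fder (\<lambda>y. tr c d y v) y z"]
    by (simp add: field_simps s[of w v] s[of z v] s[of z w] metric_coord_sym[of d y' "fder (\<lambda>y. tr c d y v) y z"])
  finally show "metric_coord M d ((chart_map d \<circ> chart_inv c) y) (tr c d y (christoffel M c y v w) - fder (\<lambda>y. tr c d y w) y v) z'
      = koszul d ((chart_map d \<circ> chart_inv c) y) (tr c d y v) (tr c d y w) z'"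
    unfolding z' y'_def[symmetric] by (simp add: bilinear_lsub[OF g])
qed

end

section \<open>Geodesics and the exponential map\<close>

context riemannian
begin

text \<open>\<open>velocity\<close> uses the chart selected at the moving point, so its coordinates
  may jump with \<open>t\<close>; a fixed chart \<open>c\<close> is needed to state differential
  equations.\<close>

abbreviation cvel :: "('a, 'e) chart \<Rightarrow> (real \<Rightarrow> 'a) \<Rightarrow> real \<Rightarrow> 'e" where
  "cvel c \<gamma> t \<equiv> vector_derivative (chart_map c \<circ> \<gamma>) (at t)"

definition cstate :: "('a, 'e) chart \<Rightarrow> (real \<Rightarrow> 'a) \<Rightarrow> real \<Rightarrow> 'e \<times> 'e" where
  "cstate c \<gamma> t = (chart_map c (\<gamma> t), cvel c \<gamma> t)"

lemma chart_curve_tr: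
  assumes c: "c \<in> charts M" and d: "d \<in> charts M" and t: "\<gamma> t \<in> chart_dom c" "\<gamma> t \<in> chart_dom d" "t \<in> T"
    and \<gamma>: "continuous (at t within T) \<gamma>" and p: "((chart_map c \<circ> \<gamma>) has_vector_derivative p) (at t within T)"
  shows "((chart_map d \<circ> \<gamma>) has_vector_derivative tr c d (chart_map c (\<gamma> t)) p) (at t within T)"
proof -
  have y: "chart_map c (\<gamma> t) \<in> ov c d" using t by auto
  have "((\<lambda>\<tau>. (chart_map d \<circ> chart_inv c) ((chart_map c \<circ> \<gamma>) \<tau>)) has_derivative
      (\<lambda>h. tr c d (chart_map c (\<gamma> t)) (h *\<^sub>R p))) (at t within T)"
    by (rule has_derivative_compose[where g="chart_map d \<circ> chart_inv c", OF p[unfolded has_vector_derivative_def]])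
      (use tr_has_derivative[OF c d y] in \<open>simp only: comp_apply\<close>)
  moreover have "\<forall>\<^sub>F \<tau> in at t within T. (chart_map d \<circ> chart_inv c) ((chart_map c \<circ> \<gamma>) \<tau>) = (chart_map d \<circ> \<gamma>) \<tau>"
  proof -
    have "\<forall>\<^sub>F \<tau> in at t within T. \<gamma> \<tau> \<in> chart_dom c"
      using \<gamma> open_dom[OF c] t by (auto simp: continuous_within topological_tendstoD)
    then show ?thesis by eventually_elim (simp add: chart_inv_map[OF c])
  qed
  ultimately have "((chart_map d \<circ> \<gamma>) has_derivative (\<lambda>h. tr c d (chart_map c (\<gamma> t)) (h *\<^sub>R p))) (at t within T)"
    by (rule has_derivative_transform_eventually) (use chart_inv_map[OF c] t in auto)
  then show ?thesis
    unfolding has_vector_derivative_def by (simp add: linear_scale[OF linear_tr[OF c d y]])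
qed

lemma geodesic_isCont: "geodesic M \<gamma> \<Longrightarrow> isCont \<gamma> t"
  by (simp add: geodesic_def continuous_on_eq_continuous_at)

lemma geodesic_open_dom: "geodesic M \<gamma> \<Longrightarrow> c \<in> charts M \<Longrightarrow> open {t. \<gamma> t \<in> chart_dom c}"
  using continuous_open_preimage[of UNIV \<gamma> "chart_dom c"] open_dom by (simp add: geodesic_def vimage_def)

lemma geodesic_cvel:
  "geodesic M \<gamma> \<Longrightarrow> c \<in> charts M \<Longrightarrow> \<gamma> t \<in> chart_dom c \<Longrightarrow>
    ((chart_map c \<circ> \<gamma>) has_vector_derivative cvel c \<gamma> t) (at t)"
  using vector_derivative_works[of "chart_map c \<circ> \<gamma>" "at t"] by (simp add: geodesic_def)

lemma to_chart_velocity: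
  assumes "geodesic M \<gamma>" "c \<in> charts M" "\<gamma> t \<in> chart_dom c"
  shows "to_chart M c (\<gamma> t) (velocity M \<gamma> t) = cvel c \<gamma> t"
  using chart_curve_tr[OF chart_at(1) assms(2) chart_at(2) assms(3) UNIV_I geodesic_isCont[OF assms(1)]
      geodesic_cvel[OF assms(1) chart_at]]
  unfolding to_chart_eq velocity_def by (simp add: vector_derivative_at)

lemma geodesic_chart:
  assumes g: "geodesic M \<gamma>" and c: "c \<in> charts M" "\<gamma> t \<in> chart_dom c"
  shows "(cvel c \<gamma> has_vector_derivative - christoffel M c (chart_map c (\<gamma> t)) (cvel c \<gamma> t) (cvel c \<gamma> t)) (at t)"
proof -
  have "((\<lambda>\<tau>. to_chart M c (\<gamma> \<tau>) (velocity M \<gamma> \<tau>)) has_vector_derivative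
      - christoffel M c (chart_map c (\<gamma> t)) (cvel c \<gamma> t) (cvel c \<gamma> t)) (at t)"
  proof -
    have "((\<lambda>\<tau>. to_chart M c (\<gamma> \<tau>) (velocity M \<gamma> \<tau>)) has_vector_derivative
        - christoffel M c (chart_map c (\<gamma> t)) (cvel c \<gamma> t) (to_chart M c (\<gamma> t) (velocity M \<gamma> t))) (at t)"
      using g c unfolding geodesic_def parallel_on_def by blast
    then show ?thesis using to_chart_velocity[OF g c] by simp
  qed
  then show ?thesis
    by (rule has_vector_derivative_transform_within_open[OF _ geodesic_open_dom[OF g c(1)]])
      (use c to_chart_velocity[OF g c(1)] in auto)
qed

lemma cstate_has_vector_derivative:
  assumes "geodesic M \<gamma>" "c \<in> charts M" "\<gamma> t \<in> chart_dom c"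
  shows "(cstate c \<gamma> has_vector_derivative geo_field (christoffel M c) (cstate c \<gamma> t)) (at t)"
  unfolding cstate_def[abs_def] geo_field_def
  using has_vector_derivative_Pair[OF geodesic_cvel[OF assms] geodesic_chart[OF assms]] by simp

lemma isCont_cstate: "geodesic M \<gamma> \<Longrightarrow> c \<in> charts M \<Longrightarrow> \<gamma> t \<in> chart_dom c \<Longrightarrow> isCont (cstate c \<gamma>) t"
  using cstate_has_vector_derivative has_vector_derivative_continuous by blast

lemma geodesic_near_dom:
  assumes g: "geodesic M \<gamma>" and c: "c \<in> charts M" "\<gamma> t \<in> chart_dom c"
  obtains d where "d > 0" "\<And>r. \<bar>r - t\<bar> < d \<Longrightarrow> \<gamma> r \<in> chart_dom c"
proof -
  obtain d where "d > 0" "ball t d \<subseteq> {r. \<gamma> r \<in> chart_dom c}"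
    using geodesic_open_dom[OF g c(1)] c(2) by (metis mem_Collect_eq open_contains_ball)
  then show thesis using that[of d] by (auto simp: subset_iff dist_real_def abs_minus_commute)
qed

lemma cstate_near:
  assumes g: "geodesic M \<gamma>" and c: "c \<in> charts M" "\<gamma> t \<in> chart_dom c" and B: "open B" "cstate c \<gamma> t \<in> B"
  obtains d where "d > 0" "\<And>r. \<bar>r - t\<bar> < d \<Longrightarrow> \<gamma> r \<in> chart_dom c \<and> cstate c \<gamma> r \<in> B"
proof -
  obtain d1 where d1: "d1 > 0" "\<And>r. \<bar>r - t\<bar> < d1 \<Longrightarrow> \<gamma> r \<in> chart_dom c"
    using geodesic_near_dom[OF g c] by blast
  have "\<forall>\<^sub>F r in at t. cstate c \<gamma> r \<in> B"
    by (rule topological_tendstoD[OF isCont_cstate[OF g c, unfolded isCont_def] B])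
  then obtain d2 where d2: "d2 > 0" "\<And>r. r \<noteq> t \<Longrightarrow> \<bar>r - t\<bar> < d2 \<Longrightarrow> cstate c \<gamma> r \<in> B"
    unfolding eventually_at dist_real_def by blast
  show thesis
    by (rule that[of "min d1 d2"]) (use d1 d2 B(2) in \<open>auto, metis\<close>)
qed

text \<open>Both sides of the geodesic equation acquire the factor \<open>a\<^sup>2\<close>, the
  right one by bilinearity. This identifies \<open>Exp M x (t *\<^sub>R v)\<close> with a point of
  one geodesic, and \<open>a = - 1\<close> reverses time.\<close>

lemma geodesic_scale:
  assumes g: "geodesic M \<gamma>"
  shows "geodesic M (\<lambda>t. \<gamma> (a * t))" and "velocity M (\<lambda>t. \<gamma> (a * t)) t = a *\<^sub>R velocity M \<gamma> (a * t)"
proof -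
  have cont: "continuous_on UNIV (\<lambda>t. \<gamma> (a * t))"
    using g by (auto simp: geodesic_def intro!: continuous_on_compose2[of UNIV \<gamma>] continuous_intros)
  have sc: "((\<lambda>t. a * t) has_vector_derivative a) (at t)" for t
    by (auto intro!: derivative_eq_intros simp: has_real_derivative_iff_has_vector_derivative[symmetric])
  have d: "((chart_map c \<circ> (\<lambda>t. \<gamma> (a * t))) has_vector_derivative a *\<^sub>R cvel c \<gamma> (a * t)) (at t)"
    if "c \<in> charts M" "\<gamma> (a * t) \<in> chart_dom c" for c t
    using vector_diff_chain_at[OF sc geodesic_cvel[OF g that]] by (simp add: o_def)
  have vel: "velocity M (\<lambda>t. \<gamma> (a * t)) t = a *\<^sub>R velocity M \<gamma> (a * t)" for t
    using vector_derivative_at[OF d[OF chart_at, of t]] by (simp add: velocity_def)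
  then show "velocity M (\<lambda>t. \<gamma> (a * t)) t = a *\<^sub>R velocity M \<gamma> (a * t)" .
  show "geodesic M (\<lambda>t. \<gamma> (a * t))"
    unfolding geodesic_def
  proof (intro conjI allI ballI impI)
    show "continuous_on UNIV (\<lambda>t. \<gamma> (a * t))" by (rule cont)
    fix t c assume c: "c \<in> charts M" "\<gamma> (a * t) \<in> chart_dom c"
    show "(chart_map c \<circ> (\<lambda>t. \<gamma> (a * t))) differentiable at t"
      using d[OF c] differentiableI_vector by blast
  next
    show "parallel_on M UNIV (\<lambda>t. \<gamma> (a * t)) (velocity M (\<lambda>t. \<gamma> (a * t)))"
      unfolding parallel_on_def
    proof (intro ballI impI)
      fix t c assume c: "c \<in> charts M" "\<gamma> (a * t) \<in> chart_dom c"
      define p where "p = cvel c \<gamma> (a * t)"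
      define y where "y = chart_map c (\<gamma> (a * t))"
      have b: "bilinear (christoffel M c y)" using bilinear_christoffel c by (simp add: y_def)
      have tv: "to_chart M c (\<gamma> (a * \<tau>)) (velocity M (\<lambda>t. \<gamma> (a * t)) \<tau>) = a *\<^sub>R cvel c \<gamma> (a * \<tau>)"
        if "\<gamma> (a * \<tau>) \<in> chart_dom c" for \<tau>
        using to_chart_velocity[OF g c(1) that] linear_scale[OF linear_to_chart[OF c(1) that]] by (simp add: vel)
      have "((\<lambda>\<tau>. a *\<^sub>R cvel c \<gamma> (a * \<tau>)) has_vector_derivative a *\<^sub>R (a *\<^sub>R - christoffel M c y p p)) (at t)"
        using vector_diff_chain_at[OF sc geodesic_chart[OF g c]] unfolding p_def y_def
        by (intro bounded_linear.has_vector_derivative[OF bounded_linear_scaleR_right]) (simp add: o_def)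
      then have "((\<lambda>\<tau>. a *\<^sub>R cvel c \<gamma> (a * \<tau>)) has_vector_derivative - christoffel M c y (a *\<^sub>R p) (a *\<^sub>R p)) (at t)"
        by (simp add: bilinear_lmul[OF b] bilinear_rmul[OF b])
      then have "((\<lambda>\<tau>. to_chart M c (\<gamma> (a * \<tau>)) (velocity M (\<lambda>t. \<gamma> (a * t)) \<tau>)) has_vector_derivative
          - christoffel M c y (a *\<^sub>R p) (a *\<^sub>R p)) (at t)"
      proof (rule has_vector_derivative_transform_within_open)
        show "open {\<tau>. \<gamma> (a * \<tau>) \<in> chart_dom c}"
          using continuous_open_preimage[OF cont open_UNIV open_dom[OF c(1)]] by (simp add: vimage_def)
      qed (use c tv in auto)
      then show "((\<lambda>\<tau>. to_chart M c (\<gamma> (a * \<tau>)) (velocity M (\<lambda>t. \<gamma> (a * t)) \<tau>)) has_vector_derivative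
          - christoffel M c (chart_map c (\<gamma> (a * t)))
            (vector_derivative (chart_map c \<circ> (\<lambda>t. \<gamma> (a * t))) (at t within UNIV))
            (to_chart M c (\<gamma> (a * t)) (velocity M (\<lambda>t. \<gamma> (a * t)) t))) (at t within UNIV)"
        using vector_derivative_at[OF d[OF c]] tv[OF c(2)] by (simp add: p_def y_def)
    qed
  qed
qed

lemma geo_field_smooth: "c \<in> charts M \<Longrightarrow> Ck_on k (geo_field (christoffel M c)) (cimg c \<times> UNIV)"
  by (rule Ck_on_geo_field[OF open_cimg bilinear_christoffel Ck_on_christoffel])

text \<open>Position and velocity must be continued together. At a limit time the positions agree
  because the space is Hausdorff; only then does one chart contain both points and permit a
  comparison of velocities. Beyond a common state \<open>ode_unique\<close> applies in a ball inside
  the chart.\<close>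

lemma geodesic_unique_forward:
  assumes g: "geodesic M \<gamma>1" "geodesic M \<gamma>2" and eq: "\<gamma>1 0 = \<gamma>2 0" "velocity M \<gamma>1 0 = velocity M \<gamma>2 0"
    and t: "t \<in> {0..b}"
  shows "\<gamma>1 t = \<gamma>2 t \<and> velocity M \<gamma>1 t = velocity M \<gamma>2 t"
proof (rule real_induct_Icc[OF _ _ _ t])
  show "\<gamma>1 0 = \<gamma>2 0 \<and> velocity M \<gamma>1 0 = velocity M \<gamma>2 0" using eq by blast
next
  fix t :: real assume t: "0 < t" and P: "\<forall>s\<in>{0..<t}. \<gamma>1 s = \<gamma>2 s \<and> velocity M \<gamma>1 s = velocity M \<gamma>2 s"
  have ev: "\<forall>\<^sub>F s in at_left t. s \<in> {0..<t}" using eventually_at_left_real[OF t] by eventually_elim auto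
  have lim: "(\<gamma>1 \<longlongrightarrow> \<gamma>1 t) (at_left t)" "(\<gamma>2 \<longlongrightarrow> \<gamma>2 t) (at_left t)"
    using geodesic_isCont[OF g(1), of t] geodesic_isCont[OF g(2), of t] by (auto simp: isCont_def filterlim_at_split)
  have "\<forall>\<^sub>F s in at_left t. \<gamma>2 s = \<gamma>1 s" using ev by eventually_elim (use P in auto)
  then have e: "\<gamma>1 t = \<gamma>2 t"
    using tendsto_unique[OF _ lim(1) Lim_transform_eventually[OF lim(2)]] by simp
  define c where "c = chart_at M (\<gamma>1 t)"
  have c: "c \<in> charts M" "\<gamma>1 t \<in> chart_dom c" "\<gamma>2 t \<in> chart_dom c" using chart_at[of "\<gamma>1 t"] e by (auto simp: c_def)
  have "(cvel c \<gamma>1 \<longlongrightarrow> cvel c \<gamma>1 t) (at t)" "(cvel c \<gamma>2 \<longlongrightarrow> cvel c \<gamma>2 t) (at t)"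
    using geodesic_chart[OF g(1) c(1,2)] geodesic_chart[OF g(2) c(1,3)] has_vector_derivative_continuous isCont_def by blast+
  then have limv: "(cvel c \<gamma>1 \<longlongrightarrow> cvel c \<gamma>1 t) (at_left t)" "(cvel c \<gamma>2 \<longlongrightarrow> cvel c \<gamma>2 t) (at_left t)"
    by (auto simp: filterlim_at_split)
  have "\<forall>\<^sub>F s in at_left t. \<gamma>1 s \<in> chart_dom c"
    using lim(1) open_dom[OF c(1)] c(2) by (simp add: topological_tendstoD)
  then have "\<forall>\<^sub>F s in at_left t. cvel c \<gamma>2 s = cvel c \<gamma>1 s"
    using ev by eventually_elim (metis P to_chart_velocity[OF g(1) c(1)] to_chart_velocity[OF g(2) c(1)])
  then have "cvel c \<gamma>1 t = cvel c \<gamma>2 t"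
    using tendsto_unique[OF _ limv(1) Lim_transform_eventually[OF limv(2)]] by simp
  then show "\<gamma>1 t = \<gamma>2 t \<and> velocity M \<gamma>1 t = velocity M \<gamma>2 t"
    using e unfolding velocity_def c_def by simp
next
  fix t :: real assume t: "0 \<le> t" and "\<forall>s\<in>{0..t}. \<gamma>1 s = \<gamma>2 s \<and> velocity M \<gamma>1 s = velocity M \<gamma>2 s"
  then have e: "\<gamma>1 t = \<gamma>2 t" "velocity M \<gamma>1 t = velocity M \<gamma>2 t" by auto
  define c where "c = chart_at M (\<gamma>1 t)"
  have c: "c \<in> charts M" "\<gamma>1 t \<in> chart_dom c" "\<gamma>2 t \<in> chart_dom c" using chart_at[of "\<gamma>1 t"] e by (auto simp: c_def)
  have est: "cstate c \<gamma>2 t = cstate c \<gamma>1 t"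
    using to_chart_velocity[OF g(1) c(1,2)] to_chart_velocity[OF g(2) c(1,3)] e by (simp add: cstate_def)
  have "cstate c \<gamma>1 t \<in> cimg c \<times> UNIV" "open (cimg c \<times> (UNIV::'e set))"
    using c open_cimg by (auto simp: cstate_def open_Times)
  then obtain r where r: "r > 0" "cball (cstate c \<gamma>1 t) r \<subseteq> cimg c \<times> UNIV" by (metis open_contains_cball)
  have in_ball: "cstate c \<gamma>1 t \<in> ball (cstate c \<gamma>1 t) r" "cstate c \<gamma>2 t \<in> ball (cstate c \<gamma>1 t) r"
    using r(1) est by auto
  obtain d1 where d1: "d1 > 0" "\<And>s. \<bar>s - t\<bar> < d1 \<Longrightarrow> \<gamma>1 s \<in> chart_dom c \<and> cstate c \<gamma>1 s \<in> ball (cstate c \<gamma>1 t) r"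
    using cstate_near[OF g(1) c(1,2) open_ball in_ball(1)] by blast
  obtain d2 where d2: "d2 > 0" "\<And>s. \<bar>s - t\<bar> < d2 \<Longrightarrow> \<gamma>2 s \<in> chart_dom c \<and> cstate c \<gamma>2 s \<in> ball (cstate c \<gamma>1 t) r"
    using cstate_near[OF g(2) c(1,3) open_ball in_ball(2)] by blast
  define u where "u = t + min d1 d2 / 2"
  have near: "\<gamma>1 s \<in> chart_dom c" "cstate c \<gamma>1 s \<in> cball (cstate c \<gamma>1 t) r"
      "\<gamma>2 s \<in> chart_dom c" "cstate c \<gamma>2 s \<in> cball (cstate c \<gamma>1 t) r" if "s \<in> {t..u}" for s
    using d1(2)[of s] d2(2)[of s] that d1(1) d2(1) ball_subset_cball by (auto simp: u_def min_def split: if_splits)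
  have "\<gamma>1 s = \<gamma>2 s \<and> velocity M \<gamma>1 s = velocity M \<gamma>2 s" if s: "s \<in> {t..u}" for s
  proof -
    have "cstate c \<gamma>1 s = cstate c \<gamma>2 s"
      by (rule ode_unique[OF geo_field_smooth[OF c(1), of "Suc 0"] _ _ r(2), of t u])
        (use near s est in \<open>auto intro!: has_vector_derivative_at_within[OF cstate_has_vector_derivative] g c\<close>)
    then have m: "chart_map c (\<gamma>1 s) = chart_map c (\<gamma>2 s)" "cvel c \<gamma>1 s = cvel c \<gamma>2 s" by (auto simp: cstate_def)
    then have "\<gamma>1 s = \<gamma>2 s" using chart_inv_map[OF c(1)] near s by metis
    moreover have "velocity M \<gamma>1 s = velocity M \<gamma>2 s"
      using from_to_chart[OF c(1)] to_chart_velocity[OF g(1) c(1)] to_chart_velocity[OF g(2) c(1)] near[OF s] m calculation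
      by metis
    ultimately show ?thesis by blast
  qed
  then show "\<exists>u>t. \<forall>s. t < s \<and> s \<le> u \<and> s \<le> b \<longrightarrow> \<gamma>1 s = \<gamma>2 s \<and> velocity M \<gamma>1 s = velocity M \<gamma>2 s"
    using d1(1) d2(1) by (intro exI[of _ u]) (auto simp: u_def)
qed

lemma geodesic_unique:
  assumes g: "geodesic M \<gamma>1" "geodesic M \<gamma>2" and eq: "\<gamma>1 0 = \<gamma>2 0" "velocity M \<gamma>1 0 = velocity M \<gamma>2 0"
  shows "\<gamma>1 = \<gamma>2"
proof
  fix t :: real
  show "\<gamma>1 t = \<gamma>2 t"
  proof (cases "t \<ge> 0")
    case True
    then show ?thesis using geodesic_unique_forward[OF g eq, of t t] by simp
  next
    case False
    have "\<gamma>1 (- 1 * - t) = \<gamma>2 (- 1 * - t) \<and> velocity M (\<lambda>t. \<gamma>1 (- 1 * t)) (- t) = velocity M (\<lambda>t. \<gamma>2 (- 1 * t)) (- t)"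
      by (rule geodesic_unique_forward[OF geodesic_scale(1)[OF g(1), of "-1"] geodesic_scale(1)[OF g(2), of "-1"], of "-t" "-t"])
        (use eq False geodesic_scale(2)[OF g(1), of "-1" 0] geodesic_scale(2)[OF g(2), of "-1" 0] in auto)
    then show ?thesis by simp
  qed
qed

end

section \<open>The exponential map near the origin of a tangent space\<close>

locale complete_riemannian = riemannian M
  for M :: "('a::{t2_space, second_countable_topology}, 'e::euclidean_space) riem" +
  assumes complete: "complete_manifold M"
begin

definition geo :: "'a \<Rightarrow> 'e \<Rightarrow> real \<Rightarrow> 'a" where
  "geo x v = (THE \<gamma>. geodesic M \<gamma> \<and> \<gamma> 0 = x \<and> velocity M \<gamma> 0 = v)"

lemma geo: "geodesic M (geo x v)" "geo x v 0 = x" "velocity M (geo x v) 0 = v"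
proof -
  have "\<exists>!\<gamma>. geodesic M \<gamma> \<and> \<gamma> 0 = x \<and> velocity M \<gamma> 0 = v"
    using complete geodesic_unique unfolding complete_manifold_def by metis
  from theI'[OF this] show "geodesic M (geo x v)" "geo x v 0 = x" "velocity M (geo x v) 0 = v"
    unfolding geo_def by auto
qed

lemma geo_eqI: "geodesic M \<gamma> \<Longrightarrow> \<gamma> 0 = x \<Longrightarrow> velocity M \<gamma> 0 = v \<Longrightarrow> geo x v = \<gamma>"
  using geodesic_unique[OF geo(1)] geo by metis

lemma Exp_eq_geo: "Exp M x v = geo x v 1"
  by (simp add: Exp_def geo_def)

lemma Exp_scaleR: "Exp M x (t *\<^sub>R v) = geo x v t"
proof -
  have "geo x (t *\<^sub>R v) = (\<lambda>\<tau>. geo x v (t * \<tau>))"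
    by (rule geo_eqI) (use geodesic_scale[OF geo(1)[of x v], of t] geo[of x v] in auto)
  then show ?thesis by (simp add: Exp_eq_geo)
qed

lemma Exp_0: "Exp M x 0 = x"
  using Exp_scaleR[of x 0 0] geo(2) by simp

lemma cvel_geo_0: "cvel (chart_at M x) (geo x u) 0 = u"
  using geo[of x u] by (simp add: velocity_def)

text \<open>The field vanishes at the rest state \<open>z0\<close>, so \<open>gronwall\<close> keeps
  a slow geodesic close to \<open>z0\<close> as long as it stays in the chart. Compactness in turn
  prevents it from leaving the chart while its coordinates remain in the ball.\<close>

lemma geo_stays_near:
  fixes x
  defines "c \<equiv> chart_at M x"
  defines "z0 \<equiv> (chart_map c x, 0)"
  assumes r: "r > 0" "cball z0 r \<subseteq> cimg c \<times> UNIV"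
  shows "\<exists>\<delta>>0. \<forall>u t. norm u < \<delta> \<longrightarrow> t \<in> {0..1} \<longrightarrow> geo x u t \<in> chart_dom c \<and> cstate c (geo x u) t \<in> cball z0 r"
proof -
  have c: "c \<in> charts M" "x \<in> chart_dom c" unfolding c_def by (rule chart_at)+
  define X where "X = geo_field (christoffel M c)"
  have "bilinear (christoffel M c (chart_map c x))" using bilinear_christoffel c by blast
  then have X0: "X z0 = 0" by (simp add: X_def z0_def geo_field_def bilinear_lzero zero_prod_def)
  obtain C where C: "C \<ge> 0" "\<And>a b. a \<in> cball z0 r \<Longrightarrow> b \<in> cball z0 r \<Longrightarrow> norm (X a - X b) \<le> C * norm (a - b)"
    using Ck_on_lipschitz[OF geo_field_smooth[OF c(1), of "Suc 0"] compact_cball convex_cball r(2)] unfolding X_def by blast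
  \<comment> \<open>By \<open>gronwall\<close> a start at distance below \<open>\<delta>\<close>
    from \<open>z0\<close> stays within \<open>\<delta> * exp (C + 1) = r / 2\<close> up to time 1,
    strictly inside the ball, which leaves room for continuation.\<close>
  define \<delta> where "\<delta> = r * exp (- (C + 1)) / 2"
  have \<delta>: "\<delta> > 0" "\<delta> * exp (C + 1) < r" 
  proof -
    have "exp (- (C + 1)) * exp (C + 1) = 1" by (simp add: mult_exp_exp)
    then have "\<delta> * exp (C + 1) = r / 2" by (simp add: \<delta>_def)
    then show "\<delta> > 0" "\<delta> * exp (C + 1) < r" using r(1) by (auto simp: \<delta>_def)
  qed
  have \<delta>r: "\<delta> < r"
  proof -
    have "\<delta> * 1 \<le> \<delta> * exp (C + 1)" using \<delta>(1) C(1) by (intro mult_left_mono) auto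
    then show ?thesis using \<delta>(2) by simp
  qed
  have "geo x u t \<in> chart_dom c \<and> cstate c (geo x u) t \<in> cball z0 r" if u: "norm u < \<delta>" and t: "t \<in> {0..1}" for u t
  proof (rule real_induct_Icc[OF _ _ _ t])
    define \<gamma> where "\<gamma> = geo x u"
    have g: "geodesic M \<gamma>" "\<gamma> 0 = x" using geo by (auto simp: \<gamma>_def)
    have st0: "cstate c \<gamma> 0 = z0 + (0, u)"
      using cvel_geo_0[of x u] g by (simp add: cstate_def z0_def c_def \<gamma>_def)
    show "geo x u 0 \<in> chart_dom c \<and> cstate c (geo x u) 0 \<in> cball z0 r"
      using st0 u \<delta>r c g by (simp add: \<gamma>_def dist_norm norm_Pair)
  next
    fix t assume t: "0 < t" and P: "\<forall>s\<in>{0..<t}. geo x u s \<in> chart_dom c \<and> cstate c (geo x u) s \<in> cball z0 r"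
    define \<gamma> where "\<gamma> = geo x u"
    have g: "geodesic M \<gamma>" using geo by (auto simp: \<gamma>_def)
    have ev: "\<forall>\<^sub>F s in at_left t. s \<in> {0..<t}" using eventually_at_left_real[OF t] by eventually_elim auto
    \<comment> \<open>The positions with coordinates in the projected ball form a compact, hence
      closed, subset of the chart domain. So the limit position lies in the domain too, which has to
      be known before \<open>chart_map c\<close> means anything there.\<close>
    define B where "B = chart_inv c ` (fst ` cball z0 r)"
    have fB: "fst ` cball z0 r \<subseteq> cimg c" using r(2) by auto
    have "compact (fst ` cball z0 r)"
      by (intro compact_continuous_image continuous_intros) auto
    then have "compact B" unfolding B_def
      by (rule compact_continuous_image[OF continuous_on_subset[OF continuous_chart_inv[OF c(1)] fB]])
    then have clB: "closed B" by (rule compact_imp_closed)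
    have Bdom: "B \<subseteq> chart_dom c" using fB chart_inv_in[OF c(1)] by (auto simp: B_def)
    have "\<gamma> s \<in> B" if "s \<in> {0..<t}" for s
    proof -
      have "\<gamma> s = chart_inv c (fst (cstate c \<gamma> s))" "cstate c \<gamma> s \<in> cball z0 r"
        using P that chart_inv_map[OF c(1)] by (auto simp: cstate_def \<gamma>_def)
      then show ?thesis unfolding B_def by blast
    qed
    then have evB: "\<forall>\<^sub>F s in at_left t. \<gamma> s \<in> B" using ev eventually_mono by (metis (mono_tags, lifting))
    have "(\<gamma> \<longlongrightarrow> \<gamma> t) (at_left t)"
      using geodesic_isCont[OF g, of t] by (auto simp: isCont_def filterlim_at_split)
    then have "\<gamma> t \<in> B" using Lim_in_closed_set[OF clB evB] by simp
    then have td: "\<gamma> t \<in> chart_dom c" using Bdom by blast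
    have "(cstate c \<gamma> \<longlongrightarrow> cstate c \<gamma> t) (at_left t)"
      using isCont_cstate[OF g c(1) td] by (auto simp: isCont_def filterlim_at_split)
    moreover have "\<forall>\<^sub>F s in at_left t. cstate c \<gamma> s \<in> cball z0 r"
      using ev by eventually_elim (use P in \<open>auto simp: \<gamma>_def\<close>)
    ultimately have "cstate c \<gamma> t \<in> cball z0 r" using Lim_in_closed_set[OF closed_cball] by (metis trivial_limit_at_left_real)
    then show "geo x u t \<in> chart_dom c \<and> cstate c (geo x u) t \<in> cball z0 r" using td by (simp add: \<gamma>_def)
  next
    fix t :: real assume t: "0 \<le> t" "t < 1" and P: "\<forall>s\<in>{0..t}. geo x u s \<in> chart_dom c \<and> cstate c (geo x u) s \<in> cball z0 r"
    define \<gamma> where "\<gamma> = geo x u"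
    have g: "geodesic M \<gamma>" "\<gamma> 0 = x" using geo by (auto simp: \<gamma>_def)
    have st0: "cstate c \<gamma> 0 = z0 + (0, u)"
      using cvel_geo_0[of x u] g by (simp add: cstate_def z0_def c_def \<gamma>_def)
    have z0r: "z0 \<in> cball z0 r" using r(1) by simp
    have "norm (cstate c \<gamma> t - z0) \<le> (norm (cstate c \<gamma> 0 - z0) + 0) * exp ((C + 1) * (t - 0))"
    proof (rule gronwall[where e'="\<lambda>s. X (cstate c \<gamma> s)" and b=t])
      fix s assume "s \<in> {0..t}"
      then have s: "\<gamma> s \<in> chart_dom c" "cstate c \<gamma> s \<in> cball z0 r" using P by (auto simp: \<gamma>_def)
      show "((\<lambda>s. cstate c \<gamma> s - z0) has_vector_derivative X (cstate c \<gamma> s)) (at s within {0..t})"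
        unfolding X_def using has_vector_derivative_at_within[OF cstate_has_vector_derivative[OF g(1) c(1) s(1)]]
        by (auto intro!: derivative_eq_intros)
      show "norm (X (cstate c \<gamma> s)) \<le> C * norm (cstate c \<gamma> s - z0) + 0"
        using C(2)[OF s(2) z0r] X0 by simp
    qed (use C t in auto)
    also have "\<dots> \<le> norm u * exp (C + 1)"
      unfolding st0 using C(1) t by (auto simp: norm_Pair intro!: mult_left_mono mult_left_le)
    also have "\<dots> < r" using u \<delta>(2) by (smt (verit) exp_gt_zero mult_right_mono)
    finally have "cstate c \<gamma> t \<in> ball z0 r" by (simp add: dist_norm norm_minus_commute)
    moreover have td: "\<gamma> t \<in> chart_dom c" using P t by (simp add: \<gamma>_def)
    ultimately obtain d where d: "d > 0" "\<And>s. \<bar>s - t\<bar> < d \<Longrightarrow> \<gamma> s \<in> chart_dom c \<and> cstate c \<gamma> s \<in> ball z0 r"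
      using cstate_near[OF g(1) c(1) _ open_ball] by blast
    have "geo x u s \<in> chart_dom c \<and> cstate c (geo x u) s \<in> cball z0 r" if "t < s" "s \<le> t + d / 2" for s
      using d(2)[of s] that d(1) by (auto simp: \<gamma>_def)
    then show "\<exists>v>t. \<forall>s. t < s \<and> s \<le> v \<and> s \<le> 1 \<longrightarrow> geo x u s \<in> chart_dom c \<and> cstate c (geo x u) s \<in> cball z0 r"
      using d(1) by (intro exI[of _ "t + d / 2"]) auto
  qed
  then show ?thesis using \<delta>(1) by blast
qed

lemma Exp_chart_derivatives:
  fixes x
  defines "c \<equiv> chart_at M x"
  obtains \<delta> F' where "\<delta> > 0" "\<And>u. norm u < \<delta> \<Longrightarrow> Exp M x u \<in> chart_dom c"
    "\<And>u. norm u < \<delta> \<Longrightarrow> ((\<lambda>u. chart_map c (Exp M x u)) has_derivative F' u) (at u)"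
    "\<And>w. F' 0 w = w"
    "\<And>w. ((\<lambda>u. F' u w) has_derivative (\<lambda>u. - christoffel M c (chart_map c x) u w)) (at 0)"
proof -
  have c: "c \<in> charts M" "x \<in> chart_dom c" unfolding c_def by (rule chart_at)+
  define z0 where "z0 = (chart_map c x, 0::'e)"
  have "z0 \<in> cimg c \<times> UNIV" "open (cimg c \<times> (UNIV::'e set))"
    using c open_cimg by (auto simp: z0_def open_Times)
  then obtain r where r: "r > 0" "cball z0 r \<subseteq> cimg c \<times> UNIV" by (metis open_contains_cball)
  obtain \<delta> where \<delta>: "\<delta> > 0" "\<And>u t. norm u < \<delta> \<Longrightarrow> t \<in> {0..1} \<Longrightarrow> geo x u t \<in> chart_dom c \<and> cstate c (geo x u) t \<in> cball z0 r"
    using geo_stays_near[of r x] r unfolding c_def z0_def by blast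
  have sol: "sol_in (geo_field (christoffel M c)) (cball z0 r) (cstate c (geo x u))" if "norm u < \<delta>" for u
    using \<delta>(2)[OF that] has_vector_derivative_at_within[OF cstate_has_vector_derivative[OF geo(1) c(1)]]
    unfolding sol_in_def by blast
  have init: "cstate c (geo x u) 0 = (chart_map c x, u)" for u
    using cvel_geo_0[of x u] geo(2) by (simp add: cstate_def c_def)
  have z0r: "(chart_map c x, 0) \<in> cball z0 r" using r(1) by (simp add: z0_def)
  obtain F' where F': "\<And>u. norm u < \<delta> \<Longrightarrow> ((\<lambda>u. fst (cstate c (geo x u) 1)) has_derivative F' u) (at u)"
    "\<And>w. F' 0 w = w" "\<And>w. ((\<lambda>u. F' u w) has_derivative (\<lambda>u. - christoffel M c (chart_map c x) u w)) (at 0)"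
    by (rule geodesic_flow_derivatives[OF open_cimg[OF c(1)] bilinear_christoffel[OF c(1)]
          Ck_on_christoffel[OF c(1)] christoffel_sym compact_cball convex_cball r(2) z0r \<delta>(1) sol init])
      (assumption | (rule that; assumption))+
  show thesis
    by (rule that[OF \<delta>(1) _ _ F'(2,3)]) (use \<delta>(2) F'(1) in \<open>auto simp: Exp_eq_geo cstate_def\<close>)
qed

end

section \<open>Gradients and Hessians\<close>

context riemannian
begin

lemma C2_coord: "C2_function M f \<Longrightarrow> c \<in> charts M \<Longrightarrow> Ck_on (Suc (Suc 0)) (f \<circ> chart_inv c) (cimg c)"
  unfolding C2_function_def numeral_2_eq_2 by blast

lemma fder_coord_tr:
  assumes f: "C2_function M f" and c: "c \<in> charts M" "x \<in> chart_dom c" and d: "d \<in> charts M" "x \<in> chart_dom d"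
  shows "fder (f \<circ> chart_inv d) (chart_map d x) (tr c d (chart_map c x) v) = fder (f \<circ> chart_inv c) (chart_map c x) v"
proof -
  have y: "chart_map c x \<in> ov c d" "chart_map d x \<in> cimg d" using c d by auto
  have inv: "(chart_map d \<circ> chart_inv c) (chart_map c x) = chart_map d x" using chart_inv_map c by simp
  have "((f \<circ> chart_inv d) \<circ> (chart_map d \<circ> chart_inv c) has_derivative
      fder (f \<circ> chart_inv d) (chart_map d x) \<circ> tr c d (chart_map c x)) (at (chart_map c x))"
    using diff_chain_at[OF tr_has_derivative[OF c(1) d(1) y(1)], of "f \<circ> chart_inv d"]
      Ck_on_has_derivative[OF C2_coord[OF f d(1)] y(2)] by (simp only: inv)
  then have "(f \<circ> chart_inv c has_derivative fder (f \<circ> chart_inv d) (chart_map d x) \<circ> tr c d (chart_map c x)) (at (chart_map c x))"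
  proof (rule has_derivative_transform_within_open)
    show "open (ov c d)" "chart_map c x \<in> ov c d" using open_ov c d y by auto
    show "((f \<circ> chart_inv d) \<circ> (chart_map d \<circ> chart_inv c)) y = (f \<circ> chart_inv c) y" if "y \<in> ov c d" for y
      using that mem_ov[OF c(1)] chart_inv_map[OF d(1)] by auto
  qed
  then show ?thesis using fder_eqI by (metis comp_apply)
qed

lemma grad_riesz:
  "grad M f x = riesz (metric M x) (fder (f \<circ> chart_inv (chart_at M x)) (chart_map (chart_at M x) x))"
  by (simp add: grad_def riesz_def Let_def)

lemma egrad_riesz: "egrad M x h u = riesz (metric M x) (fder h u)"
  by (simp add: egrad_def riesz_def)

lemma metric_grad:
  assumes f: "C2_function M f"
  shows "metric M x (grad M f x) w = fder (f \<circ> chart_inv (chart_at M x)) (chart_map (chart_at M x) x) w"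
  unfolding grad_riesz
  by (rule riesz[OF metric_inner_form Ck_on_linear_fder[OF C2_coord[OF f chart_at(1)]]]) (use chart_at(2) in blast)

lemma metric_coord_grad:
  assumes f: "C2_function M f" and c: "c \<in> charts M" "x \<in> chart_dom c"
  shows "metric_coord M c (chart_map c x) (to_chart M c x (grad M f x)) w = fder (f \<circ> chart_inv c) (chart_map c x) w"
proof -
  have "metric_coord M c (chart_map c x) (to_chart M c x (grad M f x)) w = metric M x (grad M f x) (from_chart M c x w)"
    using metric_eq_coord[OF c] to_from_chart[OF c] by simp
  also have "\<dots> = fder (f \<circ> chart_inv c) (chart_map c x) (to_chart M c x (from_chart M c x w))"
    using fder_coord_tr[OF f chart_at c] by (simp add: metric_grad[OF f] to_chart_eq)
  finally show ?thesis using to_from_chart[OF c] by simp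
qed

text \<open>The defining relation of the gradient is differentiated in coordinates. Metric
  compatibility splits the derivative of the metric into two Christoffel terms: one cancels that of
  the covariant derivative, the other remains.\<close>

lemma metric_Hess:
  fixes x
  defines "c \<equiv> chart_at M x"
  assumes f: "C2_function M f"
  shows "metric M x (Hess M f x v) w = fder (\<lambda>y. fder (f \<circ> chart_inv c) y w) (chart_map c x) v
    - fder (f \<circ> chart_inv c) (chart_map c x) (christoffel M c (chart_map c x) v w)"
proof -
  have c: "c \<in> charts M" "x \<in> chart_dom c" unfolding c_def by (rule chart_at)+
  define y where "y = chart_map c x"
  have y: "y \<in> cimg c" using c by (simp add: y_def)
  define G where "G y = to_chart M c (chart_inv c y) (grad M f (chart_inv c y))" for y
  have tc: "to_chart M c x u = u" for u using to_chart_at by (simp add: c_def)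
  have Gy: "G y = grad M f x" using chart_inv_map[OF c] tc by (simp add: G_def y_def)
  have mc: "metric M x a b = metric_coord M c y a b" for a b using metric_eq_coord[OF c] tc by (simp add: y_def)
  have G: "metric_coord M c z (G z) u = fder (f \<circ> chart_inv c) z u" if "z \<in> cimg c" for z u
    using metric_coord_grad[OF f c(1) chart_inv_in[OF c(1) that]] chart_map_inv[OF c(1) that] by (simp add: G_def)
  note f2 = C2_coord[OF f c(1)]
  \<comment> \<open>The coordinate gradient solves a linear system whose right-hand side is C^1
    because \<open>f\<close> is C^2; this makes it differentiable.\<close>
  have "Ck_on (Suc 0) G (cimg c)"
    by (rule Ck_on_solve[OF open_cimg[OF c(1)] metric_coord_inner_form[OF c(1)] Ck_on_metric_coord[OF c(1)] _ G])
      (assumption | rule Ck_on_fder[OF f2])+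
  then have dG: "(G has_derivative fder G y) (at y)" using Ck_on_has_derivative y by blast
  have "((\<lambda>z. metric_coord M c z (G z) w) has_derivative
      (\<lambda>h. dmet c y h (G y) w + metric_coord M c y (fder G y h) w + metric_coord M c y (G y) 0)) (at y)"
    (is "(_ has_derivative ?D) _")
    by (rule has_derivative_bilinear_family[where \<psi>="\<lambda>z. z" and S="cimg c", OF open_cimg[OF c(1)] y bilinear_metric_coord[OF c(1)]
          Ck_on_metric_coord[OF c(1), of "Suc 0"] has_derivative_ident dG has_derivative_const UNIV_I])
  then have "((\<lambda>z. fder (f \<circ> chart_inv c) z w) has_derivative ?D) (at y)"
    by (rule has_derivative_transform_within_open[OF _ open_cimg[OF c(1)] y]) (rule G)
  then have D: "fder (\<lambda>z. fder (f \<circ> chart_inv c) z w) y v = dmet c y v (G y) w + metric_coord M c y (fder G y v) w"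
    using fder_eqI bilinear_rzero[OF bilinear_metric_coord[OF c(1) y]] by fastforce
  have "Hess M f x v = fder G y v + christoffel M c y v (G y)"
    by (simp add: Hess_def cov_deriv_def Let_def c_def[symmetric] G_def[abs_def, symmetric] y_def[symmetric] Gy)
  then have "metric M x (Hess M f x v) w
      = metric_coord M c y (fder G y v) w + metric_coord M c y (christoffel M c y v (G y)) w"
    by (simp add: mc bilinear_ladd[OF bilinear_metric_coord[OF c(1) y]])
  also have "\<dots> = fder (\<lambda>z. fder (f \<circ> chart_inv c) z w) y v - metric_coord M c y (G y) (christoffel M c y v w)"
    using D metric_compatible[OF c(1) y, where v=v and a="G y" and b=w] by simp
  finally show ?thesis using G[OF y] by (simp add: y_def)
qed

lemma metric_Hess_sym:
  assumes f: "C2_function M f"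
  shows "metric M x (Hess M f x v) w = metric M x v (Hess M f x w)"
proof -
  have c: "chart_at M x \<in> charts M" "chart_map (chart_at M x) x \<in> cimg (chart_at M x)" using chart_at by blast+
  show ?thesis
    using fder_fder_sym[OF C2_coord[OF f c(1)] open_cimg[OF c(1)] c(2), of w v]
      christoffel_sym[of "chart_at M x" "chart_map (chart_at M x) x" v w] inner_formD(4)[OF metric_inner_form, of x v]
    by (simp add: metric_Hess[OF f])
qed

text \<open>By symmetry the argument moves to the other side of the metric, where linearity is that
  of the metric.\<close>

lemma linear_Hess:
  assumes f: "C2_function M f"
  shows "linear (Hess M f x)"
proof (rule linearI)
  note m = inner_formD(3)[OF metric_inner_form[of x]]
  show "Hess M f x (a + b) = Hess M f x a + Hess M f x b" for a b
    by (rule inner_form_eqI[OF metric_inner_form[of x]])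
      (simp add: metric_Hess_sym[OF f] bilinear_ladd[OF m])
  show "Hess M f x (r *\<^sub>R a) = r *\<^sub>R Hess M f x a" for r a
    by (rule inner_form_eqI[OF metric_inner_form[of x]])
      (simp add: metric_Hess_sym[OF f] bilinear_lmul[OF m])
qed

end

section \<open>Gradient and Hessian of the pulled-back function\<close>

context complete_riemannian
begin

text \<open>With F the coordinate form of \<open>Exp M x\<close>, the derivative of the pullback at
  u in direction w is Df(F(u)) (F'(u) w). At 0 this is Df(w), since F'(0) is the identity; its
  derivative along v there is D^2 f(v, w) - Df(\<Gamma>(v, w)), the formula of
  \<open>metric_Hess\<close>.\<close>

lemma pullback_gradient_hessian:
  assumes f: "C2_function M f"
  shows "egrad M x (f \<circ> Exp M x) 0 = grad M f x" and "ehess M x (f \<circ> Exp M x) 0 v = Hess M f x v"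
proof -
  define c where "c = chart_at M x"
  have c: "c \<in> charts M" "x \<in> chart_dom c" unfolding c_def by (rule chart_at)+
  obtain \<delta> F' where \<delta>: "\<delta> > 0" "\<And>u. norm u < \<delta> \<Longrightarrow> Exp M x u \<in> chart_dom c"
    and F': "\<And>u. norm u < \<delta> \<Longrightarrow> ((\<lambda>u. chart_map c (Exp M x u)) has_derivative F' u) (at u)"
    "\<And>w. F' 0 w = w"
    "\<And>w. ((\<lambda>u. F' u w) has_derivative (\<lambda>u. - christoffel M c (chart_map c x) u w)) (at 0)"
    using Exp_chart_derivatives[of x, folded c_def] by blast
  define h where "h = f \<circ> Exp M x"
  define ft where "ft = f \<circ> chart_inv c"
  define F where "F u = chart_map c (Exp M x u)" for u
  have f2: "Ck_on (Suc (Suc 0)) ft (cimg c)" unfolding ft_def by (rule C2_coord[OF f c(1)])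
  have F: "F u \<in> cimg c" if "norm u < \<delta>" for u using \<delta>(2)[OF that] by (simp add: F_def)
  have F0: "F 0 = chart_map c x" by (simp add: F_def Exp_0)
  have dF: "(F has_derivative F' u) (at u)" if "norm u < \<delta>" for u using F'(1)[OF that] by (simp add: F_def[abs_def])
  have B: "open (ball 0 \<delta> :: 'e set)" "(0::'e) \<in> ball 0 \<delta>" using \<delta>(1) by auto
  have dh: "fder h u = (\<lambda>w. fder ft (F u) (F' u w))" if u: "norm u < \<delta>" for u
  proof -
    have "((\<lambda>u. ft (F u)) has_derivative (\<lambda>w. fder ft (F u) (F' u w))) (at u)"
      by (rule has_derivative_compose[OF dF[OF u] Ck_on_has_derivative[OF f2 F[OF u]]])
    then have "(h has_derivative (\<lambda>w. fder ft (F u) (F' u w))) (at u)"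
      by (rule has_derivative_transform_within_open[OF _ B(1)])
        (use u \<delta>(2) chart_inv_map[OF c(1)] in \<open>auto simp: h_def ft_def F_def\<close>)
    then show ?thesis using fder_eqI by blast
  qed
  have lin: "linear (fder h u)" if u: "norm u < \<delta>" for u
    unfolding dh[OF u]
    using linear_compose[OF has_derivative_linear[OF dF[OF u]] Ck_on_linear_fder[OF f2 F[OF u]]] by (simp add: o_def)
  have "egrad M x h 0 = grad M f x"
    unfolding egrad_riesz grad_riesz dh[of 0, simplified, OF \<delta>(1)] F0 F'(2) by (simp add: ft_def c_def)
  then show "egrad M x (f \<circ> Exp M x) 0 = grad M f x" by (simp add: h_def)
  have l': "((\<lambda>u. fder h u w) has_derivative (\<lambda>v. metric M x (Hess M f x v) w)) (at 0)" for w
  proof -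
    have A: "Ck_on (Suc 0) (\<lambda>y. fder ft y w) (cimg c)" for w by (rule Ck_on_fder[OF f2])
    have F0in: "F 0 \<in> cimg c" using F[of 0] \<delta>(1) by simp
    have dF0: "(F has_derivative F' 0) (at 0)" using dF[of 0] \<delta>(1) by simp
    have "((\<lambda>u. fder ft (F u) (F' u w)) has_derivative
        (\<lambda>v. fder (\<lambda>y. fder ft y (F' 0 w)) (F 0) (F' 0 v) + fder ft (F 0) (- christoffel M c (chart_map c x) v w))) (at 0)"
    (is "(_ has_derivative ?D) _")
      by (rule has_derivative_linear_family[where A="fder ft" and \<psi>=F, OF open_cimg[OF c(1)] F0in Ck_on_linear_fder[OF f2] A dF0 F'(3) UNIV_I])
    then have "((\<lambda>u. fder h u w) has_derivative ?D) (at 0)"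
      by (rule has_derivative_transform_within_open[OF _ B]) (simp add: dh)
    then show ?thesis
    proof (rule has_derivative_eqI)
      fix v
      have "linear (fder ft (F 0))" using Ck_on_linear_fder[OF f2 F0in] .
      then show "?D v = metric M x (Hess M f x v) w"
        unfolding metric_Hess[OF f] by (simp add: F'(2) F0 linear_neg ft_def c_def)
    qed
  qed
  \<comment> \<open>On one tangent space the inner product does not depend on the point, hence the
    zero for \<open>g'\<close>: the Hessian comes from \<open>l'\<close> alone.\<close>
  have "(egrad M x h has_derivative Hess M f x) (at 0)"
  proof (rule solve_has_derivative[where g="\<lambda>_. metric M x" and l="fder h" and g'="\<lambda>_ _ _. 0"])
    show "inner_form (metric M x)" by (rule metric_inner_form)
    show "\<forall>\<^sub>F y in nhds (0::'e). bilinear (metric M x)" using inner_formD(3)[OF metric_inner_form] by simp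
    show "((\<lambda>y. metric M x v w) has_derivative (\<lambda>h. 0)) (at 0)" for v w by simp
    have "\<forall>\<^sub>F u in nhds (0::'e). u \<in> ball 0 \<delta>" using eventually_nhds_in_open[OF B] .
    then show "\<forall>\<^sub>F u in nhds 0. \<forall>w. metric M x (egrad M x h u) w = fder h u w"
      by eventually_elim (use riesz[OF metric_inner_form lin] in \<open>auto simp: egrad_riesz\<close>)
  qed (use l' linear_Hess[OF f] in auto)
  then show "ehess M x (f \<circ> Exp M x) 0 v = Hess M f x v"
    unfolding ehess_def h_def using fder_eqI by metis
qed

end

section \<open>Norms of tangent vectors and the gradient of the cubic model\<close>

context riemannian
begin

lemma bounded_bilinear_metric: "bounded_bilinear (metric M x)"
  using inner_formD(3)[OF metric_inner_form] bilinear_conv_bounded_bilinear by blast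

lemma tnorm_power2: "(tnorm M x v)\<^sup>2 = metric M x v v"
  using inner_formD(6)[OF metric_inner_form] by (simp add: tnorm_def)

lemma tnorm_nonneg: "tnorm M x v \<ge> 0"
  using inner_formD(6)[OF metric_inner_form] by (simp add: tnorm_def)

lemma tnorm_pos: "v \<noteq> 0 \<Longrightarrow> tnorm M x v > 0"
  using inner_formD(5)[OF metric_inner_form] by (simp add: tnorm_def)

text \<open>When neither vector vanishes, positivity is applied to
  \<open>b *\<^sub>R v - a *\<^sub>R w\<close>, where \<open>a\<close> and \<open>b\<close> are the
  norms of \<open>v\<close> and \<open>w\<close>.\<close>

lemma metric_cauchy_schwarz: "metric M x v w \<le> tnorm M x v * tnorm M x w"
proof (cases "v = 0 \<or> w = 0")
  case True
  then show ?thesis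
    using inner_formD(3)[OF metric_inner_form] tnorm_nonneg by (auto simp: bilinear_lzero bilinear_rzero tnorm_def)
next
  case False
  define a b where "a = tnorm M x v" and "b = tnorm M x w"
  have ab: "a > 0" "b > 0" using False tnorm_pos by (auto simp: a_def b_def)
  note m = inner_formD(3)[OF metric_inner_form[of x]]
  have "0 \<le> metric M x (b *\<^sub>R v - a *\<^sub>R w) (b *\<^sub>R v - a *\<^sub>R w)" by (rule inner_formD(6)[OF metric_inner_form])
  also have "\<dots> = b\<^sup>2 * metric M x v v - 2 * a * b * metric M x v w + a\<^sup>2 * metric M x w w"
    using inner_formD(4)[OF metric_inner_form, of x w v]
    by (simp add: bilinear_lsub[OF m] bilinear_rsub[OF m] bilinear_lmul[OF m] bilinear_rmul[OF m] power2_eq_square algebra_simps)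
  also have "\<dots> = 2 * a * b * (a * b - metric M x v w)"
    unfolding tnorm_power2[symmetric] a_def[symmetric] b_def[symmetric] by (simp add: power2_eq_square algebra_simps)
  finally have "0 \<le> (2 * a * b) * (a * b - metric M x v w)" .
  moreover have "2 * a * b > 0" using ab by simp
  ultimately have "0 \<le> a * b - metric M x v w" by (metis zero_le_mult_iff linorder_not_less)
  then show ?thesis unfolding a_def b_def by simp
qed

lemma tnorm_triangle: "tnorm M x (v + w) \<le> tnorm M x v + tnorm M x w"
proof (rule power2_le_imp_le)
  note m = inner_formD(3)[OF metric_inner_form[of x]]
  have "(tnorm M x (v + w))\<^sup>2 = (tnorm M x v)\<^sup>2 + 2 * metric M x v w + (tnorm M x w)\<^sup>2"
    using inner_formD(4)[OF metric_inner_form, of x w v]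
    by (simp add: tnorm_power2 bilinear_ladd[OF m] bilinear_radd[OF m])
  also have "\<dots> \<le> (tnorm M x v)\<^sup>2 + 2 * (tnorm M x v * tnorm M x w) + (tnorm M x w)\<^sup>2"
    using metric_cauchy_schwarz[of x v w] by simp
  finally show "(tnorm M x (v + w))\<^sup>2 \<le> (tnorm M x v + tnorm M x w)\<^sup>2"
    by (simp add: power2_sum)
qed (use tnorm_nonneg in simp)

lemma tnorm_scaleR: "tnorm M x (r *\<^sub>R v) = \<bar>r\<bar> * tnorm M x v"
proof -
  note m = inner_formD(3)[OF metric_inner_form[of x]]
  have "metric M x (r *\<^sub>R v) (r *\<^sub>R v) = r\<^sup>2 * metric M x v v"
    by (simp add: bilinear_lmul[OF m] bilinear_rmul[OF m] power2_eq_square)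
  then show ?thesis by (simp add: tnorm_def real_sqrt_mult)
qed

text \<open>Self-adjointness of \<open>H\<close> merges the two halves of the derivative of the
  quadratic term. Away from 0 the norm n is differentiable, and the factor 3 n^2 from its cube
  leaves \<open>(\<sigma> * n) *\<^sub>R s\<close>.\<close>

lemma egrad_cubic_model:
  assumes H: "linear H" "\<And>v w. metric M x (H v) w = metric M x v (H w)" and s: "s \<noteq> 0"
  shows "egrad M x (\<lambda>s. a + metric M x s g + 1 / 2 * metric M x s (H s) + \<sigma> / 3 * tnorm M x s ^ 3) s
    = g + H s + (\<sigma> * tnorm M x s) *\<^sub>R s"
proof -
  note m = inner_formD(3)[OF metric_inner_form[of x]] and sym = inner_formD(4)[OF metric_inner_form[of x]]
    and bd = bounded_bilinear.FDERIV[OF bounded_bilinear_metric[of x]]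
  define n where "n = tnorm M x s"
  have n: "n > 0" using tnorm_pos[OF s] by (simp add: n_def)
  have sq: "sqrt (metric M x s s) = n" "metric M x s s = n\<^sup>2" using tnorm_power2[of x s] by (auto simp: n_def tnorm_def)
  have dH: "(H has_derivative H) (at s)" using H(1) bounded_linear_imp_has_derivative linear_conv_bounded_linear by blast
  have d1: "((\<lambda>s. metric M x s g) has_derivative (\<lambda>h. metric M x s 0 + metric M x h g)) (at s)"
    by (rule bd[OF has_derivative_ident has_derivative_const])
  have d2: "((\<lambda>s. metric M x s (H s)) has_derivative (\<lambda>h. metric M x s (H h) + metric M x h (H s))) (at s)"
    by (rule bd[OF has_derivative_ident dH])
  have d3: "((\<lambda>s. metric M x s s) has_derivative (\<lambda>h. metric M x s h + metric M x h s)) (at s)"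
    by (rule bd[OF has_derivative_ident has_derivative_ident])
  have "(sqrt has_derivative (\<lambda>h. h * (inverse n / 2))) (at (metric M x s s))"
  proof -
    have "(sqrt has_real_derivative inverse n / 2) (at (metric M x s s))"
      using DERIV_real_sqrt[of "metric M x s s"] n sq by simp
    then show ?thesis unfolding has_field_derivative_def by (rule has_derivative_eqI) simp
  qed
  then have d4: "((\<lambda>s. tnorm M x s) has_derivative (\<lambda>h. (metric M x s h + metric M x h s) * (inverse n / 2))) (at s)"
    unfolding tnorm_def by (rule has_derivative_compose[OF d3])
  have d5: "((\<lambda>s. tnorm M x s ^ 3) has_derivative
      (\<lambda>h. of_nat 3 * ((metric M x s h + metric M x h s) * (inverse n / 2)) * tnorm M x s ^ (3 - 1))) (at s)"
    by (rule has_derivative_power[OF d4])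
  have "((\<lambda>s. a + metric M x s g + 1 / 2 * metric M x s (H s) + \<sigma> / 3 * tnorm M x s ^ 3) has_derivative
      (\<lambda>h. 0 + (metric M x s 0 + metric M x h g) + 1 / 2 * (metric M x s (H h) + metric M x h (H s))
        + \<sigma> / 3 * (of_nat 3 * ((metric M x s h + metric M x h s) * (inverse n / 2)) * tnorm M x s ^ (3 - 1)))) (at s)"
    by (intro has_derivative_add has_derivative_mult_right has_derivative_const d1 d2 d5)
  from fder_eqI[OF this]
  have "fder (\<lambda>s. a + metric M x s g + 1 / 2 * metric M x s (H s) + \<sigma> / 3 * tnorm M x s ^ 3) s h
      = metric M x (g + H s + (\<sigma> * n) *\<^sub>R s) h" for h
    using n sym[of h s] sym[of h g] sym[of h "H s"] H(2)[of s h]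
    by (simp add: bilinear_rzero[OF m] bilinear_ladd[OF m] bilinear_lmul[OF m] n_def[symmetric] field_simps power2_eq_square)
  then show ?thesis unfolding egrad_riesz n_def[symmetric] by (intro riesz_unique[OF metric_inner_form]) simp
qed

end

section \<open>Parallel transport\<close>

lemma has_vector_derivative_within_Un:
  assumes "(f has_vector_derivative f') (at x within S)" "(f has_vector_derivative f') (at x within T)"
  shows "(f has_vector_derivative f') (at x within S \<union> T)"
  using assms unfolding has_vector_derivative_def has_derivative_within
  by (auto simp: at_within_union intro: filterlim_sup)

text \<open>No point of \<open>S\<close> lies near \<open>x\<close>, so the filter is trivial. When
  fields on adjacent intervals are glued, times outside one of the pieces are thereby
  covered.\<close>

lemma has_vector_derivative_within_closed_notin:
  assumes "closed S" "x \<notin> S"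
  shows "(f has_vector_derivative f') (at x within S)"
proof -
  have "at x within S = bot" using assms by (simp add: at_within_eq_bot_iff)
  then show ?thesis
    by (simp add: has_vector_derivative_def has_derivative_def bounded_linear_scaleR_left)
qed

section \<open>Parallel fields along a geodesic\<close>

context riemannian
begin

text \<open>The two-sided \<open>cvel\<close> replaces the velocity within the interval; along a
  geodesic the two agree on intervals of positive length. The interval then enters only through the
  filter, which suits cutting and gluing.\<close>

definition parallel_at :: "(real \<Rightarrow> 'a) \<Rightarrow> (real \<Rightarrow> 'e) \<Rightarrow> ('a, 'e) chart \<Rightarrow> real set \<Rightarrow> real \<Rightarrow> bool" where
  "parallel_at \<gamma> V c T t \<longleftrightarrow> ((\<lambda>\<tau>. to_chart M c (\<gamma> \<tau>) (V \<tau>)) has_vector_derivative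
    - christoffel M c (chart_map c (\<gamma> t)) (cvel c \<gamma> t) (to_chart M c (\<gamma> t) (V t))) (at t within T)"

lemma parallel_on_iff:
  assumes "geodesic M \<gamma>" "a < b"
  shows "parallel_on M {a..b} \<gamma> V \<longleftrightarrow> (\<forall>t\<in>{a..b}. \<forall>c\<in>charts M. \<gamma> t \<in> chart_dom c \<longrightarrow> parallel_at \<gamma> V c {a..b} t)"
proof -
  have "vector_derivative (chart_map c \<circ> \<gamma>) (at t within {a..b}) = cvel c \<gamma> t"
    if "t \<in> {a..b}" "c \<in> charts M" "\<gamma> t \<in> chart_dom c" for t c
    using vector_derivative_at_within_ivl[OF geodesic_cvel[OF assms(1) that(2,3)]] that(1) assms(2) by simp
  then show ?thesis by (simp add: parallel_on_def parallel_at_def)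
qed

lemma geodesic_eventually_dom:
  assumes "geodesic M \<gamma>" "c \<in> charts M" "\<gamma> t \<in> chart_dom c"
  shows "\<forall>\<^sub>F \<tau> in at t within T. \<gamma> \<tau> \<in> chart_dom c"
  using topological_tendstoD[OF tendsto_within_subset[OF geodesic_isCont[OF assms(1), unfolded isCont_def]] open_dom[OF assms(2)] assms(3)]
  by simp

lemma geodesic_coord_derivative:
  assumes "geodesic M \<gamma>" "c \<in> charts M" "\<gamma> t \<in> chart_dom c"
  shows "((\<lambda>\<tau>. chart_map c (\<gamma> \<tau>)) has_derivative (\<lambda>h. h *\<^sub>R cvel c \<gamma> t)) (at t within T)"
  using has_vector_derivative_at_within[OF geodesic_cvel[OF assms]] by (simp add: has_vector_derivative_def o_def)

text \<open>The product rule adds the derivative of the Jacobian along the curve, which is exactly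
  the inhomogeneous term of \<open>christoffel_tr\<close>.\<close>

lemma parallel_at_change_chart:
  assumes g: "geodesic M \<gamma>" and c: "c \<in> charts M" "\<gamma> t \<in> chart_dom c" and d: "d \<in> charts M" "\<gamma> t \<in> chart_dom d"
    and t: "t \<in> T" and par: "parallel_at \<gamma> V c T t"
  shows "parallel_at \<gamma> V d T t"
proof -
  define y where "y = chart_map c (\<gamma> t)"
  define p where "p = cvel c \<gamma> t"
  define v where "v = to_chart M c (\<gamma> t) (V t)"
  have y: "y \<in> ov c d" using c d by (auto simp: y_def)
  have yd: "(chart_map d \<circ> chart_inv c) y = chart_map d (\<gamma> t)" using chart_inv_map[OF c] by (simp add: y_def)
  have p': "cvel d \<gamma> t = tr c d y p"
    using vector_derivative_at[OF chart_curve_tr[OF c(1) d(1) c(2) d(2) UNIV_I geodesic_isCont[OF g] geodesic_cvel[OF g c]]]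
    by (simp add: y_def p_def)
  have v': "to_chart M d (\<gamma> t) (V t) = tr c d y v"
    using to_chart_tr[OF c(1) d(1) c(2) d(2)] by (simp add: y_def v_def)
  note lt = linear_tr[OF c(1) d(1) y]
  have dv: "((\<lambda>\<tau>. to_chart M c (\<gamma> \<tau>) (V \<tau>)) has_derivative (\<lambda>h. h *\<^sub>R - christoffel M c y p v)) (at t within T)"
    using par by (simp add: parallel_at_def has_vector_derivative_def y_def p_def v_def)
  have "((\<lambda>\<tau>. tr c d (chart_map c (\<gamma> \<tau>)) (to_chart M c (\<gamma> \<tau>) (V \<tau>))) has_derivative
      (\<lambda>h. fder (\<lambda>z. tr c d z (to_chart M c (\<gamma> t) (V t))) (chart_map c (\<gamma> t)) (h *\<^sub>R cvel c \<gamma> t)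
        + tr c d (chart_map c (\<gamma> t)) (h *\<^sub>R - christoffel M c y p v))) (at t within T)"
    (is "(_ has_derivative ?D) _")
    by (rule has_derivative_linear_family[where A="tr c d" and \<psi>="\<lambda>\<tau>. chart_map c (\<gamma> \<tau>)", OF open_ov[OF c(1) d(1)] _
          linear_tr[OF c(1) d(1)] Ck_on_tr[OF c(1) d(1), of "Suc 0"] geodesic_coord_derivative[OF g c] dv t])
      (use y in \<open>simp_all add: y_def\<close>)
  then have "((\<lambda>\<tau>. to_chart M d (\<gamma> \<tau>) (V \<tau>)) has_derivative ?D) (at t within T)"
  proof (rule has_derivative_transform_eventually)
    show "\<forall>\<^sub>F \<tau> in at t within T. tr c d (chart_map c (\<gamma> \<tau>)) (to_chart M c (\<gamma> \<tau>) (V \<tau>)) = to_chart M d (\<gamma> \<tau>) (V \<tau>)"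
      using geodesic_eventually_dom[OF g c] geodesic_eventually_dom[OF g d]
      by eventually_elim (simp add: to_chart_tr[OF c(1) d(1)])
  qed (use t to_chart_tr[OF c(1) d(1) c(2) d(2)] in auto)
  moreover have "?D h = h *\<^sub>R - christoffel M d (chart_map d (\<gamma> t)) (cvel d \<gamma> t) (to_chart M d (\<gamma> t) (V t))" for h
    unfolding p' v' christoffel_tr[OF c(1) d(1) y, of p v, unfolded yd] y_def[symmetric] p_def[symmetric] v_def[symmetric]
      linear_scale[OF Ck_on_linear_fder[OF Ck_on_tr[OF c(1) d(1), of "Suc 0" v] y], of h p]
    by (simp add: linear_scale[OF lt] linear_neg[OF lt] scaleR_diff_right)
  ultimately show ?thesis unfolding parallel_at_def has_vector_derivative_def by (rule has_derivative_eqI)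
qed

text \<open>In a chart parallelism is a linear equation, so \<open>linear_ode_exists\<close> solves
  it on the whole interval.\<close>

lemma parallel_exists_in_chart:
  assumes g: "geodesic M \<gamma>" and ab: "a \<le> b" and c: "c \<in> charts M" "\<And>t. t \<in> {a..b} \<Longrightarrow> \<gamma> t \<in> chart_dom c"
  shows "\<exists>V. V a = u \<and> (\<forall>t\<in>{a..b}. parallel_at \<gamma> V c {a..b} t)"
proof -
  define y where "y t = chart_map c (\<gamma> t)" for t
  have y: "y t \<in> cimg c" if "t \<in> {a..b}" for t using c(2)[OF that] by (simp add: y_def)
  have bil: "bilinear (christoffel M c (y t))" if "t \<in> {a..b}" for t using bilinear_christoffel[OF c(1) y[OF that]] .
  have ycont: "continuous_on {a..b} y"
    unfolding y_def[abs_def] continuous_on_eq_continuous_within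
    using has_derivative_continuous[OF geodesic_coord_derivative[OF g c(1) c(2)]] by blast
  have pcont: "continuous_on {a..b} (cvel c \<gamma>)"
    unfolding continuous_on_eq_continuous_within
    using has_vector_derivative_continuous[OF has_vector_derivative_at_within[OF geodesic_chart[OF g c(1) c(2)]]] by blast
  have \<Gamma>cont: "continuous_on {a..b} (\<lambda>t. christoffel M c (y t) v w)" for v w
    by (rule continuous_on_compose2[OF Ck_on_continuous[OF Ck_on_christoffel[OF c(1), of 0]] ycont]) (use y in auto)
  have "\<exists>z. z a = to_chart M c (\<gamma> a) u \<and>
      (\<forall>t\<in>{a..b}. (z has_vector_derivative - christoffel M c (y t) (cvel c \<gamma> t) (z t)) (at t within {a..b}))"
  proof (rule linear_ode_exists[OF ab])
    show "linear (\<lambda>v. - christoffel M c (y t) (cvel c \<gamma> t) v)" if "t \<in> {a..b}" for t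
      using bil[OF that] by (intro linear_compose_neg) (simp add: bilinear_def)
    have "continuous_on {a..b} (\<lambda>t. christoffel M c (y t) (cvel c \<gamma> t) v)" for v
      by (rule continuous_on_linear_family[where A="\<lambda>t p. christoffel M c (y t) p v", OF _ \<Gamma>cont pcont])
        (use bil in \<open>simp add: bilinear_def\<close>)
    then show "continuous_on {a..b} (\<lambda>t. - christoffel M c (y t) (cvel c \<gamma> t) v)" for v
      by (rule continuous_on_minus)
  qed
  then obtain z where z: "z a = to_chart M c (\<gamma> a) u"
    "\<And>t. t \<in> {a..b} \<Longrightarrow> (z has_vector_derivative - christoffel M c (y t) (cvel c \<gamma> t) (z t)) (at t within {a..b})" by blast
  define V where "V t = from_chart M c (\<gamma> t) (z t)" for t
  have Vz: "to_chart M c (\<gamma> t) (V t) = z t" if "t \<in> {a..b}" for t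
    using to_from_chart[OF c(1) c(2)[OF that]] by (simp add: V_def)
  have "parallel_at \<gamma> V c {a..b} t" if t: "t \<in> {a..b}" for t
    unfolding parallel_at_def Vz[OF t] y_def[symmetric]
    by (rule has_vector_derivative_transform[OF t _ z(2)[OF t]]) (rule Vz)
  moreover have "V a = u" using from_to_chart[OF c(1) c(2)[of a]] ab z(1) by (simp add: V_def)
  ultimately show ?thesis by blast
qed

lemma parallel_at_cong:
  assumes "parallel_at \<gamma> V c T t" "\<And>\<tau>. \<tau> \<in> T \<Longrightarrow> V \<tau> = W \<tau>" "t \<in> T"
  shows "parallel_at \<gamma> W c T t"
  using assms(1) unfolding parallel_at_def assms(2)[OF assms(3), symmetric]
  by (rule has_vector_derivative_transform[OF assms(3), rotated]) (simp add: assms(2))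

text \<open>The variable end point makes this a property for real induction; at \<open>t = 0\<close>
  the filter is trivial and every field qualifies.\<close>

definition parallel_upto :: "(real \<Rightarrow> 'a) \<Rightarrow> (real \<Rightarrow> 'e) \<Rightarrow> real \<Rightarrow> bool" where
  "parallel_upto \<gamma> V t \<longleftrightarrow> (\<forall>\<tau>\<in>{0..t}. \<forall>c\<in>charts M. \<gamma> \<tau> \<in> chart_dom c \<longrightarrow> parallel_at \<gamma> V c {0..t} \<tau>)"

lemma parallel_extend:
  assumes g: "geodesic M \<gamma>" and V: "parallel_upto \<gamma> V s" and st: "0 \<le> s" "s \<le> t"
    and c: "c \<in> charts M" "\<And>\<tau>. \<tau> \<in> {s..t} \<Longrightarrow> \<gamma> \<tau> \<in> chart_dom c"
  shows "\<exists>U. U 0 = V 0 \<and> parallel_upto \<gamma> U t"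
proof -
  obtain W where W: "W s = V s" "\<And>\<tau>. \<tau> \<in> {s..t} \<Longrightarrow> parallel_at \<gamma> W c {s..t} \<tau>"
    using parallel_exists_in_chart[OF g st(2) c, of "V s"] by blast
  \<comment> \<open>At the seam both one-sided derivatives have the value prescribed by the common
    vector \<open>V s = W s\<close>, so they combine to a derivative within the union.\<close>
  define U where "U \<tau> = (if \<tau> \<le> s then V \<tau> else W \<tau>)" for \<tau>
  have "parallel_at \<gamma> U d {0..t} \<tau>" if \<tau>: "\<tau> \<in> {0..t}" and d: "d \<in> charts M" "\<gamma> \<tau> \<in> chart_dom d" for \<tau> d
  proof -
    have "parallel_at \<gamma> U d {0..s} \<tau>"
    proof (cases "\<tau> \<in> {0..s}")
      case True
      then have "parallel_at \<gamma> V d {0..s} \<tau>" using V d by (simp add: parallel_upto_def)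
      then show ?thesis by (rule parallel_at_cong) (use True in \<open>auto simp: U_def\<close>)
    qed (auto simp: parallel_at_def intro!: has_vector_derivative_within_closed_notin)
    moreover have "parallel_at \<gamma> U d {s..t} \<tau>"
    proof (cases "\<tau> \<in> {s..t}")
      case True
      then have "parallel_at \<gamma> W d {s..t} \<tau>" using parallel_at_change_chart[OF g c(1) c(2) d True W(2)] by blast
      then show ?thesis by (rule parallel_at_cong) (use True W(1) in \<open>auto simp: U_def\<close>)
    qed (auto simp: parallel_at_def intro!: has_vector_derivative_within_closed_notin)
    moreover have "{0..t} = {0..s} \<union> {s..t}" using st by auto
    ultimately show ?thesis unfolding parallel_at_def using has_vector_derivative_within_Un by metis
  qed
  then show ?thesis using st by (intro exI[of _ U]) (auto simp: parallel_upto_def U_def)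
qed

text \<open>The induction claims only that some field exists up to each time. The limit step can
  therefore start from any earlier time whose remaining stretch lies in a chart around
  \<open>\<gamma> r\<close>.\<close>

lemma parallel_exists:
  assumes g: "geodesic M \<gamma>" and t: "0 \<le> t"
  shows "\<exists>V. V 0 = u \<and> parallel_upto \<gamma> V t"
proof (rule real_induct_Icc[where a=0 and b=t and t=t])
  have "(f has_vector_derivative f') (at 0 within {0..0})" for f :: "real \<Rightarrow> 'e" and f'
  proof -
    have "at (0::real) within {0} = bot" by (simp add: at_within_eq_bot_iff)
    then show ?thesis by (simp add: has_vector_derivative_def has_derivative_def bounded_linear_scaleR_left)
  qed
  then show "\<exists>V. V 0 = u \<and> parallel_upto \<gamma> V 0"
    by (intro exI[of _ "\<lambda>_. u"]) (auto simp: parallel_upto_def parallel_at_def)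
next
  fix r :: real assume r: "0 \<le> r" and P: "\<forall>s\<in>{0..r}. \<exists>V. V 0 = u \<and> parallel_upto \<gamma> V s"
  obtain d where d: "d > 0" "\<And>\<tau>. \<bar>\<tau> - r\<bar> < d \<Longrightarrow> \<gamma> \<tau> \<in> chart_dom (chart_at M (\<gamma> r))"
    using geodesic_near_dom[OF g chart_at] by blast
  obtain V where V: "V 0 = u" "parallel_upto \<gamma> V r" using P r by force
  have "\<exists>V. V 0 = u \<and> parallel_upto \<gamma> V s" if "r < s" "s \<le> r + d / 2" for s
    using parallel_extend[OF g V(2) r, of s, OF _ chart_at(1)] that d V(1) by force
  then show "\<exists>v>r. \<forall>s. r < s \<and> s \<le> v \<and> s \<le> t \<longrightarrow> (\<exists>V. V 0 = u \<and> parallel_upto \<gamma> V s)"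
    using d(1) by (intro exI[of _ "r + d / 2"]) auto
next
  fix r :: real assume r: "0 < r" and P: "\<forall>s\<in>{0..<r}. \<exists>V. V 0 = u \<and> parallel_upto \<gamma> V s"
  obtain d where d: "d > 0" "\<And>\<tau>. \<bar>\<tau> - r\<bar> < d \<Longrightarrow> \<gamma> \<tau> \<in> chart_dom (chart_at M (\<gamma> r))"
    using geodesic_near_dom[OF g chart_at] by blast
  define s where "s = max 0 (r - d / 2)"
  have s: "0 \<le> s" "s < r" "r - s < d" using d(1) r by (auto simp: s_def)
  obtain V where V: "V 0 = u" "parallel_upto \<gamma> V s" using P s by force
  show "\<exists>V. V 0 = u \<and> parallel_upto \<gamma> V r"
    using parallel_extend[OF g V(2) s(1), of r, OF _ chart_at(1)] s d V(1) by force
qed (use t in auto)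

lemma parallel_lincomb:
  assumes g: "geodesic M \<gamma>" and V: "parallel_upto \<gamma> V t" "parallel_upto \<gamma> W t"
  shows "parallel_upto \<gamma> (\<lambda>\<tau>. V \<tau> + k *\<^sub>R W \<tau>) t"
  unfolding parallel_upto_def
proof (intro ballI impI)
  fix \<tau> c assume c: "\<tau> \<in> {0..t}" "c \<in> charts M" "\<gamma> \<tau> \<in> chart_dom c"
  then have "chart_map c (\<gamma> \<tau>) \<in> cimg c" by blast
  note b = bilinear_christoffel[OF c(2) this]
  have eq: "to_chart M c (\<gamma> r) (V r + k *\<^sub>R W r) = to_chart M c (\<gamma> r) (V r) + k *\<^sub>R to_chart M c (\<gamma> r) (W r)"
    if "\<gamma> r \<in> chart_dom c" for r
    using linear_to_chart[OF c(2) that] by (simp add: linear_add linear_scale)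
  have "((\<lambda>\<tau>. to_chart M c (\<gamma> \<tau>) (V \<tau>) + k *\<^sub>R to_chart M c (\<gamma> \<tau>) (W \<tau>)) has_vector_derivative
      - christoffel M c (chart_map c (\<gamma> \<tau>)) (cvel c \<gamma> \<tau>) (to_chart M c (\<gamma> \<tau>) (V \<tau>))
      + k *\<^sub>R - christoffel M c (chart_map c (\<gamma> \<tau>)) (cvel c \<gamma> \<tau>) (to_chart M c (\<gamma> \<tau>) (W \<tau>))) (at \<tau> within {0..t})"
    (is "(_ has_vector_derivative ?D) _")
    using V c unfolding parallel_upto_def parallel_at_def
    by (intro has_vector_derivative_add bounded_linear.has_vector_derivative[OF bounded_linear_scaleR_right]) auto
  then have "((\<lambda>\<tau>. to_chart M c (\<gamma> \<tau>) (V \<tau> + k *\<^sub>R W \<tau>)) has_vector_derivative ?D) (at \<tau> within {0..t})"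
    unfolding has_vector_derivative_def
  proof (rule has_derivative_transform_eventually)
    show "\<forall>\<^sub>F r in at \<tau> within {0..t}. to_chart M c (\<gamma> r) (V r) + k *\<^sub>R to_chart M c (\<gamma> r) (W r) = to_chart M c (\<gamma> r) (V r + k *\<^sub>R W r)"
      using geodesic_eventually_dom[OF g c(2,3)] by eventually_elim (simp add: eq)
  qed (use c eq in auto)
  then show "parallel_at \<gamma> (\<lambda>\<tau>. V \<tau> + k *\<^sub>R W \<tau>) c {0..t} \<tau>"
    unfolding parallel_at_def eq[OF c(3)] by (simp add: bilinear_radd[OF b] bilinear_rmul[OF b])
qed

text \<open>The product rule and \<open>metric_compatible\<close> make the derivative vanish. Taken
  for one field this is the isometry of transport, for a difference of two fields their
  uniqueness.\<close>

lemma parallel_metric_constant: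
  assumes g: "geodesic M \<gamma>" and V: "parallel_upto \<gamma> V t" "parallel_upto \<gamma> W t" and t: "0 \<le> t"
  shows "metric M (\<gamma> t) (V t) (W t) = metric M (\<gamma> 0) (V 0) (W 0)"
proof -
  have "((\<lambda>\<tau>. metric M (\<gamma> \<tau>) (V \<tau>) (W \<tau>)) has_derivative (\<lambda>h. 0)) (at \<tau> within {0..t})" if \<tau>: "\<tau> \<in> {0..t}" for \<tau>
  proof -
    define c where "c = chart_at M (\<gamma> \<tau>)"
    have c: "c \<in> charts M" "\<gamma> \<tau> \<in> chart_dom c" unfolding c_def by (rule chart_at)+
    define y where "y = chart_map c (\<gamma> \<tau>)"
    define p where "p = cvel c \<gamma> \<tau>"
    define v where "v = to_chart M c (\<gamma> \<tau>) (V \<tau>)"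
    define w where "w = to_chart M c (\<gamma> \<tau>) (W \<tau>)"
    have y: "y \<in> cimg c" using c by (simp add: y_def)
    have dv: "((\<lambda>\<tau>. to_chart M c (\<gamma> \<tau>) (V \<tau>)) has_derivative (\<lambda>h. h *\<^sub>R - christoffel M c y p v)) (at \<tau> within {0..t})"
      and dw: "((\<lambda>\<tau>. to_chart M c (\<gamma> \<tau>) (W \<tau>)) has_derivative (\<lambda>h. h *\<^sub>R - christoffel M c y p w)) (at \<tau> within {0..t})"
      using V c \<tau> by (auto simp: parallel_upto_def parallel_at_def has_vector_derivative_def y_def p_def v_def w_def)
    have "((\<lambda>\<tau>. metric_coord M c (chart_map c (\<gamma> \<tau>)) (to_chart M c (\<gamma> \<tau>) (V \<tau>)) (to_chart M c (\<gamma> \<tau>) (W \<tau>))) has_derivative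
        (\<lambda>h. dmet c (chart_map c (\<gamma> \<tau>)) (h *\<^sub>R cvel c \<gamma> \<tau>) (to_chart M c (\<gamma> \<tau>) (V \<tau>)) (to_chart M c (\<gamma> \<tau>) (W \<tau>))
          + metric_coord M c (chart_map c (\<gamma> \<tau>)) (h *\<^sub>R - christoffel M c y p v) (to_chart M c (\<gamma> \<tau>) (W \<tau>))
          + metric_coord M c (chart_map c (\<gamma> \<tau>)) (to_chart M c (\<gamma> \<tau>) (V \<tau>)) (h *\<^sub>R - christoffel M c y p w))) (at \<tau> within {0..t})"
      (is "(_ has_derivative ?D) _")
      by (rule has_derivative_bilinear_family[where g="metric_coord M c" and \<psi>="\<lambda>\<tau>. chart_map c (\<gamma> \<tau>)", OF open_cimg[OF c(1)] _
            bilinear_metric_coord[OF c(1)] Ck_on_metric_coord[OF c(1), of "Suc 0"] geodesic_coord_derivative[OF g c] dv dw \<tau>])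
        (use y in \<open>simp_all add: y_def\<close>)
    then have "((\<lambda>\<tau>. metric M (\<gamma> \<tau>) (V \<tau>) (W \<tau>)) has_derivative ?D) (at \<tau> within {0..t})"
    proof (rule has_derivative_transform_eventually)
      show "\<forall>\<^sub>F r in at \<tau> within {0..t}. metric_coord M c (chart_map c (\<gamma> r)) (to_chart M c (\<gamma> r) (V r)) (to_chart M c (\<gamma> r) (W r))
          = metric M (\<gamma> r) (V r) (W r)"
        using geodesic_eventually_dom[OF g c] by eventually_elim (simp add: metric_eq_coord[OF c(1)])
    qed (use \<tau> metric_eq_coord[OF c] in auto)
    then show ?thesis
    proof (rule has_derivative_eqI)
      note b = bilinear_metric_coord[OF c(1) y]
      show "?D h = 0" for h
        unfolding y_def[symmetric] p_def[symmetric] v_def[symmetric] w_def[symmetric]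
          linear_scale[OF linear_dmet[OF c(1) y]] metric_compatible[OF c(1) y]
        by (simp only: bilinear_lmul[OF bilinear_christoffel[OF c(1) y]] bilinear_lmul[OF b] bilinear_rmul[OF b] bilinear_lneg[OF b] bilinear_rneg[OF b])
          (simp add: algebra_simps)
    qed
  qed
  then obtain k where "\<And>\<tau>. \<tau> \<in> {0..t} \<Longrightarrow> metric M (\<gamma> \<tau>) (V \<tau>) (W \<tau>) = k"
    using has_derivative_zero_constant[of "{0..t}" "\<lambda>\<tau>. metric M (\<gamma> \<tau>) (V \<tau>) (W \<tau>)"] by auto
  then show ?thesis using t by simp
qed

end

section \<open>Transport as a linear isometry\<close>

context complete_riemannian
begin

text \<open>Two parallel fields with the same start differ by a parallel field that starts at 0 and
  has constant norm, so the definite description in \<open>transport\<close> has one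
  candidate.\<close>

lemma transport_eq:
  assumes V: "parallel_upto (geo x s) V 1"
  shows "transport M x s (V 0) = V 1"
proof -
  have "parallel_on M {0..1} (\<lambda>t. Exp M x (t *\<^sub>R s)) W \<longleftrightarrow> parallel_upto (geo x s) W 1" for W
    using parallel_on_iff[OF geo(1)[of x s], of 0 1 W] by (simp add: Exp_scaleR parallel_upto_def)
  then have tr: "transport M x s u = (THE w. \<exists>W. parallel_upto (geo x s) W 1 \<and> W 0 = u \<and> W 1 = w)" for u
    by (simp add: transport_def)
  show ?thesis unfolding tr
  proof (rule the_equality)
    fix w assume "\<exists>W. parallel_upto (geo x s) W 1 \<and> W 0 = V 0 \<and> W 1 = w"
    then obtain W where W: "parallel_upto (geo x s) W 1" "W 0 = V 0" "W 1 = w" by blast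
    define D where "D \<tau> = V \<tau> + (- 1) *\<^sub>R W \<tau>" for \<tau>
    have "parallel_upto (geo x s) D 1"
      unfolding D_def by (rule parallel_lincomb[OF geo(1) V W(1)])
    from parallel_metric_constant[OF geo(1) this this]
    have "metric M (geo x s 1) (D 1) (D 1) = metric M (geo x s 0) 0 0" using W by (simp add: D_def)
    also have "\<dots> = 0" using inner_formD(3)[OF metric_inner_form] bilinear_lzero by blast
    finally have "D 1 = 0" using inner_formD(5)[OF metric_inner_form] by (metis less_irrefl)
    then show "w = V 1" using W by (simp add: D_def)
  qed (use V in blast)
qed

text \<open>\<open>inv\<close> is a right inverse only of a surjective map. Isometry makes the
  transport injective, and an injective linear map of \<open>'e\<close> to itself is onto.\<close>

lemma tnorm_inv_transport: "tnorm M x (inv (transport M x s) w) = tnorm M (Exp M x s) w"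
proof -
  define P where "P = transport M x s"
  have ex: "\<exists>V. parallel_upto (geo x s) V 1 \<and> V 0 = u \<and> V 1 = P u" for u
    using parallel_exists[OF geo(1)[of x s], of 1 u] transport_eq by (force simp: P_def)
  have iso: "metric M (Exp M x s) (P u) (P u) = metric M x u u" for u
    using ex[of u] parallel_metric_constant[OF geo(1)[of x s]] by (metis Exp_eq_geo geo(2) zero_le_one)
  have comb: "P (u + k *\<^sub>R v) = P u + k *\<^sub>R P v" for u v k
  proof -
    obtain V W where V: "parallel_upto (geo x s) V 1" "V 0 = u" "V 1 = P u"
      and W: "parallel_upto (geo x s) W 1" "W 0 = v" "W 1 = P v" using ex by metis
    show ?thesis using transport_eq[OF parallel_lincomb[OF geo(1) V(1) W(1)]] V W by (simp add: P_def)
  qed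
  have lin: "linear P"
    using comb[of _ 1] comb[of 0] comb[of 0 1 0] by (intro linearI) auto
  have "inj P"
  proof (rule linear_injective_0[OF lin, THEN iffD2], intro allI impI)
    fix u assume "P u = 0"
    then have "metric M x u u = 0" using iso[of u] inner_formD(3)[OF metric_inner_form] bilinear_lzero by metis
    then show "u = 0" using inner_formD(5)[OF metric_inner_form] by (metis less_irrefl)
  qed
  then have "surj P" using lin linear_injective_imp_surjective by blast
  then have "P (inv P w) = w" by (rule surj_f_inv_f)
  then show ?thesis using iso[of "inv P w"] unfolding P_def[symmetric] tnorm_def by simp
qed

end

section \<open>Convergence of the algorithm\<close>

lemma real_powr_three_halves:
  fixes r :: real
  assumes "r \<ge> 0"
  shows "(r\<^sup>2) powr 1.5 = r ^ 3"
proof (cases "r = 0")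
  case False
  then have r: "r > 0" using assms by simp
  have "(r\<^sup>2) powr 1.5 = (r powr 2) powr 1.5" using r by simp
  also have "\<dots> = r powr 3" by (simp add: powr_powr)
  finally show ?thesis using r by simp
qed simp

lemma descent_sum_bound:
  fixes \<phi> :: "nat \<Rightarrow> real"
  assumes desc: "\<And>k. k < N \<Longrightarrow> \<phi> (Suc k) \<le> \<phi> k - (if S k then d k else 0)"
  shows "(\<Sum>k\<in>{k. k < N \<and> S k}. d k) \<le> \<phi> 0 - \<phi> N"
  using desc
proof (induction N)
  case (Suc N)
  have "{k. k < Suc N \<and> S k} = (if S N then insert N {k. k < N \<and> S k} else {k. k < N \<and> S k})"
    by (auto simp: less_Suc_eq)
  then have "(\<Sum>k\<in>{k. k < Suc N \<and> S k}. d k) = (if S N then d N else 0) + (\<Sum>k\<in>{k. k < N \<and> S k}. d k)"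
    by simp
  then show ?case using Suc.IH Suc.prems[of N] Suc.prems by force
qed simp

text \<open>A counted index has \<open>(n k)\<^sup>2 \<ge> \<epsilon> / C\<close>, so it lowers
  \<open>\<phi>\<close> by at least \<open>a * (\<epsilon> / C) powr 1.5\<close>, while the total
  decrease is at most \<open>\<phi> 0 - l\<close>. Here \<open>R\<close> stands for
  \<open>reached s\<close> and \<open>S\<close> for success.\<close>

lemma successful_count_bound:
  fixes \<phi> n G :: "nat \<Rightarrow> real"
  assumes a: "a > 0" and low: "\<And>k. \<phi> k \<ge> l"
    and desc: "\<And>k. R (Suc k) \<Longrightarrow> \<phi> (Suc k) \<le> \<phi> k - (if S k then a * n k ^ 3 else 0)"
    and S: "\<And>k. S k \<Longrightarrow> R (Suc k)" and R: "\<And>j k. R k \<Longrightarrow> j \<le> k \<Longrightarrow> R j"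
    and n: "\<And>k. n k \<ge> 0" and G: "\<And>k. S k \<Longrightarrow> G k \<le> C * (n k)\<^sup>2" and \<epsilon>: "\<epsilon> > 0"
  shows "finite {k. S k \<and> G k > \<epsilon>} \<and> real (card {k. S k \<and> G k > \<epsilon>}) \<le> (\<phi> 0 - l) / a * C powr 1.5 * (1 / \<epsilon> powr 1.5)"
proof -
  define b where "b = (\<phi> 0 - l) / a * C powr 1.5 * (1 / \<epsilon> powr 1.5)"
  have b0: "b \<ge> 0" using a low[of 0] by (simp add: b_def)
  have bound: "real (card F) \<le> b" if F: "F \<subseteq> {k. S k \<and> G k > \<epsilon>}" "finite F" for F
  proof (cases "F = {}")
    case False
    \<comment> \<open>One past the last counted index: success at \<open>Max F\<close> ensures
      \<open>R N\<close>, so the descent estimate holds for all indices below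
      \<open>N\<close>.\<close>
    define N where "N = Suc (Max F)"
    have "Max F \<in> F" using False F(2) by simp
    then have RN: "R N" using F(1) S by (auto simp: N_def)
    have FN: "F \<subseteq> {k. k < N \<and> S k}" using F by (auto simp: N_def less_Suc_eq_le)
    \<comment> \<open>The sign of \<open>C\<close> is forced by the existence of a counted
      index.\<close>
    have C: "C > 0"
    proof -
      have "\<epsilon> < C * (n (Max F))\<^sup>2" using \<open>Max F \<in> F\<close> F(1) G[of "Max F"] by force
      then show ?thesis using \<epsilon> by (metis less_trans zero_le_power2 zero_less_mult_iff not_le)
    qed
    have each: "a * (\<epsilon> powr 1.5 / C powr 1.5) \<le> a * n k ^ 3" if "k \<in> F" for k
    proof -
      have "\<epsilon> / C \<le> (n k)\<^sup>2" using that F(1) G[of k] C by (force simp: field_simps)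
      then have "(\<epsilon> / C) powr 1.5 \<le> ((n k)\<^sup>2) powr 1.5" using \<epsilon> C by (intro powr_mono2) auto
      then have "\<epsilon> powr 1.5 / C powr 1.5 \<le> n k ^ 3"
        using real_powr_three_halves[OF n] \<epsilon> C by (simp add: powr_divide)
      then show ?thesis using a by (intro mult_left_mono) auto
    qed
    have "real (card F) * (a * (\<epsilon> powr 1.5 / C powr 1.5)) \<le> (\<Sum>k\<in>F. a * n k ^ 3)"
      using sum_bounded_below[of F "a * (\<epsilon> powr 1.5 / C powr 1.5)" "\<lambda>k. a * n k ^ 3"] each by simp
    also have "\<dots> \<le> (\<Sum>k\<in>{k. k < N \<and> S k}. a * n k ^ 3)"
      using FN a n by (intro sum_mono2) auto
    also have "\<dots> \<le> \<phi> 0 - \<phi> N"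
      by (rule descent_sum_bound) (use desc R[OF RN] in auto)
    also have "\<dots> \<le> \<phi> 0 - l" using low by simp
    finally have "real (card F) * (a * (\<epsilon> powr 1.5 / C powr 1.5)) \<le> \<phi> 0 - l" .
    moreover have "a * (\<epsilon> powr 1.5 / C powr 1.5) > 0" using a \<epsilon> C by simp
    ultimately have "real (card F) \<le> (\<phi> 0 - l) / (a * (\<epsilon> powr 1.5 / C powr 1.5))"
      by (rule pos_le_divide_eq[THEN iffD2, rotated])
    then show ?thesis using a by (simp add: b_def)
  qed (use b0 in simp)
  \<comment> \<open>A common bound for the sizes of finite subsets shows that the set itself is
    finite.\<close>
  have "card F \<le> nat \<lfloor>b\<rfloor>" if "F \<subseteq> {k. S k \<and> G k > \<epsilon>}" "finite F" for F
    using bound[OF that] by (simp add: le_nat_floor)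
  then have "finite {k. S k \<and> G k > \<epsilon>}" using finite_if_finite_subsets_card_bdd by blast
  then show ?thesis using bound[of "{k. S k \<and> G k > \<epsilon>}"] by (simp add: b_def)
qed

text \<open>Otherwise \<open>\<sigma>\<close> would dominate a geometric sequence from index
  \<open>K\<close> on and exceed \<open>B\<close>.\<close>

lemma not_eventually_growing:
  fixes \<sigma> :: "nat \<Rightarrow> real"
  assumes "\<gamma> > 1" "\<And>k. \<sigma> k \<ge> m" "m > 0" "\<And>k. \<sigma> k \<le> B"
  shows "\<exists>k\<ge>K. \<sigma> (Suc k) < \<gamma> * \<sigma> k"
proof (rule ccontr)
  assume "\<not> ?thesis"
  then have grow: "\<gamma> * \<sigma> k \<le> \<sigma> (Suc k)" if "k \<ge> K" for k using that by (metis not_less)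
  have "m * \<gamma> ^ j \<le> \<sigma> (K + j)" for j
  proof (induction j)
    case (Suc j)
    have "m * \<gamma> ^ Suc j \<le> \<gamma> * \<sigma> (K + j)" using Suc assms(1) by (simp add: ac_simps mult_left_mono)
    then show ?case using grow[of "K + j"] by simp
  qed (use assms in simp)
  then have "\<gamma> ^ j \<le> B / m" for j
    using assms(3,4) by (metis order_trans mult.commute pos_le_divide_eq)
  then show False using real_arch_pow[OF assms(1), of "B / m"] by (metis not_le)
qed

lemma reached_Suc: "reached s (Suc k) \<longleftrightarrow> reached s k \<and> s k \<noteq> 0"
  by (auto simp: reached_def less_Suc_eq)

lemma reached_mono: "reached s k \<Longrightarrow> j \<le> k \<Longrightarrow> reached s j"
  by (simp add: reached_def)

theorem theorem3:
  fixes M :: "('a::{t2_space, second_countable_topology}, 'e::euclidean_space) riem"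
    and f :: "'a \<Rightarrow> real"
    and x :: "nat \<Rightarrow> 'a" and s :: "nat \<Rightarrow> 'e" and \<sigma> :: "nat \<Rightarrow> real"
    and \<theta> \<sigma>min \<eta>1 \<eta>2 \<gamma>1 \<gamma>2 \<gamma>3 flow L L' \<sigma>max :: real
  assumes "riemannian_manifold M" and "complete_manifold M"
    and "C2_function M f"
    and "\<theta> > 0" and "\<sigma>min > 0" and "0 < \<eta>1" and "\<eta>1 \<le> \<eta>2" and "\<eta>2 < 1"
    and "0 < \<gamma>1" and "\<gamma>1 < 1" and "1 < \<gamma>2" and "\<gamma>2 < \<gamma>3"
    and run: "arc_run M (Exp M) f \<theta> \<sigma>min \<eta>1 \<eta>2 \<gamma>1 \<gamma>2 \<gamma>3 x s \<sigma>"
    and A1: "\<And>p. f p \<ge> flow"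
    and A2: "\<And>k. reached s k \<Longrightarrow>
      (f \<circ> Exp M (x k)) (s k) - taylor2 M (x k) (f \<circ> Exp M (x k)) (s k)
        \<le> L / 6 * tnorm M (x k) (s k) ^ 3"
    and A3: "\<And>k. arc_successful M (Exp M) f \<eta>1 x s \<sigma> k \<Longrightarrow>
      tnorm M (x k)
        (inv (transport M (x k) (s k)) (grad M f (Exp M (x k) (s k)))
          - grad M f (x k) - Hess M f (x k) (s k))
        \<le> L' / 2 * (tnorm M (x k) (s k))\<^sup>2"
    and \<sigma>max: "\<sigma>max = max (\<sigma> 0) (L * \<gamma>3 / (2 * (1 - \<eta>2)))"
  shows "(\<forall>\<epsilon>>0.
      finite {k. arc_successful M (Exp M) f \<eta>1 x s \<sigma> k \<and> tnorm M (x (Suc k)) (grad M f (x (Suc k))) > \<epsilon>} \<and>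
      real (card {k. arc_successful M (Exp M) f \<eta>1 x s \<sigma> k \<and> tnorm M (x (Suc k)) (grad M f (x (Suc k))) > \<epsilon>})
        \<le> 3 * (f (x 0) - flow) / (\<eta>1 * \<sigma>min) * (L' / 2 + \<theta> + \<sigma>max) powr 1.5 * (1 / \<epsilon> powr 1.5)) \<and>
    ((\<forall>k. s k \<noteq> 0) \<longrightarrow> (\<lambda>k. tnorm M (x k) (grad M f (x k))) \<longlonglongrightarrow> 0)"
proof -
  interpret complete_riemannian M by unfold_locales fact+
  note f = \<open>C2_function M f\<close>
  define succ where "succ k \<longleftrightarrow> arc_successful M (Exp M) f \<eta>1 x s \<sigma> k" for k
  define n where "n k = tnorm M (x k) (s k)" for k
  define G where "G k = tnorm M (x k) (grad M f (x k))" for k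
  define T where "T k = taylor2 M (x k) (f \<circ> Exp M (x k)) (s k)" for k
  define x' where "x' k = Exp M (x k) (s k)" for k
  define \<rho> where "\<rho> k = arc_ratio M (Exp M) f (x k) (\<sigma> k) (s k)" for k
  \<comment> \<open>The cubic term added in the ratio undoes the one in the model, so the
    denominator is the decrease of the Taylor polynomial.\<close>
  define den where "den k = f (x k) - T k" for k
  have n0: "n k \<ge> 0" for k by (simp add: n_def tnorm_nonneg)
  have npos: "n k > 0" if "s k \<noteq> 0" for k using tnorm_pos[OF that] by (simp add: n_def)
  have ms: "arc_model M (Exp M) f (x k) (\<sigma> k) (s k) = T k + \<sigma> k / 3 * n k ^ 3" for k
    by (simp add: arc_model_def T_def n_def)
  have m0: "arc_model M (Exp M) f (x k) (\<sigma> k) 0 = f (x k)" for k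
    using bilinear_lzero[OF inner_formD(3)[OF metric_inner_form[of "x k"]]]
    by (simp add: arc_model_def taylor2_def Exp_0 tnorm_def)
  have \<rho>: "\<rho> k = (f (x k) - f (x' k)) / den k" for k
    by (simp add: \<rho>_def arc_ratio_def ms m0 den_def x'_def n_def)
  have step: "T k + \<sigma> k / 3 * n k ^ 3 \<le> f (x k)"
    "tnorm M (x k) (egrad M (x k) (arc_model M (Exp M) f (x k) (\<sigma> k)) (s k)) \<le> \<theta> * (n k)\<^sup>2"
    "s k \<noteq> 0 \<Longrightarrow> x (Suc k) = (if \<rho> k \<ge> \<eta>1 then x' k else x k)"
    "s k \<noteq> 0 \<Longrightarrow> \<rho> k \<ge> \<eta>2 \<Longrightarrow> \<sigma>min \<le> \<sigma> (Suc k) \<and> \<sigma> (Suc k) \<le> \<sigma> k"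
    "s k \<noteq> 0 \<Longrightarrow> \<eta>1 \<le> \<rho> k \<Longrightarrow> \<rho> k < \<eta>2 \<Longrightarrow> \<sigma> k \<le> \<sigma> (Suc k) \<and> \<sigma> (Suc k) \<le> \<gamma>2 * \<sigma> k"
    "s k \<noteq> 0 \<Longrightarrow> \<rho> k < \<eta>1 \<Longrightarrow> \<gamma>2 * \<sigma> k \<le> \<sigma> (Suc k) \<and> \<sigma> (Suc k) \<le> \<gamma>3 * \<sigma> k" if "reached s k" for k
  proof -
    have *: "arc_model M (Exp M) f (x k) (\<sigma> k) (s k) \<le> arc_model M (Exp M) f (x k) (\<sigma> k) 0"
      using run that unfolding arc_run_def Let_def by blast
    show "T k + \<sigma> k / 3 * n k ^ 3 \<le> f (x k)" using * unfolding ms m0 .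
  qed (use run that in \<open>auto simp: arc_run_def Let_def n_def x'_def \<rho>_def\<close>)
  have \<sigma>min: "\<sigma> k \<ge> \<sigma>min" if "reached s k" for k
    using that
  proof (induction k)
    case 0
    then show ?case using run by (simp add: arc_run_def)
  next
    case (Suc k)
    then have k: "reached s k" "s k \<noteq> 0" "\<sigma> k \<ge> \<sigma>min" by (auto simp: reached_Suc)
    \<comment> \<open>An unsuccessful iteration does not lower the weight, because \<gamma>2 > 1;
      the rule for \<rho> \<ge> \<eta>2 has the floor \<sigma>min built in.\<close>
    have "\<sigma> k \<le> \<gamma>2 * \<sigma> k" using k(3) \<open>\<sigma>min > 0\<close> \<open>1 < \<gamma>2\<close> by simp
    then show ?case using step(4-6)[OF k(1,2)] k(3) by (meson not_less order_trans)
  qed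
  have den: "\<sigma> k / 3 * n k ^ 3 \<le> den k" if "reached s k" for k
    using step(1)[OF that] by (simp add: den_def)
  have denpos: "den k > 0" if "reached s k" "s k \<noteq> 0" for k
  proof -
    have "0 < \<sigma> k / 3 * n k ^ 3" using \<sigma>min[OF that(1)] \<open>\<sigma>min > 0\<close> npos[OF that(2)] by simp
    then show ?thesis using den[OF that(1)] by simp
  qed
  have \<sigma>le: "\<sigma> k \<le> \<sigma>max" if "reached s k" for k
    using that
  proof (induction k)
    case 0
    then show ?case by (simp add: \<sigma>max)
  next
    case (Suc k)
    then have k: "reached s k" "s k \<noteq> 0" "\<sigma> k \<le> \<sigma>max" by (auto simp: reached_Suc)
    show ?case
    proof (cases "\<rho> k \<ge> \<eta>2")
      case True
      then show ?thesis using step(4)[OF k(1,2)] k(3) by simp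
    next
      case False
      have \<sigma>0: "\<sigma> k > 0" using \<sigma>min[OF k(1)] \<open>\<sigma>min > 0\<close> by simp
      \<comment> \<open>The actual decrease falls short of \<eta>2 times the predicted one, so
        \<open>(1 - \<eta>2) * den k\<close> is at most the Taylor error
        \<open>L / 6 * n k ^ 3\<close>, whereas \<open>den k\<close> is at least
        \<open>\<sigma> k / 3 * n k ^ 3\<close>. This caps \<open>\<sigma> k\<close> by
        \<open>L / (2 * (1 - \<eta>2))\<close>, and one update multiplies it by at most
        \<gamma>3.\<close>
      have "f (x k) - f (x' k) < \<eta>2 * den k"
        using False denpos[OF k(1,2)] by (simp add: \<rho> field_simps)
      moreover have "f (x' k) - T k \<le> L / 6 * n k ^ 3" using A2[OF k(1)] by (simp add: T_def n_def x'_def)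
      ultimately have "(1 - \<eta>2) * den k \<le> L / 6 * n k ^ 3" by (simp add: den_def algebra_simps)
      moreover have "(1 - \<eta>2) * (\<sigma> k / 3 * n k ^ 3) \<le> (1 - \<eta>2) * den k"
        using den[OF k(1)] \<open>\<eta>2 < 1\<close> by (intro mult_left_mono) auto
      moreover have "((1 - \<eta>2) * \<sigma> k / 3) * n k ^ 3 = (1 - \<eta>2) * (\<sigma> k / 3 * n k ^ 3)" by simp
      ultimately have "((1 - \<eta>2) * \<sigma> k / 3) * n k ^ 3 \<le> L / 6 * n k ^ 3" by linarith
      then have "(1 - \<eta>2) * \<sigma> k / 3 \<le> L / 6" using npos[OF k(2)] by simp
      then have "\<sigma> k \<le> L / (2 * (1 - \<eta>2))" using \<open>\<eta>2 < 1\<close> by (simp add: field_simps)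
      then have "\<gamma>3 * \<sigma> k \<le> \<gamma>3 * (L / (2 * (1 - \<eta>2)))" using \<open>1 < \<gamma>2\<close> \<open>\<gamma>2 < \<gamma>3\<close> by (intro mult_left_mono) auto
      also have "\<dots> \<le> \<sigma>max" unfolding \<sigma>max by (simp add: mult.commute)
      finally have "\<gamma>3 * \<sigma> k \<le> \<sigma>max" .
      moreover have "\<gamma>2 * \<sigma> k \<le> \<gamma>3 * \<sigma> k" using \<sigma>0 \<open>\<gamma>2 < \<gamma>3\<close> by simp
      ultimately show ?thesis using step(5,6)[OF k(1,2)] False by force
    qed
  qed
  \<comment> \<open>The decrease guaranteed by a successful iteration per cubed step length; its
    inverse is the factor 3 / (\<eta>1 \<sigma>min) of the bound.\<close>
  define a where "a = \<eta>1 * \<sigma>min / 3"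
  have a: "a > 0" using \<open>0 < \<eta>1\<close> \<open>\<sigma>min > 0\<close> by (simp add: a_def)
  have succ_iff: "succ k \<longleftrightarrow> reached s k \<and> s k \<noteq> 0 \<and> \<rho> k \<ge> \<eta>1" for k
    by (simp add: succ_def arc_successful_def \<rho>_def)
  have succ_x: "x (Suc k) = x' k" if "succ k" for k using step(3) that by (simp add: succ_iff)
  have desc: "f (x (Suc k)) \<le> f (x k) - (if succ k then a * n k ^ 3 else 0)" if "reached s (Suc k)" for k
  proof (cases "succ k")
    case True
    then have k: "reached s k" "s k \<noteq> 0" "\<rho> k \<ge> \<eta>1" by (auto simp: succ_iff)
    have "\<eta>1 * den k \<le> f (x k) - f (x' k)" using k(3) denpos[OF k(1,2)] by (simp add: \<rho> pos_le_divide_eq)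
    moreover have "\<eta>1 * (\<sigma>min / 3 * n k ^ 3) \<le> \<eta>1 * den k"
    proof -
      have "\<sigma>min / 3 * n k ^ 3 \<le> \<sigma> k / 3 * n k ^ 3" using \<sigma>min[OF k(1)] n0 by (intro mult_right_mono) auto
      then show ?thesis using den[OF k(1)] \<open>0 < \<eta>1\<close> by (intro mult_left_mono) auto
    qed
    ultimately show ?thesis using True by (simp add: succ_x a_def)
  next
    case False
    then show ?thesis using that step(3)[of k] by (simp add: succ_iff reached_Suc)
  qed
  define C where "C = L' / 2 + \<theta> + \<sigma>max"
  have Gbound: "G (Suc k) \<le> C * (n k)\<^sup>2" if "succ k" for k
  proof -
    have k: "reached s k" "s k \<noteq> 0" using that by (auto simp: succ_iff)
    define p where "p = inv (transport M (x k) (s k)) (grad M f (x' k))"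
    define gk where "gk = grad M f (x k)"
    define Hs where "Hs = Hess M f (x k) (s k)"
    \<comment> \<open>\<open>pullback_gradient_hessian\<close> rewrites the model with
      \<open>grad\<close> and \<open>Hess\<close>, so that the condition on the step and A3 concern
      the same vectors.\<close>
    have model: "arc_model M (Exp M) f (x k) (\<sigma> k) = (\<lambda>v. (f \<circ> Exp M (x k)) 0 + metric M (x k) v gk
        + 1 / 2 * metric M (x k) v (Hess M f (x k) v) + \<sigma> k / 3 * tnorm M (x k) v ^ 3)"
      by (rule ext) (simp add: arc_model_def taylor2_def pullback_gradient_hessian[OF f] gk_def)
    have "egrad M (x k) (arc_model M (Exp M) f (x k) (\<sigma> k)) (s k) = gk + Hs + (\<sigma> k * n k) *\<^sub>R s k"
      unfolding model Hs_def n_def by (rule egrad_cubic_model[OF linear_Hess[OF f] metric_Hess_sym[OF f] k(2)])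
    then have 1: "tnorm M (x k) (gk + Hs + (\<sigma> k * n k) *\<^sub>R s k) \<le> \<theta> * (n k)\<^sup>2" using step(2)[OF k(1)] by simp
    have 2: "tnorm M (x k) (p - gk - Hs) \<le> L' / 2 * (n k)\<^sup>2"
      using A3[of k] that by (simp add: succ_def p_def gk_def Hs_def n_def x'_def)
    have "\<sigma> k \<ge> 0" using \<sigma>min[OF k(1)] \<open>\<sigma>min > 0\<close> by simp
    then have 3: "tnorm M (x k) ((- (\<sigma> k * n k)) *\<^sub>R s k) = \<sigma> k * (n k)\<^sup>2"
      using n0[of k] unfolding tnorm_scaleR n_def[symmetric] by (simp add: power2_eq_square abs_mult)
    have "G (Suc k) = tnorm M (x k) p"
      using that by (simp add: G_def succ_x p_def tnorm_inv_transport x'_def)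
    \<comment> \<open>Three contributions: the Taylor defect bounded by A3, the model gradient
      bounded by the step condition, and the regularization term bounded through \<sigma>max. They
      give the three summands of \<open>C\<close>.\<close>
    also have "p = (p - gk - Hs) + ((gk + Hs + (\<sigma> k * n k) *\<^sub>R s k) + (- (\<sigma> k * n k)) *\<^sub>R s k)" by simp
    also have "tnorm M (x k) \<dots> \<le> tnorm M (x k) (p - gk - Hs)
        + (tnorm M (x k) (gk + Hs + (\<sigma> k * n k) *\<^sub>R s k) + tnorm M (x k) ((- (\<sigma> k * n k)) *\<^sub>R s k))"
      by (intro order_trans[OF tnorm_triangle] add_left_mono tnorm_triangle)
    also have "\<dots> \<le> L' / 2 * (n k)\<^sup>2 + (\<theta> * (n k)\<^sup>2 + \<sigma>max * (n k)\<^sup>2)"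
    proof -
      have "\<sigma> k * (n k)\<^sup>2 \<le> \<sigma>max * (n k)\<^sup>2" using \<sigma>le[OF k(1)] by (intro mult_right_mono) auto
      then show ?thesis using 1 2 unfolding 3 by (intro add_mono) auto
    qed
    finally show ?thesis by (simp add: C_def algebra_simps)
  qed
  have count: "finite {k. succ k \<and> G (Suc k) > \<epsilon>} \<and>
      real (card {k. succ k \<and> G (Suc k) > \<epsilon>}) \<le> (f (x 0) - flow) / a * C powr 1.5 * (1 / \<epsilon> powr 1.5)" if "\<epsilon> > 0" for \<epsilon>
    by (rule successful_count_bound[where R="reached s" and \<phi>="\<lambda>k. f (x k)" and n=n])
      (use a A1 desc reached_mono n0 Gbound that in \<open>auto simp: succ_iff reached_Suc\<close>)
  have lim: "G \<longlonglongrightarrow> 0" if ns: "\<forall>k. s k \<noteq> 0"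
  proof (rule LIMSEQ_I)
    fix \<epsilon> :: real assume \<epsilon>: "\<epsilon> > 0"
    have r: "reached s k" for k using ns by (simp add: reached_def)
    have "finite {k. succ k \<and> G (Suc k) > \<epsilon> / 2}" using count[of "\<epsilon> / 2"] \<epsilon> by simp
    then obtain K where K: "\<And>k. succ k \<Longrightarrow> G (Suc k) > \<epsilon> / 2 \<Longrightarrow> k < K"
      using finite_nat_set_iff_bounded[of "{k. succ k \<and> G (Suc k) > \<epsilon> / 2}"] by auto
    \<comment> \<open>An unsuccessful iteration multiplies the weight by at least \<gamma>2, so
      \<open>k0\<close> is a success at or after \<open>K\<close>.\<close>
    obtain k0 where k0: "k0 \<ge> K" "\<sigma> (Suc k0) < \<gamma>2 * \<sigma> k0"
      using not_eventually_growing[where \<gamma>=\<gamma>2 and \<sigma>=\<sigma> and m=\<sigma>min and B=\<sigma>max and K=K] \<open>1 < \<gamma>2\<close> \<sigma>min \<sigma>le r \<open>\<sigma>min > 0\<close> by blast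
    have "succ k0" using step(6)[OF r, of k0] k0(2) ns r by (force simp: succ_iff)
    \<comment> \<open>After \<open>k0\<close> each success leaves a gradient of norm at most
      \<epsilon> / 2, by the choice of \<open>K\<close>, and without success the iterate does not
      move.\<close>
    have half: "G (Suc k0 + j) \<le> \<epsilon> / 2" for j
    proof (induction j)
      case 0
      then show ?case using K[OF \<open>succ k0\<close>] k0(1) by force
    next
      case (Suc j)
      show ?case
      proof (cases "succ (Suc k0 + j)")
        case True
        then show ?thesis using K[OF True] k0(1) by force
      next
        case False
        then have "x (Suc (Suc k0 + j)) = x (Suc k0 + j)" using step(3)[OF r, of "Suc k0 + j"] ns r by (simp add: succ_iff)
        then show ?thesis using Suc by (simp add: G_def)
      qed
    qed
    have small: "norm (G m - 0) < \<epsilon>" if "m \<ge> Suc k0" for m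
    proof -
      from le_Suc_ex[OF that] obtain j where "m = Suc k0 + j" ..
      then have "G m \<le> \<epsilon> / 2" by (simp only: half)
      moreover have "G m \<ge> 0" by (simp add: G_def tnorm_nonneg)
      ultimately show ?thesis using \<epsilon> by simp
    qed
    show "\<exists>no. \<forall>m\<ge>no. norm (G m - 0) < \<epsilon>" using small by blast
  qed
  have "(f (x 0) - flow) / a = 3 * (f (x 0) - flow) / (\<eta>1 * \<sigma>min)" by (simp add: a_def)
  then show ?thesis using count lim unfolding succ_def G_def C_def by auto
qed

end
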